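(* Let $(\omega^1,\omega^2)$ be a bi-contact structure on a 3-manifold $M$ and let $C$ be the torsion function appearing in its 1-adapted structure equations. Then $C$ is an invariant function on $M$. Moreover, $C$ is the local obstruction for the bi-contact structure to be a taut contact circle or taut contact equilateral hyperbola.
   Context: A bi-contact structure on an orientable 3-manifold $M$ is a pair of contact distributions $(\mathcal{D}_1,\mathcal{D}_2)$ with $\mathcal{D}_1(p)\neq\mathcal{D}_2(p)$ for every $p\in M$; when $\mathcal{D}_i=\ker\omega^i$ one also calls $(\omega^1,\omega^2)$ the bi-contact structure. A bi-contactomorphism is a map $\Phi:M\to M$ that is a contactomorphism for both $\mathcal{D}_1$ and $\mathcal{D}_2$ simultaneously; "invariant" refers to equivalence under bi-contactomorphisms. A coframe $(\omega^1,\omega^2,\omega^3)$ with $\mathcal{D}_i=\ker\omega^i$ for $i=1,2$ is 1-adapted if it is normalized so that $\omega^1\wedge d\omega^1=-\epsilon\,\omega^2\wedge d\omega^2=\omega^1\wedge\omega^2\wedge\omega^3$ with $\epsilon=\pm1$. Two 1-adapted coframes are related by $\tilde\omega=g^{-1}\omega$ with $g=\begin{bmatrix} a & 0 & 0 \\ 0 & \delta a & 0 \\ b_1 & b_2 & \delta \end{bmatrix}$, $a\neq0$, $\delta=\pm1$. On the bundle of 1-adapted coframes the structure equations are $$d\omega^1=-\alpha\wedge\omega^1-C\omega^1\wedge\omega^3+\omega^2\wedge\omega^3,\quad d\omega^2=-\alpha\wedge\omega^2+\epsilon\,\omega^1\wedge\omega^3+C\omega^2\wedge\omega^3,\quad d\omega^3=-\beta_1\wedge\omega^1-\beta_2\wedge\omega^2,$$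 for 1-forms $\alpha,\beta_1,\beta_2$ and a function $C$; in particular $\omega^1\wedge d\omega^2+\omega^2\wedge d\omega^1=2C\,\omega^1\wedge\omega^2\wedge\omega^3$. For $a=(a_1,a_2)\in\mathbb{R}^2$ put $\omega_a=a_1\omega^1+a_2\omega^2$. The pair is a taut contact circle if $\omega_a$ is a contact form for every $a$ on the circle $a_1^2+a_2^2=1$ and the volume form $\omega_a\wedge d\omega_a$ is independent of such $a$. It is a taut contact equilateral hyperbola if $\omega_a$ is a contact form for every $a$ on the equilateral hyperbola $a_1^2-a_2^2=r$, $r=\pm1$, and $\omega_a\wedge d\omega_a=r\,\omega^1\wedge d\omega^1=-r\,\omega^2\wedge d\omega^2$ independently of such $a$.
   Formalization: Literal invariance of C fails: (ω1,−ω2,−ω3) is also 1-adapted, with torsion −C. Proved instead: C is invariant up to the sign δ=±1 comparing relative co-orientations (C'∘Φ=δC), hence strictly invariant when δ=1; the sign of C on M is fixed by the given forms ω1, ω2. *)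

theory Defs
  imports "HOL-Analysis.Analysis"
begin

section \<open>Smooth 3-manifolds\<close>

primrec Ck_on :: "nat \<Rightarrow> 'e::real_normed_vector set \<Rightarrow> ('e \<Rightarrow> 'f::real_normed_vector) \<Rightarrow> bool"
  where
    "Ck_on 0 S f \<longleftrightarrow> continuous_on S f"
  | "Ck_on (Suc k) S f \<longleftrightarrow>
       (\<forall>x\<in>S. f differentiable (at x)) \<and> (\<forall>v. Ck_on k S (\<lambda>x. frechet_derivative f (at x) v))"

(* Only used for open sets S. *)
definition smooth_on :: "'e::real_normed_vector set \<Rightarrow> ('e \<Rightarrow> 'f::real_normed_vector) \<Rightarrow> bool"
  where "smooth_on S f \<longleftrightarrow> (\<forall>k. Ck_on k S f)"

record 'a chart =
  chart_dom :: "'a set"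
  coords :: "'a \<Rightarrow> real ^ 3"

type_synonym 'a atlas = "'a chart set"

definition chart_inv :: "'a chart \<Rightarrow> real ^ 3 \<Rightarrow> 'a"
  where "chart_inv c = inv_into (chart_dom c) (coords c)"

(* The manifold M is the union of the chart domains, an open subset of the ambient type, which
   will be Hausdorff and second countable. *)
definition carrier :: "'a atlas \<Rightarrow> 'a set"
  where "carrier A = (\<Union>c\<in>A. chart_dom c)"

definition smooth_atlas :: "'a::topological_space atlas \<Rightarrow> bool"
  where "smooth_atlas A \<longleftrightarrow>
    (\<forall>c\<in>A. open (chart_dom c) \<and> open (coords c ` chart_dom c) \<and>
       homeomorphism (chart_dom c) (coords c ` chart_dom c) (coords c) (chart_inv c)) \<and>
    (\<forall>c\<in>A. \<forall>d\<in>A.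
       smooth_on (coords c ` (chart_dom c \<inter> chart_dom d)) (coords d \<circ> chart_inv c))"

definition open_in_manifold :: "'a::topological_space atlas \<Rightarrow> 'a set \<Rightarrow> bool"
  where "open_in_manifold A U \<longleftrightarrow> open U \<and> U \<subseteq> carrier A"

definition smooth_function :: "'a atlas \<Rightarrow> 'a set \<Rightarrow> ('a \<Rightarrow> real) \<Rightarrow> bool"
  where "smooth_function A U f \<longleftrightarrow>
    (\<forall>c\<in>A. smooth_on (coords c ` (chart_dom c \<inter> U)) (f \<circ> chart_inv c))"

definition smooth_map ::
    "'a::topological_space atlas \<Rightarrow> 'b::topological_space atlas \<Rightarrow> ('a \<Rightarrow> 'b) \<Rightarrow> bool"
  where "smooth_map A B \<Phi> \<longleftrightarrow>
    \<Phi> ` carrier A \<subseteq> carrier B \<and> continuous_on (carrier A) \<Phi> \<and>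
    (\<forall>c\<in>A. \<forall>d\<in>B.
       smooth_on (coords c ` (chart_dom c \<inter> \<Phi> -` chart_dom d)) (coords d \<circ> \<Phi> \<circ> chart_inv c))"

definition diffeomorphism ::
    "'a::topological_space atlas \<Rightarrow> 'b::topological_space atlas \<Rightarrow> ('a \<Rightarrow> 'b) \<Rightarrow> bool"
  where "diffeomorphism A B \<Phi> \<longleftrightarrow>
    bij_betw \<Phi> (carrier A) (carrier B) \<and> smooth_map A B \<Phi> \<and>
    smooth_map B A (inv_into (carrier A) \<Phi>)"

definition tangent_map ::
    "('a \<Rightarrow> 'b) \<Rightarrow> 'a chart \<Rightarrow> 'b chart \<Rightarrow> 'a \<Rightarrow> real ^ 3 \<Rightarrow> real ^ 3"
  where "tangent_map \<Phi> c d p =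
    frechet_derivative (coords d \<circ> \<Phi> \<circ> chart_inv c) (at (coords c p))"

section \<open>Differential forms\<close>

(* Tangent vectors at p are written in the coordinates of a chart c around p.  A form takes a chart c,
   a point p of its domain, and coordinate vectors; its representatives in different charts are
   related by the Jacobians of the chart changes (last clause of one_form).  Values outside
   the chart domain are irrelevant, so identities between forms are stated with eq1, eq2, eq3. *)
type_synonym 'a form1 = "'a chart \<Rightarrow> 'a \<Rightarrow> real ^ 3 \<Rightarrow> real"
type_synonym 'a form2 = "'a chart \<Rightarrow> 'a \<Rightarrow> real ^ 3 \<Rightarrow> real ^ 3 \<Rightarrow> real"
type_synonym 'a form3 = "'a chart \<Rightarrow> 'a \<Rightarrow> real ^ 3 \<Rightarrow> real ^ 3 \<Rightarrow> real ^ 3 \<Rightarrow> real"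

definition one_form :: "'a atlas \<Rightarrow> 'a set \<Rightarrow> 'a form1 \<Rightarrow> bool"
  where "one_form A U \<omega> \<longleftrightarrow>
    (\<forall>c\<in>A.
      (\<forall>p\<in>chart_dom c \<inter> U. linear (\<omega> c p)) \<and>
      (\<forall>v. smooth_on (coords c ` (chart_dom c \<inter> U)) (\<lambda>x. \<omega> c (chart_inv c x) v)) \<and>
      (\<forall>d\<in>A. \<forall>p\<in>chart_dom c \<inter> chart_dom d \<inter> U. \<forall>v.
         \<omega> c p v = \<omega> d p (tangent_map id c d p v)))"

definition eq1 :: "'a atlas \<Rightarrow> 'a set \<Rightarrow> 'a form1 \<Rightarrow> 'a form1 \<Rightarrow> bool"
  where "eq1 A U \<sigma> \<tau> \<longleftrightarrow> (\<forall>c\<in>A. \<forall>p\<in>chart_dom c \<inter> U. \<sigma> c p = \<tau> c p)"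

definition eq2 :: "'a atlas \<Rightarrow> 'a set \<Rightarrow> 'a form2 \<Rightarrow> 'a form2 \<Rightarrow> bool"
  where "eq2 A U \<sigma> \<tau> \<longleftrightarrow> (\<forall>c\<in>A. \<forall>p\<in>chart_dom c \<inter> U. \<sigma> c p = \<tau> c p)"

definition eq3 :: "'a atlas \<Rightarrow> 'a set \<Rightarrow> 'a form3 \<Rightarrow> 'a form3 \<Rightarrow> bool"
  where "eq3 A U \<sigma> \<tau> \<longleftrightarrow> (\<forall>c\<in>A. \<forall>p\<in>chart_dom c \<inter> U. \<sigma> c p = \<tau> c p)"

definition nowhere_zero3 :: "'a atlas \<Rightarrow> 'a set \<Rightarrow> 'a form3 \<Rightarrow> bool"
  where "nowhere_zero3 A U \<sigma> \<longleftrightarrow>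
    (\<forall>c\<in>A. \<forall>p\<in>chart_dom c \<inter> U. \<exists>u v w. \<sigma> c p u v w \<noteq> 0)"

definition wedge11 :: "'a form1 \<Rightarrow> 'a form1 \<Rightarrow> 'a form2"
  where "wedge11 \<sigma> \<tau> = (\<lambda>c p u v. \<sigma> c p u * \<tau> c p v - \<sigma> c p v * \<tau> c p u)"

definition wedge12 :: "'a form1 \<Rightarrow> 'a form2 \<Rightarrow> 'a form3"
  where "wedge12 \<sigma> \<tau> =
    (\<lambda>c p u v w. \<sigma> c p u * \<tau> c p v w + \<sigma> c p v * \<tau> c p w u + \<sigma> c p w * \<tau> c p u v)"

(* d\<omega>(u,v) = u(\<omega>(v)) - v(\<omega>(u)) for the constant coordinate fields u, v of the chart. *)
definition ext_d :: "'a form1 \<Rightarrow> 'a form2"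
  where "ext_d \<omega> = (\<lambda>c p u v.
    frechet_derivative (\<lambda>x. \<omega> c (chart_inv c x) v) (at (coords c p)) u -
    frechet_derivative (\<lambda>x. \<omega> c (chart_inv c x) u) (at (coords c p)) v)"

(* Well defined for one-forms: the result does not depend on the chart chosen around \<Phi> p. *)
definition pullback :: "'b atlas \<Rightarrow> ('a \<Rightarrow> 'b) \<Rightarrow> 'b form1 \<Rightarrow> 'a form1"
  where "pullback B \<Phi> \<theta> = (\<lambda>c p v.
    let d = (SOME d. d \<in> B \<and> \<Phi> p \<in> chart_dom d) in \<theta> d (\<Phi> p) (tangent_map \<Phi> c d p v))"

section \<open>Bi-contact structures\<close>

definition kern :: "'a form1 \<Rightarrow> 'a chart \<Rightarrow> 'a \<Rightarrow> (real ^ 3) set"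
  where "kern \<omega> c p = {v. \<omega> c p v = 0}"

definition same_distribution :: "'a atlas \<Rightarrow> 'a set \<Rightarrow> 'a form1 \<Rightarrow> 'a form1 \<Rightarrow> bool"
  where "same_distribution A U \<sigma> \<tau> \<longleftrightarrow>
    (\<forall>c\<in>A. \<forall>p\<in>chart_dom c \<inter> U. kern \<sigma> c p = kern \<tau> c p)"

definition contact_form :: "'a atlas \<Rightarrow> 'a set \<Rightarrow> 'a form1 \<Rightarrow> bool"
  where "contact_form A U \<omega> \<longleftrightarrow> one_form A U \<omega> \<and> nowhere_zero3 A U (wedge12 \<omega> (ext_d \<omega>))"

(* The volume form \<eta>1 \<and> d\<eta>1 orients the manifold, so orientability is not a separate hypothesis. *)
definition bi_contact :: "'a atlas \<Rightarrow> 'a form1 \<Rightarrow> 'a form1 \<Rightarrow> bool"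
  where "bi_contact A \<eta>1 \<eta>2 \<longleftrightarrow>
    contact_form A (carrier A) \<eta>1 \<and> contact_form A (carrier A) \<eta>2 \<and>
    (\<forall>c\<in>A. \<forall>p\<in>chart_dom c. kern \<eta>1 c p \<noteq> kern \<eta>2 c p)"

definition contactomorphism ::
    "'a::topological_space atlas \<Rightarrow> 'b::topological_space atlas \<Rightarrow> 'a form1 \<Rightarrow> 'b form1 \<Rightarrow>
     ('a \<Rightarrow> 'b) \<Rightarrow> bool"
  where "contactomorphism A B \<eta> \<theta> \<Phi> \<longleftrightarrow>
    diffeomorphism A B \<Phi> \<and>
    (\<forall>c\<in>A. \<forall>d\<in>B. \<forall>p\<in>chart_dom c. \<Phi> p \<in> chart_dom d \<longrightarrow>
       tangent_map \<Phi> c d p ` kern \<eta> c p = kern \<theta> d (\<Phi> p))"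

definition bi_contactomorphism ::
    "'a::topological_space atlas \<Rightarrow> 'b::topological_space atlas \<Rightarrow> 'a form1 \<Rightarrow> 'a form1 \<Rightarrow>
     'b form1 \<Rightarrow> 'b form1 \<Rightarrow> ('a \<Rightarrow> 'b) \<Rightarrow> bool"
  where "bi_contactomorphism A B \<eta>1 \<eta>2 \<theta>1 \<theta>2 \<Phi> \<longleftrightarrow>
    contactomorphism A B \<eta>1 \<theta>1 \<Phi> \<and> contactomorphism A B \<eta>2 \<theta>2 \<Phi>"

section \<open>Adapted coframes and the torsion function\<close>

definition adapted_coframe ::
    "'a atlas \<Rightarrow> 'a form1 \<Rightarrow> 'a form1 \<Rightarrow> 'a set \<Rightarrow> real \<Rightarrow> 'a form1 \<Rightarrow> 'a form1 \<Rightarrow> 'a form1 \<Rightarrow> bool"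
  where "adapted_coframe A \<eta>1 \<eta>2 U \<epsilon> \<omega>1 \<omega>2 \<omega>3 \<longleftrightarrow>
    (\<epsilon> = 1 \<or> \<epsilon> = -1) \<and>
    one_form A U \<omega>1 \<and> one_form A U \<omega>2 \<and> one_form A U \<omega>3 \<and>
    nowhere_zero3 A U (wedge12 \<omega>1 (wedge11 \<omega>2 \<omega>3)) \<and>
    same_distribution A U \<omega>1 \<eta>1 \<and> same_distribution A U \<omega>2 \<eta>2 \<and>
    eq3 A U (wedge12 \<omega>1 (ext_d \<omega>1)) (wedge12 \<omega>1 (wedge11 \<omega>2 \<omega>3)) \<and>
    eq3 A U (\<lambda>c p u v w. - \<epsilon> * wedge12 \<omega>2 (ext_d \<omega>2) c p u v w)
            (wedge12 \<omega>1 (wedge11 \<omega>2 \<omega>3))"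

definition structure_equations ::
    "'a atlas \<Rightarrow> 'a set \<Rightarrow> real \<Rightarrow> 'a form1 \<Rightarrow> 'a form1 \<Rightarrow> 'a form1 \<Rightarrow>
     'a form1 \<Rightarrow> 'a form1 \<Rightarrow> 'a form1 \<Rightarrow> ('a \<Rightarrow> real) \<Rightarrow> bool"
  where "structure_equations A U \<epsilon> \<omega>1 \<omega>2 \<omega>3 \<alpha> \<beta>1 \<beta>2 C \<longleftrightarrow>
    eq2 A U (ext_d \<omega>1) (\<lambda>c p u v.
      - wedge11 \<alpha> \<omega>1 c p u v - C p * wedge11 \<omega>1 \<omega>3 c p u v + wedge11 \<omega>2 \<omega>3 c p u v) \<and>
    eq2 A U (ext_d \<omega>2) (\<lambda>c p u v.
      - wedge11 \<alpha> \<omega>2 c p u v + \<epsilon> * wedge11 \<omega>1 \<omega>3 c p u v + C p * wedge11 \<omega>2 \<omega>3 c p u v) \<and>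
    eq2 A U (ext_d \<omega>3) (\<lambda>c p u v.
      - wedge11 \<beta>1 \<omega>1 c p u v - wedge11 \<beta>2 \<omega>2 c p u v)"

definition coframe_torsion ::
    "'a atlas \<Rightarrow> 'a set \<Rightarrow> real \<Rightarrow> 'a form1 \<Rightarrow> 'a form1 \<Rightarrow> 'a form1 \<Rightarrow> ('a \<Rightarrow> real) \<Rightarrow> bool"
  where "coframe_torsion A U \<epsilon> \<omega>1 \<omega>2 \<omega>3 C \<longleftrightarrow>
    smooth_function A U C \<and>
    (\<exists>\<alpha> \<beta>1 \<beta>2. one_form A U \<alpha> \<and> one_form A U \<beta>1 \<and> one_form A U \<beta>2 \<and>
       structure_equations A U \<epsilon> \<omega>1 \<omega>2 \<omega>3 \<alpha> \<beta>1 \<beta>2 C)"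

(* (\<omega>1,\<omega>2) = (f1 \<eta>1, f2 \<eta>2) with f1, f2 nowhere zero and \<delta> = sgn (f1 f2).  Between two adapted
   coframes this \<delta> is the diagonal entry \<delta> of the matrix g of the structure group. *)
definition relative_sign ::
    "'a atlas \<Rightarrow> 'a set \<Rightarrow> 'a form1 \<Rightarrow> 'a form1 \<Rightarrow> 'a form1 \<Rightarrow> 'a form1 \<Rightarrow> ('a \<Rightarrow> real) \<Rightarrow> bool"
  where "relative_sign A U \<eta>1 \<eta>2 \<omega>1 \<omega>2 \<delta> \<longleftrightarrow>
    (\<exists>f1 f2. (\<forall>p\<in>U. f1 p \<noteq> 0 \<and> f2 p \<noteq> 0 \<and> \<delta> p = sgn (f1 p * f2 p)) \<and>
       eq1 A U \<omega>1 (\<lambda>c p v. f1 p * \<eta>1 c p v) \<and> eq1 A U \<omega>2 (\<lambda>c p v. f2 p * \<eta>2 c p v))"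

(* C is the torsion of every adapted coframe of the distributions ker \<eta>1, ker \<eta>2.  The sign cannot
   be dropped: if (\<omega>1,\<omega>2,\<omega>3) is adapted with torsion C, then (\<omega>1,-\<omega>2,-\<omega>3) is adapted with
   torsion -C.  It is fixed by comparison with the given forms \<eta>1, \<eta>2. *)
definition torsion_function ::
    "'a::topological_space atlas \<Rightarrow> 'a form1 \<Rightarrow> 'a form1 \<Rightarrow> ('a \<Rightarrow> real) \<Rightarrow> bool"
  where "torsion_function A \<eta>1 \<eta>2 C \<longleftrightarrow>
    (\<forall>U \<epsilon> \<omega>1 \<omega>2 \<omega>3.
       open_in_manifold A U \<and> adapted_coframe A \<eta>1 \<eta>2 U \<epsilon> \<omega>1 \<omega>2 \<omega>3 \<longrightarrow>
       (\<exists>\<delta>. relative_sign A U \<eta>1 \<eta>2 \<omega>1 \<omega>2 \<delta> \<and>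
            coframe_torsion A U \<epsilon> \<omega>1 \<omega>2 \<omega>3 (\<lambda>p. \<delta> p * C p)))"

section \<open>Taut contact circles and equilateral hyperbolas\<close>

definition lin_comb :: "real \<Rightarrow> real \<Rightarrow> 'a form1 \<Rightarrow> 'a form1 \<Rightarrow> 'a form1"
  where "lin_comb a1 a2 \<omega>1 \<omega>2 = (\<lambda>c p v. a1 * \<omega>1 c p v + a2 * \<omega>2 c p v)"

definition contact_volume :: "'a form1 \<Rightarrow> 'a form3"
  where "contact_volume \<omega> = wedge12 \<omega> (ext_d \<omega>)"

definition taut_contact_circle :: "'a atlas \<Rightarrow> 'a set \<Rightarrow> 'a form1 \<Rightarrow> 'a form1 \<Rightarrow> bool"
  where "taut_contact_circle A U \<omega>1 \<omega>2 \<longleftrightarrow>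
    (\<forall>a1 a2. a1\<^sup>2 + a2\<^sup>2 = 1 \<longrightarrow> contact_form A U (lin_comb a1 a2 \<omega>1 \<omega>2)) \<and>
    (\<forall>a1 a2 b1 b2. a1\<^sup>2 + a2\<^sup>2 = 1 \<and> b1\<^sup>2 + b2\<^sup>2 = 1 \<longrightarrow>
       eq3 A U (contact_volume (lin_comb a1 a2 \<omega>1 \<omega>2)) (contact_volume (lin_comb b1 b2 \<omega>1 \<omega>2)))"

definition taut_contact_equilateral_hyperbola ::
    "'a atlas \<Rightarrow> 'a set \<Rightarrow> 'a form1 \<Rightarrow> 'a form1 \<Rightarrow> bool"
  where "taut_contact_equilateral_hyperbola A U \<omega>1 \<omega>2 \<longleftrightarrow>
    (\<forall>r\<in>{1, -1}. \<forall>a1 a2. a1\<^sup>2 - a2\<^sup>2 = r \<longrightarrow>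
       contact_form A U (lin_comb a1 a2 \<omega>1 \<omega>2) \<and>
       eq3 A U (contact_volume (lin_comb a1 a2 \<omega>1 \<omega>2))
               (\<lambda>c p u v w. r * contact_volume \<omega>1 c p u v w) \<and>
       eq3 A U (contact_volume (lin_comb a1 a2 \<omega>1 \<omega>2))
               (\<lambda>c p u v w. - r * contact_volume \<omega>2 c p u v w))"

definition locally_taut ::
    "'a::topological_space atlas \<Rightarrow> 'a form1 \<Rightarrow> 'a form1 \<Rightarrow> 'a \<Rightarrow> bool"
  where "locally_taut A \<eta>1 \<eta>2 p \<longleftrightarrow>
    (\<exists>U \<omega>1 \<omega>2. open_in_manifold A U \<and> p \<in> U \<and>
       same_distribution A U \<omega>1 \<eta>1 \<and> same_distribution A U \<omega>2 \<eta>2 \<and>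
       (taut_contact_circle A U \<omega>1 \<omega>2 \<or> taut_contact_equilateral_hyperbola A U \<omega>1 \<omega>2))"

end

theory Submission
  imports Defs
begin

text \<open>
  If \<open>(\<omega>1, \<omega>2, \<omega>3)\<close> is adapted, then \<open>\<omega>1 \<and> d\<omega>2 + \<omega>2 \<and> d\<omega>1 = 2C \<omega>1 \<and> d\<omega>1\<close>, so the torsion depends
  only on the pair \<open>(\<omega>1, \<omega>2)\<close>, which is normalised by \<open>\<bar>\<omega>1 \<and> d\<omega>1\<bar> = \<bar>\<omega>2 \<and> d\<omega>2\<bar>\<close>.  Two normalised
  pairs \<open>(\<omega>1, \<omega>2)\<close> and \<open>(f1 \<omega>1, f2 \<omega>2)\<close> satisfy \<open>f1\<^sup>2 = f2\<^sup>2\<close>.  Hence \<open>f2 df1 = f1 df2\<close>, the derivatives of the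
  factors cancel in \<open>\<omega>1 \<and> d\<omega>2 + \<omega>2 \<and> d\<omega>1\<close>, and the quotient changes only by the sign of \<open>f1 f2\<close>.
  Scaling \<open>\<eta>1\<close> by the positive root \<open>h\<close> of \<open>h\<^sup>2 \<bar>\<eta>1 \<and> d\<eta>1\<bar> = \<bar>\<eta>2 \<and> d\<eta>2\<bar>\<close> gives a global normalised pair, whose quotient
  is the torsion function; as exterior derivatives commute with pullbacks, it is invariant.
  Finally \<open>(a1 \<omega>1 + a2 \<omega>2) \<and> d(a1 \<omega>1 + a2 \<omega>2) = (a1\<^sup>2 - \<epsilon> a2\<^sup>2 + 2C a1 a2) \<omega>1 \<and> d\<omega>1\<close>, and the taut
  structures are exactly the normalised pairs whose mixed term vanishes.
\<close>

text \<open>Forms are families of chart representatives, so the argument rests on two facts about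
  chart changes: the exterior derivative commutes with smooth maps, which comes down to the symmetry
  of second derivatives, and the quotient of two three-forms is a function on the manifold, because
  both pick up the same Jacobian determinant. The relation f1^2 = f2^2 holds because df drops out of
  f \<omega> \<and> d(f \<omega>); its derivative is f1 df1 = f2 df2, and f1 = +-f2 at each point
  turns this into f2 df1 = f1 df2. Hence the factors have to be smooth, while equality of kernels
  supplies them only pointwise. Absolute values in the normalisation avoid a choice of \<epsilon>:
  it is only locally constant and may differ between components of the manifold. Adapted coframes,
  with their \<epsilon> and \<omega>3, are therefore constructed near a point only. They cannot be
  avoided: a torsion function is defined by a condition on all adapted coframes, which would
  determine nothing at a point that no adapted coframe reaches.\<close>

section \<open>Smooth functions on open sets\<close>

text \<open>\<open>Ck_on\<close> refers to derivatives at the points of \<open>S\<close>, hence to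
  values near them; openness of \<open>S\<close> is what makes these values the ones on
  \<open>S\<close>.\<close>

lemma Ck_on_cong:
  assumes "open S" "\<And>x. x \<in> S \<Longrightarrow> f x = g x" "Ck_on k S f"
  shows "Ck_on k S g"
  using assms(2,3)
proof (induction k arbitrary: f g)
  case 0
  then show ?case using continuous_on_cong[of S S f g] by simp
next
  case (Suc k)
  have f: "f differentiable (at x)" if "x \<in> S" for x
    using Suc.prems(2) that by simp
  have d: "(g has_derivative frechet_derivative f (at x)) (at x)" if "x \<in> S" for x
    by (rule has_derivative_transform_within_open[OF f[OF that, unfolded frechet_derivative_works] assms(1) that])
       (rule Suc.prems(1))
  have eq: "frechet_derivative f (at x) = frechet_derivative g (at x)" if "x \<in> S" for x
    using d[OF that] by (rule frechet_derivative_at)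
  have "Ck_on k S (\<lambda>x. frechet_derivative g (at x) v)" for v
  proof (rule Suc.IH)
    show "frechet_derivative f (at x) v = frechet_derivative g (at x) v" if "x \<in> S" for x
      by (simp only: eq[OF that])
    show "Ck_on k S (\<lambda>x. frechet_derivative f (at x) v)"
      using Suc.prems(2) by simp
  qed
  moreover have "g differentiable (at x)" if "x \<in> S" for x
    using d[OF that] by (rule differentiableI)
  ultimately show ?case by simp
qed

lemma Ck_on_subset: "Ck_on k T f \<Longrightarrow> S \<subseteq> T \<Longrightarrow> Ck_on k S f"
  by (induction k arbitrary: f) (auto intro: continuous_on_subset)

lemma Ck_on_SucD: "Ck_on (Suc k) S f \<Longrightarrow> Ck_on k S f"
proof (induction k arbitrary: f)
  case 0
  then show ?case
    by (auto intro!: continuous_at_imp_continuous_on differentiable_imp_continuous_within)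
next
  case (Suc k)
  then show ?case
    by (metis Ck_on.simps(2))
qed

text \<open>Used where the formula that exhibits smoothness changes from point to point: another
  vector in \<open>proportional_smooth\<close>, another chart in
  \<open>one_form_pullback\<close>.\<close>

lemma Ck_on_local:
  assumes "\<And>x. x \<in> S \<Longrightarrow> \<exists>T. open T \<and> x \<in> T \<and> Ck_on k T f"
  shows "Ck_on k S f"
  using assms
proof (induction k arbitrary: f)
  case 0
  have "continuous (at x) f" if "x \<in> S" for x
    using 0[OF that] by (auto simp: continuous_on_eq_continuous_at)
  then show ?case
    by (simp add: continuous_at_imp_continuous_on)
next
  case (Suc k)
  have "Ck_on k S (\<lambda>x. frechet_derivative f (at x) v)" for v
    by (rule Suc.IH) (use Suc.prems in force)
  moreover have "f differentiable (at x)" if "x \<in> S" for x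
    using Suc.prems[OF that] by auto
  ultimately show ?case by simp
qed

text \<open>\<open>frechet_derivative\<close> is a choice term; with this rule the inductions below
  can work with an explicit derivative instead.\<close>

lemma Ck_on_Suc_eqI:
  assumes "open S" "\<And>x. x \<in> S \<Longrightarrow> (f has_derivative f' x) (at x)"
    "\<And>v. Ck_on k S (\<lambda>x. f' x v)"
  shows "Ck_on (Suc k) S f"
proof -
  have "Ck_on k S (\<lambda>x. frechet_derivative f (at x) v)" for v
    by (rule Ck_on_cong[OF assms(1) _ assms(3)[of v]]) (rule fun_cong[OF frechet_derivative_at[OF assms(2)]])
  moreover have "f differentiable (at x)" if "x \<in> S" for x
    using assms(2)[OF that] by (rule differentiableI)
  ultimately show ?thesis
    by simp
qed

lemma Ck_on_Suc_has_derivative: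
  "Ck_on (Suc k) S f \<Longrightarrow> x \<in> S \<Longrightarrow> (f has_derivative frechet_derivative f (at x)) (at x)"
  unfolding frechet_derivative_works[symmetric] by simp

section \<open>Closure of C^k functions under sums, products, inverses, roots and
  composition\<close>

lemma Ck_on_const: "Ck_on k S (\<lambda>x. c)"
  by (induction k arbitrary: c) auto

lemma Ck_on_bounded_linear:
  assumes "open S" "bounded_linear h" "Ck_on k S f"
  shows "Ck_on k S (\<lambda>x. h (f x))"
  using assms(3)
proof (induction k arbitrary: f)
  case 0
  then show ?case using bounded_linear.continuous_on[OF assms(2)] by auto
next
  case (Suc k)
  show ?case
  proof (rule Ck_on_Suc_eqI[OF assms(1)])
    show "((\<lambda>x. h (f x)) has_derivative (\<lambda>v. h (frechet_derivative f (at x) v))) (at x)" if "x \<in> S" for x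
      by (rule bounded_linear.has_derivative[OF assms(2) Ck_on_Suc_has_derivative[OF Suc.prems that]])
    have "Ck_on k S (\<lambda>x. frechet_derivative f (at x) v)" for v
      using Suc.prems by simp
    then show "Ck_on k S (\<lambda>x. h (frechet_derivative f (at x) v))" for v
      by (rule Suc.IH)
  qed
qed

lemma Ck_on_add:
  assumes "open S" "Ck_on k S f" "Ck_on k S g"
  shows "Ck_on k S (\<lambda>x. f x + g x)"
  using assms(2,3)
proof (induction k arbitrary: f g)
  case 0
  then show ?case by (auto intro: continuous_on_add)
next
  case (Suc k)
  show ?case
  proof (rule Ck_on_Suc_eqI[OF assms(1)])
    show "((\<lambda>x. f x + g x) has_derivative
        (\<lambda>v. frechet_derivative f (at x) v + frechet_derivative g (at x) v)) (at x)" if "x \<in> S" for x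
      by (rule has_derivative_add[OF Ck_on_Suc_has_derivative[OF Suc.prems(1) that]
            Ck_on_Suc_has_derivative[OF Suc.prems(2) that]])
    show "Ck_on k S (\<lambda>x. frechet_derivative f (at x) v + frechet_derivative g (at x) v)" for v
      using Suc.prems by (intro Suc.IH) simp_all
  qed
qed

lemma Ck_on_mult:
  fixes f g :: "'e::real_normed_vector \<Rightarrow> real"
  assumes "open S" "Ck_on k S f" "Ck_on k S g"
  shows "Ck_on k S (\<lambda>x. f x * g x)"
  using assms(2,3)
proof (induction k arbitrary: f g)
  case 0
  then show ?case by (auto intro: continuous_on_mult)
next
  case (Suc k)
  have f: "Ck_on k S f" and g: "Ck_on k S g"
    and f': "\<And>v. Ck_on k S (\<lambda>x. frechet_derivative f (at x) v)"
    and g': "\<And>v. Ck_on k S (\<lambda>x. frechet_derivative g (at x) v)"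
    using Suc.prems by (blast dest: Ck_on_SucD, blast dest: Ck_on_SucD, simp_all)
  show ?case
  proof (rule Ck_on_Suc_eqI[OF assms(1)])
    show "((\<lambda>x. f x * g x) has_derivative
        (\<lambda>v. f x * frechet_derivative g (at x) v + frechet_derivative f (at x) v * g x)) (at x)"
      if "x \<in> S" for x
      by (rule has_derivative_mult[OF Ck_on_Suc_has_derivative[OF Suc.prems(1) that]
            Ck_on_Suc_has_derivative[OF Suc.prems(2) that]])
    show "Ck_on k S (\<lambda>x. f x * frechet_derivative g (at x) v + frechet_derivative f (at x) v * g x)" for v
      by (intro Ck_on_add assms(1) Suc.IH f g f' g')
  qed
qed

text \<open>The derivative of 1/f is -f'/f^2, so the induction hypothesis for 1/f itself, together
  with products, is enough.\<close>

lemma Ck_on_inverse: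
  fixes f :: "'e::real_normed_vector \<Rightarrow> real"
  assumes "open S" "Ck_on k S f" "\<And>x. x \<in> S \<Longrightarrow> f x \<noteq> 0"
  shows "Ck_on k S (\<lambda>x. inverse (f x))"
  using assms(2)
proof (induction k)
  case 0
  then show ?case using assms(3) by (auto intro: continuous_on_inverse)
next
  case (Suc k)
  have inv: "Ck_on k S (\<lambda>x. inverse (f x))"
    by (rule Suc.IH[OF Ck_on_SucD[OF Suc.prems]])
  show ?case
  proof (rule Ck_on_Suc_eqI[OF assms(1)])
    show "((\<lambda>x. inverse (f x)) has_derivative
        (\<lambda>v. (-1) * (inverse (f x) * frechet_derivative f (at x) v * inverse (f x)))) (at x)"
      if "x \<in> S" for x
      using Deriv.has_derivative_inverse[OF assms(3)[OF that] Ck_on_Suc_has_derivative[OF Suc.prems that]]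
      by simp
    show "Ck_on k S (\<lambda>x. (-1) * (inverse (f x) * frechet_derivative f (at x) v * inverse (f x)))" for v
      using Suc.prems inv by (intro Ck_on_mult Ck_on_const assms(1)) simp_all
  qed
qed

text \<open>As for the inverse: the derivative f'/(2 sqrt f) contains only f' and the inverse of the
  function to which the induction hypothesis applies.\<close>

lemma Ck_on_sqrt:
  fixes f :: "'e::real_normed_vector \<Rightarrow> real"
  assumes "open S" "Ck_on k S f" "\<And>x. x \<in> S \<Longrightarrow> f x > 0"
  shows "Ck_on k S (\<lambda>x. sqrt (f x))"
  using assms(2)
proof (induction k)
  case 0
  then show ?case by (auto intro: continuous_on_real_sqrt)
next
  case (Suc k)
  have s: "Ck_on k S (\<lambda>x. sqrt (f x))"
    by (rule Suc.IH[OF Ck_on_SucD[OF Suc.prems]])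
  have inv: "Ck_on k S (\<lambda>x. inverse (sqrt (f x)))"
    using assms(3) by (intro Ck_on_inverse s assms(1)) force
  show ?case
  proof (rule Ck_on_Suc_eqI[OF assms(1)])
    show "((\<lambda>x. sqrt (f x)) has_derivative
        (\<lambda>v. frechet_derivative f (at x) v * (1/2 * inverse (sqrt (f x))))) (at x)" if "x \<in> S" for x
    proof -
      have "(sqrt has_derivative (\<lambda>t. t * (1/2 * inverse (sqrt (f x))))) (at (f x))"
        by (rule has_derivative_eq_rhs[OF DERIV_real_sqrt[OF assms(3)[OF that], unfolded has_field_derivative_def]])
           (simp add: fun_eq_iff)
      from diff_chain_at[OF Ck_on_Suc_has_derivative[OF Suc.prems that] this]
      show ?thesis by (simp add: o_def)
    qed
    show "Ck_on k S (\<lambda>x. frechet_derivative f (at x) v * (1/2 * inverse (sqrt (f x))))" for v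
      using Suc.prems inv by (intro Ck_on_mult Ck_on_const assms(1)) simp_all
  qed
qed

lemma Ck_on_sum:
  assumes "open S" "finite I" "\<And>i. i \<in> I \<Longrightarrow> Ck_on k S (f i)"
  shows "Ck_on k S (\<lambda>x. \<Sum>i\<in>I. f i x)"
  using assms(2,3)
  by (induction I rule: finite_induct) (auto intro: Ck_on_const Ck_on_add[OF assms(1)])

lemma Ck_on_compose:
  fixes F :: "'e::real_normed_vector \<Rightarrow> 'd::euclidean_space" and f :: "'d \<Rightarrow> real"
  assumes "open S" "open T" "F ` S \<subseteq> T" "Ck_on k S F" "Ck_on k T f"
  shows "Ck_on k S (\<lambda>x. f (F x))"
  using assms(4,5)
proof (induction k arbitrary: f)
  case 0
  then show ?case using assms(3) by (auto intro: continuous_on_compose2)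
next
  case (Suc k)
  \<comment> \<open>\<open>Ck_on\<close> controls derivatives of \<open>f\<close> along fixed
    vectors only, but the chain rule evaluates one along the moving vector DF(v). Splitting that
    vector over \<open>Basis\<close> leaves partial derivatives of \<open>f\<close> composed with
    \<open>F\<close>, to which the induction hypothesis applies.\<close>
  define D where "D x v = (\<Sum>b\<in>Basis. frechet_derivative f (at (F x)) b * (frechet_derivative F (at x) v \<bullet> b))"
    for x v
  have "(f \<circ> F has_derivative D x) (at x)" if "x \<in> S" for x
  proof -
    have Fx: "F x \<in> T" using that assms(3) by blast
    have df: "(f has_derivative frechet_derivative f (at (F x))) (at (F x))"
      using Suc.prems(2) Fx by (rule Ck_on_Suc_has_derivative)
    have "frechet_derivative f (at (F x)) w = (\<Sum>b\<in>Basis. frechet_derivative f (at (F x)) b * (w \<bullet> b))" for w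
    proof -
      have "frechet_derivative f (at (F x)) (\<Sum>b\<in>Basis. (w \<bullet> b) *\<^sub>R b) =
          (\<Sum>b\<in>Basis. frechet_derivative f (at (F x)) ((w \<bullet> b) *\<^sub>R b))"
        by (rule linear_sum[OF has_derivative_linear[OF df]])
      also have "\<dots> = (\<Sum>b\<in>Basis. frechet_derivative f (at (F x)) b * (w \<bullet> b))"
        by (intro sum.cong) (auto simp: linear_scale[OF has_derivative_linear[OF df]])
      finally show ?thesis by (simp only: euclidean_representation)
    qed
    from this[symmetric] have "D x = frechet_derivative f (at (F x)) \<circ> frechet_derivative F (at x)"
      unfolding D_def fun_eq_iff o_def by blast
    then show ?thesis
      using diff_chain_at[OF Ck_on_Suc_has_derivative[OF Suc.prems(1) that] df] by simp
  qed
  then have d: "((\<lambda>x. f (F x)) has_derivative D x) (at x)" if "x \<in> S" for x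
    using that by (simp add: o_def)
  have "Ck_on k S (\<lambda>x. D x v)" for v
    unfolding D_def
  proof (intro Ck_on_sum Ck_on_mult assms(1))
    fix b :: 'd
    show "Ck_on k S (\<lambda>x. frechet_derivative f (at (F x)) b)"
      using Suc.prems by (intro Suc.IH) (rule Ck_on_SucD, assumption, simp)
    show "Ck_on k S (\<lambda>x. frechet_derivative F (at x) v \<bullet> b)"
      using Suc.prems(1) by (intro Ck_on_bounded_linear[OF assms(1) bounded_linear_inner_left]) simp
  qed auto
  with d show ?case
    by (metis Ck_on_Suc_eqI[OF assms(1), of "\<lambda>x. f (F x)" D])
qed

section \<open>The same rules for smooth functions\<close>

lemma smooth_on_cong:
  assumes "open S" "\<And>x. x \<in> S \<Longrightarrow> f x = g x" "smooth_on S f"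
  shows "smooth_on S g"
  unfolding smooth_on_def using Ck_on_cong[of S f g] assms(1,2) assms(3)[unfolded smooth_on_def] by blast

lemma smooth_on_subset: "smooth_on T f \<Longrightarrow> S \<subseteq> T \<Longrightarrow> smooth_on S f"
  unfolding smooth_on_def using Ck_on_subset by blast

lemma smooth_on_local:
  "(\<And>x. x \<in> S \<Longrightarrow> \<exists>T. open T \<and> x \<in> T \<and> smooth_on T f) \<Longrightarrow> smooth_on S f"
  unfolding smooth_on_def by (intro allI Ck_on_local) blast

lemma smooth_on_const: "smooth_on S (\<lambda>x. c)"
  unfolding smooth_on_def by (simp add: Ck_on_const)

lemma smooth_on_add:
  "open S \<Longrightarrow> smooth_on S f \<Longrightarrow> smooth_on S g \<Longrightarrow> smooth_on S (\<lambda>x. f x + g x)"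
  unfolding smooth_on_def by (simp add: Ck_on_add)

lemma smooth_on_mult:
  fixes f g :: "'e::real_normed_vector \<Rightarrow> real"
  shows "open S \<Longrightarrow> smooth_on S f \<Longrightarrow> smooth_on S g \<Longrightarrow> smooth_on S (\<lambda>x. f x * g x)"
  unfolding smooth_on_def by (simp add: Ck_on_mult)

lemma smooth_on_minus:
  fixes f :: "'e::real_normed_vector \<Rightarrow> real"
  shows "open S \<Longrightarrow> smooth_on S f \<Longrightarrow> smooth_on S (\<lambda>x. - f x)"
  using smooth_on_mult[OF _ smooth_on_const[of S "-1::real"], of f] by simp

lemma smooth_on_diff:
  fixes f :: "'e::real_normed_vector \<Rightarrow> real"
  shows "open S \<Longrightarrow> smooth_on S f \<Longrightarrow> smooth_on S g \<Longrightarrow> smooth_on S (\<lambda>x. f x - g x)"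
  using smooth_on_add[of S f "\<lambda>x. - g x"] smooth_on_minus[of S g] by simp

lemma smooth_on_divide:
  fixes f g :: "'e::real_normed_vector \<Rightarrow> real"
  shows "open S \<Longrightarrow> smooth_on S f \<Longrightarrow> smooth_on S g \<Longrightarrow> (\<And>x. x \<in> S \<Longrightarrow> g x \<noteq> 0) \<Longrightarrow>
    smooth_on S (\<lambda>x. f x / g x)"
  unfolding smooth_on_def by (simp add: divide_inverse Ck_on_mult Ck_on_inverse)

lemma smooth_on_sqrt:
  fixes f :: "'e::real_normed_vector \<Rightarrow> real"
  shows "open S \<Longrightarrow> smooth_on S f \<Longrightarrow> (\<And>x. x \<in> S \<Longrightarrow> f x > 0) \<Longrightarrow> smooth_on S (\<lambda>x. sqrt (f x))"
  unfolding smooth_on_def by (simp add: Ck_on_sqrt)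

lemma smooth_on_abs:
  fixes f :: "'e::real_normed_vector \<Rightarrow> real"
  assumes "open S" "smooth_on S f" "\<And>x. x \<in> S \<Longrightarrow> f x \<noteq> 0"
  shows "smooth_on S (\<lambda>x. \<bar>f x\<bar>)"
  using smooth_on_sqrt[OF assms(1) smooth_on_mult[OF assms(1,2,2)]] assms(3)
  by (auto simp: zero_less_mult_iff linorder_neq_iff)

lemma smooth_on_compose:
  fixes F :: "'e::real_normed_vector \<Rightarrow> 'd::euclidean_space" and f :: "'d \<Rightarrow> real"
  shows "open S \<Longrightarrow> open T \<Longrightarrow> F ` S \<subseteq> T \<Longrightarrow> smooth_on S F \<Longrightarrow> smooth_on T f \<Longrightarrow>
    smooth_on S (\<lambda>x. f (F x))"
  unfolding smooth_on_def using Ck_on_compose by blast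

lemma smooth_on_bounded_linear:
  "open S \<Longrightarrow> bounded_linear h \<Longrightarrow> smooth_on S f \<Longrightarrow> smooth_on S (\<lambda>x. h (f x))"
  unfolding smooth_on_def by (simp add: Ck_on_bounded_linear)

lemma smooth_on_frechet_derivative:
  "smooth_on S f \<Longrightarrow> smooth_on S (\<lambda>x. frechet_derivative f (at x) v)"
  unfolding smooth_on_def using Ck_on.simps(2)[of _ S f] by blast

lemma smooth_on_differentiable: "smooth_on S f \<Longrightarrow> x \<in> S \<Longrightarrow> f differentiable (at x)"
  unfolding smooth_on_def using Ck_on.simps(2)[of 0 S f] by blast

lemma smooth_on_has_derivative:
  "smooth_on S f \<Longrightarrow> x \<in> S \<Longrightarrow> (f has_derivative frechet_derivative f (at x)) (at x)"
  unfolding frechet_derivative_works[symmetric] by (rule smooth_on_differentiable)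

lemma smooth_on_continuous_on: "smooth_on S f \<Longrightarrow> continuous_on S f"
  unfolding smooth_on_def using Ck_on.simps(1)[of S f] by blast

section \<open>Symmetry of second derivatives\<close>

text \<open>The second difference is symmetric in \<open>u\<close> and \<open>v\<close>, which forces the mixed derivatives to agree.\<close>
lemma second_difference_mvt:
  fixes f :: "'e::real_normed_vector \<Rightarrow> real"
  assumes "smooth_on S f" "t > 0" "\<And>r s. 0 \<le> r \<Longrightarrow> r \<le> t \<Longrightarrow> 0 \<le> s \<Longrightarrow> s \<le> t \<Longrightarrow> x + r *\<^sub>R u + s *\<^sub>R v \<in> S"
  shows "\<exists>r s. 0 \<le> r \<and> r \<le> t \<and> 0 \<le> s \<and> s \<le> t \<and>
    f (x + t *\<^sub>R u + t *\<^sub>R v) - f (x + t *\<^sub>R u) - f (x + t *\<^sub>R v) + f x =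
    t * t * frechet_derivative (\<lambda>y. frechet_derivative f (at y) u) (at (x + r *\<^sub>R u + s *\<^sub>R v)) v"
proof -
  have along: "((\<lambda>r. h (y + r *\<^sub>R w)) has_real_derivative frechet_derivative h (at (y + r *\<^sub>R w)) w) (at r)"
    if "h differentiable (at (y + r *\<^sub>R w))" for h :: "'e \<Rightarrow> real" and y w r
  proof -
    have h: "(h has_derivative frechet_derivative h (at (y + r *\<^sub>R w))) (at (y + r *\<^sub>R w))"
      using that frechet_derivative_works by blast
    have "((\<lambda>r. y + r *\<^sub>R w) has_derivative (\<lambda>r. r *\<^sub>R w)) (at r)"
      by (auto intro!: derivative_eq_intros)
    from diff_chain_at[OF this h] show ?thesis
      unfolding has_field_derivative_def o_def
      by (simp add: linear_scale[OF has_derivative_linear[OF h]] mult.commute[of _ "frechet_derivative _ _ _"])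
  qed
  have diff: "f differentiable (at (x + r *\<^sub>R u + s *\<^sub>R v))"
    "(\<lambda>y. frechet_derivative f (at y) u) differentiable (at (x + r *\<^sub>R u + s *\<^sub>R v))"
    if "0 \<le> r" "r \<le> t" "0 \<le> s" "s \<le> t" for r s
    using assms(3)[OF that] smooth_on_differentiable[OF assms(1)]
      smooth_on_differentiable[OF smooth_on_frechet_derivative[OF assms(1)]] by auto
  \<comment> \<open>The second difference is \<open>g t - g 0\<close>. The mean value theorem is
    applied twice: to \<open>g\<close>, which leaves an increment of the derivative along
    \<open>u\<close> over the segment t v, and then to that increment.\<close>
  define g where "g r = f (x + t *\<^sub>R v + r *\<^sub>R u) - f (x + r *\<^sub>R u)" for r
  define g' where "g' r = frechet_derivative f (at (x + t *\<^sub>R v + r *\<^sub>R u)) u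
      - frechet_derivative f (at (x + r *\<^sub>R u)) u" for r
  have "(g has_real_derivative g' r) (at r)" if "0 \<le> r" "r \<le> t" for r
    unfolding g_def g'_def
    using diff(1)[OF that, of t] diff(1)[OF that, of 0] assms(2)
    by (intro DERIV_diff along) (auto simp: algebra_simps)
  from MVT2[OF assms(2) this] obtain r where r: "0 < r" "r < t" "g t - g 0 = t * g' r"
    by auto
  define h where "h s = frechet_derivative f (at (x + r *\<^sub>R u + s *\<^sub>R v)) u" for s
  define h' where "h' s = frechet_derivative (\<lambda>y. frechet_derivative f (at y) u) (at (x + r *\<^sub>R u + s *\<^sub>R v)) v" for s
  have "(h has_real_derivative h' s) (at s)" if "0 \<le> s" "s \<le> t" for s
    unfolding h_def h'_def
    using diff(2)[OF _ _ that, of r] r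
    by (intro along[where h = "\<lambda>y. frechet_derivative f (at y) u"]) auto
  from MVT2[OF assms(2) this] obtain s where s: "0 < s" "s < t" "h t - h 0 = t * h' s"
    by auto
  have "h t - h 0 = g' r"
    unfolding h_def g'_def by (simp add: algebra_simps)
  then have "g t - g 0 = t * t * h' s"
    using r s by simp
  then show ?thesis
    unfolding g_def h'_def using r s
    by (intro exI[of _ r] exI[of _ s]) (simp add: algebra_simps)
qed

lemma smooth_on_second_derivative_symmetric:
  fixes f :: "'e::real_normed_vector \<Rightarrow> real"
  assumes "open S" "smooth_on S f" "x \<in> S"
  shows "frechet_derivative (\<lambda>y. frechet_derivative f (at y) u) (at x) v =
         frechet_derivative (\<lambda>y. frechet_derivative f (at y) v) (at x) u"
proof (rule ccontr)
  define P where "P u v y = frechet_derivative (\<lambda>y. frechet_derivative f (at y) u) (at y) v" for u v y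
  assume "\<not> ?thesis"
  then have neq: "P u v x \<noteq> P v u x" by (simp add: P_def)
  \<comment> \<open>Half the supposed gap. The two mixed derivatives, each at a suitable point near
    \<open>x\<close>, have the same value; if both are within \<open>e\<close> of their values at
    \<open>x\<close>, the gap is less than 2e, that is, less than itself.\<close>
  define e where "e = \<bar>P u v x - P v u x\<bar> / 2"
  have e: "e > 0" using neq by (simp add: e_def)
  have cont: "isCont (P u v) x" for u v
    unfolding P_def using assms smooth_on_continuous_on[OF smooth_on_frechet_derivative[OF
        smooth_on_frechet_derivative[OF assms(2)]]] continuous_on_eq_continuous_at by blast
  have ev: "\<forall>\<^sub>F y in nhds x. dist (P u v y) (P u v x) < e" for u v
    by (rule tendstoD[OF cont[of u v, unfolded isCont_def tendsto_at_iff_tendsto_nhds] e])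
  have "\<forall>\<^sub>F y in nhds x. y \<in> S"
    using assms by (simp add: eventually_nhds_in_open)
  then have "\<forall>\<^sub>F y in nhds x. y \<in> S \<and> dist (P u v y) (P u v x) < e \<and> dist (P v u y) (P v u x) < e"
    using ev by (intro eventually_conj) auto
  then obtain d where d: "d > 0"
    "\<And>y. dist y x < d \<Longrightarrow> y \<in> S \<and> dist (P u v y) (P u v x) < e \<and> dist (P v u y) (P v u x) < e"
    unfolding eventually_nhds_metric by auto
  \<comment> \<open>The parallelogram with sides t u and t v then stays within d/2 of
    \<open>x\<close>; the summand 1 keeps the denominator positive when \<open>u\<close> and
    \<open>v\<close> vanish.\<close>
  define t where "t = d / (2 * (norm u + norm v + 1))"
  have n: "norm u + norm v + 1 > 0" by (smt (verit) norm_ge_zero)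
  have t: "t > 0" using d n by (simp add: t_def)
  have near: "dist (x + r *\<^sub>R u + s *\<^sub>R v) x < d" if "0 \<le> r" "r \<le> t" "0 \<le> s" "s \<le> t" for r s
  proof -
    have "dist (x + r *\<^sub>R u + s *\<^sub>R v) x \<le> r * norm u + s * norm v"
      using that norm_triangle_ineq[of "r *\<^sub>R u" "s *\<^sub>R v"] by (simp add: dist_norm algebra_simps)
    also have "\<dots> \<le> t * norm u + t * norm v"
      using that by (intro add_mono mult_right_mono) auto
    also have "\<dots> \<le> t * (norm u + norm v + 1)"
      using t by (simp add: algebra_simps)
    also have "\<dots> = d / 2"
    proof -
      have "d / (2 * N) * N = d / 2" if "N > 0" for N :: real
        using that by simp
      from this[OF n] show ?thesis unfolding t_def .
    qed
    finally show ?thesis using d by simp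
  qed
  have near': "dist (x + r *\<^sub>R v + s *\<^sub>R u) x < d" if "0 \<le> r" "r \<le> t" "0 \<le> s" "s \<le> t" for r s
    using near[of s r] that by (simp add: algebra_simps)
  obtain r s where 1: "0 \<le> r" "r \<le> t" "0 \<le> s" "s \<le> t"
    "f (x + t *\<^sub>R u + t *\<^sub>R v) - f (x + t *\<^sub>R u) - f (x + t *\<^sub>R v) + f x = t * t * P u v (x + r *\<^sub>R u + s *\<^sub>R v)"
    using second_difference_mvt[OF assms(2) t, of x u v] d(2) near unfolding P_def by blast
  obtain r' s' where 2: "0 \<le> r'" "r' \<le> t" "0 \<le> s'" "s' \<le> t"
    "f (x + t *\<^sub>R v + t *\<^sub>R u) - f (x + t *\<^sub>R v) - f (x + t *\<^sub>R u) + f x = t * t * P v u (x + r' *\<^sub>R v + s' *\<^sub>R u)"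
    using second_difference_mvt[OF assms(2) t, of x v u] d(2) near' unfolding P_def by blast
  have "x + t *\<^sub>R v + t *\<^sub>R u = x + t *\<^sub>R u + t *\<^sub>R v" by simp
  with 1(5) 2(5) have "t * t * P u v (x + r *\<^sub>R u + s *\<^sub>R v) = t * t * P v u (x + r' *\<^sub>R v + s' *\<^sub>R u)"
    by (metis add.commute diff_diff_eq)
  then have "P u v (x + r *\<^sub>R u + s *\<^sub>R v) = P v u (x + r' *\<^sub>R v + s' *\<^sub>R u)"
    using t by simp
  moreover have "\<bar>P u v (x + r *\<^sub>R u + s *\<^sub>R v) - P u v x\<bar> < e"
    using d(2)[OF near[OF 1(1-4)]] by (simp add: dist_real_def)
  moreover have "\<bar>P v u (x + r' *\<^sub>R v + s' *\<^sub>R u) - P v u x\<bar> < e"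
    using d(2)[OF near'[OF 2(1-4)]] by (simp add: dist_real_def)
  ultimately have "\<bar>P u v x - P v u x\<bar> < 2 * e"
    by linarith
  then show False
    by (simp add: e_def)
qed

section \<open>Alternating forms on three-dimensional space\<close>

text \<open>Linearity is asked for in the second argument only; antisymmetry carries it over to the
  first.\<close>

definition alt2 :: "(real ^ 3 \<Rightarrow> real ^ 3 \<Rightarrow> real) \<Rightarrow> bool"
  where "alt2 t \<longleftrightarrow> (\<forall>u. linear (t u)) \<and> (\<forall>u v. t u v = - t v u)"

abbreviation ee :: "3 \<Rightarrow> real ^ 3"
  where "ee i \<equiv> axis i 1"

text \<open>The triple product u . (v x w), written out so that identities about it are polynomial
  identities in the coordinates.\<close>

definition det3 :: "real ^ 3 \<Rightarrow> real ^ 3 \<Rightarrow> real ^ 3 \<Rightarrow> real"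
  where "det3 u v w = u $ 1 * (v $ 2 * w $ 3 - v $ 3 * w $ 2) + u $ 2 * (v $ 3 * w $ 1 - v $ 1 * w $ 3)
    + u $ 3 * (v $ 1 * w $ 2 - v $ 2 * w $ 1)"

lemma linear_expand3:
  fixes s :: "real ^ 3 \<Rightarrow> real"
  assumes "linear s"
  shows "s u = u $ 1 * s (ee 1) + u $ 2 * s (ee 2) + u $ 3 * s (ee 3)"
proof -
  have "u = u $ 1 *\<^sub>R ee 1 + u $ 2 *\<^sub>R ee 2 + u $ 3 *\<^sub>R ee 3"
    by (simp add: vec_eq_iff axis_def forall_3)
  then have "s u = s (u $ 1 *\<^sub>R ee 1 + u $ 2 *\<^sub>R ee 2 + u $ 3 *\<^sub>R ee 3)"
    by simp
  then show ?thesis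
    by (simp add: linear_add[OF assms] linear_scale[OF assms])
qed

lemma alt2_expand:
  assumes "alt2 t"
  shows "t u v = (u $ 1 * v $ 2 - u $ 2 * v $ 1) * t (ee 1) (ee 2)
    + (u $ 2 * v $ 3 - u $ 3 * v $ 2) * t (ee 2) (ee 3)
    + (u $ 3 * v $ 1 - u $ 1 * v $ 3) * t (ee 3) (ee 1)"
proof -
  have lin: "linear (t u)" for u
    using assms unfolding alt2_def by blast
  have anti: "t u v = - t v u" for u v
    using assms unfolding alt2_def by blast
  have z: "t u u = 0" for u using anti[of u u] by linarith
  have "t u v = v $ 1 * t u (ee 1) + v $ 2 * t u (ee 2) + v $ 3 * t u (ee 3)"
    by (rule linear_expand3[OF lin])
  moreover have "t u (ee i) = - (u $ 1 * t (ee i) (ee 1) + u $ 2 * t (ee i) (ee 2) + u $ 3 * t (ee i) (ee 3))" for i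
    by (subst anti) (simp only: linear_expand3[OF lin, symmetric])
  ultimately show ?thesis
    by (simp only: z anti[of "ee 2" "ee 1"] anti[of "ee 3" "ee 2"] anti[of "ee 1" "ee 3"]) (simp add: algebra_simps)
qed

definition wedge_at :: "(real ^ 3 \<Rightarrow> real) \<Rightarrow> (real ^ 3 \<Rightarrow> real ^ 3 \<Rightarrow> real) \<Rightarrow> real ^ 3 \<Rightarrow> real ^ 3 \<Rightarrow> real ^ 3 \<Rightarrow> real"
  where "wedge_at s t u v w = s u * t v w + s v * t w u + s w * t u v"

text \<open>Alternating three-forms on a three-dimensional space form a line. One value on the
  standard basis therefore decides every question about such a form, and quotients of three-forms
  make sense.\<close>

lemma wedge_at_det3:
  assumes "linear s" "alt2 t"
  shows "wedge_at s t u v w = wedge_at s t (ee 1) (ee 2) (ee 3) * det3 u v w"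
  unfolding wedge_at_def det3_def
  by (simp only: linear_expand3[OF assms(1), of u] linear_expand3[OF assms(1), of v]
      linear_expand3[OF assms(1), of w] alt2_expand[OF assms(2), of v w] alt2_expand[OF assms(2), of w u]
      alt2_expand[OF assms(2), of u v]) algebra

lemma alt2_wedge:
  fixes s t :: "real ^ 3 \<Rightarrow> real"
  assumes "linear s" "linear t"
  shows "alt2 (\<lambda>u v. s u * t v - s v * t u)"
  unfolding alt2_def
  by (auto intro!: linearI simp: linear_add[OF assms(1)] linear_scale[OF assms(1)]
      linear_add[OF assms(2)] linear_scale[OF assms(2)] algebra_simps)

text \<open>When t is written in terms of the products of s1, s2, s3, the wedge product with each s
  isolates one coefficient; the minus sign comes from s2 \<and> s1 \<and> s3 = -(s1 \<and> s2 \<and>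
  s3). Cleared of the denominator N, this is a polynomial identity.\<close>

lemma coframe_expansion:
  fixes s1 s2 s3 :: "real ^ 3 \<Rightarrow> real"
  assumes "linear s1" "linear s2" "linear s3" "alt2 t"
  defines "N \<equiv> wedge_at s1 (\<lambda>u v. s2 u * s3 v - s2 v * s3 u) (ee 1) (ee 2) (ee 3)"
  shows "N * t u v = wedge_at s3 t (ee 1) (ee 2) (ee 3) * (s1 u * s2 v - s1 v * s2 u)
    - wedge_at s2 t (ee 1) (ee 2) (ee 3) * (s1 u * s3 v - s1 v * s3 u)
    + wedge_at s1 t (ee 1) (ee 2) (ee 3) * (s2 u * s3 v - s2 v * s3 u)"
  unfolding N_def wedge_at_def
  by (simp only: linear_expand3[OF assms(1), of u] linear_expand3[OF assms(1), of v]
      linear_expand3[OF assms(2), of u] linear_expand3[OF assms(2), of v]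
      linear_expand3[OF assms(3), of u] linear_expand3[OF assms(3), of v]
      alt2_expand[OF assms(4), of u v]) algebra

text \<open>If all three products s \<and> t \<and> dx_i vanished, so would all 2x2 minors of s and
  t, and nonzero proportional forms have the same kernel. This supplies the third member of a
  coframe as a coordinate differential.\<close>

lemma exists_transverse_coordinate:
  fixes s t :: "real ^ 3 \<Rightarrow> real"
  assumes "linear s" "linear t" "s \<noteq> (\<lambda>_. 0)" "t \<noteq> (\<lambda>_. 0)" "{v. s v = 0} \<noteq> {v. t v = 0}"
  shows "\<exists>i. wedge_at s (\<lambda>u v. t u * v $ i - t v * u $ i) (ee 1) (ee 2) (ee 3) \<noteq> 0"
proof (rule ccontr)
  assume "\<not> ?thesis"
  then have z: "wedge_at s (\<lambda>u v. t u * v $ i - t v * u $ i) (ee 1) (ee 2) (ee 3) = 0" for i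
    by blast
  have c: "s (ee 1) * t (ee 2) = s (ee 2) * t (ee 1)"
    "s (ee 2) * t (ee 3) = s (ee 3) * t (ee 2)"
    "s (ee 1) * t (ee 3) = s (ee 3) * t (ee 1)"
    using z[of 3] z[of 1] z[of 2] by (simp_all add: wedge_at_def axis_def)
  have cross: "s u * t v = s v * t u" for u v
    by (simp only: linear_expand3[OF assms(1), of u] linear_expand3[OF assms(1), of v]
      linear_expand3[OF assms(2), of u] linear_expand3[OF assms(2), of v]) (use c in algebra)
  obtain u where u: "s u \<noteq> 0" using assms(3) by blast
  obtain w where w: "t w \<noteq> 0" using assms(4) by blast
  have "s v = 0 \<longleftrightarrow> t v = 0" for v
    using cross[of u v] cross[of w v] u w by auto
  with assms(5) show False by blast
qed

lemma proportional_if_kernel_eq: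
  fixes s t :: "'e::real_vector \<Rightarrow> real"
  assumes "linear s" "linear t" "{v. s v = 0} = {v. t v = 0}" "t w \<noteq> 0"
  shows "s v = s w / t w * t v" "s w \<noteq> 0"
proof -
  have "t (t w *\<^sub>R v - t v *\<^sub>R w) = 0"
    by (simp add: linear_diff[OF assms(2)] linear_scale[OF assms(2)])
  then have "s (t w *\<^sub>R v - t v *\<^sub>R w) = 0"
    using assms(3) by blast
  then have "t w * s v = t v * s w"
    by (simp add: linear_diff[OF assms(1)] linear_scale[OF assms(1)])
  then show "s v = s w / t w * t v"
    using assms(4) by (simp add: field_simps)
  show "s w \<noteq> 0" using assms(3,4) by blast
qed

section \<open>The exterior derivative in one coordinate system\<close>

definition coord_d :: "(real ^ 3 \<Rightarrow> real ^ 3 \<Rightarrow> real) \<Rightarrow> real ^ 3 \<Rightarrow> real ^ 3 \<Rightarrow> real ^ 3 \<Rightarrow> real"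
  where "coord_d a x u v = frechet_derivative (\<lambda>y. a y v) (at x) u - frechet_derivative (\<lambda>y. a y u) (at x) v"

lemma frechet_derivative_eqI: "(f has_derivative f') (at x) \<Longrightarrow> frechet_derivative f (at x) = f'"
  by (rule frechet_derivative_at[symmetric])

lemma frechet_derivative_local_eqI:
  assumes "open S" "x \<in> S" "\<And>y. y \<in> S \<Longrightarrow> f y = g y" "(g has_derivative f') (at x)"
  shows "frechet_derivative f (at x) = f'"
  by (rule frechet_derivative_eqI, rule has_derivative_transform_within_open[OF assms(4,1,2)])
     (simp add: assms(3))

text \<open>Of the two terms, one is linear in a given vector because a derivative is, the other
  because the values \<open>a y\<close> are; the latter has to hold near \<open>x\<close>, as it is
  differentiated.\<close>

lemma alt2_coord_d:
  assumes "open S" "x \<in> S" "\<And>y. y \<in> S \<Longrightarrow> linear (a y)"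
    "\<And>v. (\<lambda>y. a y v) differentiable (at x)"
  shows "alt2 (coord_d a x)"
proof -
  define D where "D v = frechet_derivative (\<lambda>y. a y v) (at x)" for v
  have D: "((\<lambda>y. a y v) has_derivative D v) (at x)" for v
    unfolding D_def using assms(4) by (simp only: frechet_derivative_works)
  have add: "D (v + w) = (\<lambda>u. D v u + D w u)" for v w
    unfolding D_def[of "v + w"]
    by (rule frechet_derivative_local_eqI[OF assms(1,2) _ has_derivative_add[OF D D]])
       (simp add: linear_add[OF assms(3)])
  have scale: "D (r *\<^sub>R v) = (\<lambda>u. r * D v u)" for r v
    unfolding D_def[of "r *\<^sub>R v"]
    by (rule frechet_derivative_local_eqI[OF assms(1,2) _ has_derivative_mult_right[OF D]])
       (simp add: linear_scale[OF assms(3)])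
  have "coord_d a x = (\<lambda>u v. D v u - D u v)"
    by (simp add: coord_d_def D_def fun_eq_iff)
  moreover have "linear (D v)" for v
    using D by (rule has_derivative_linear)
  ultimately show ?thesis
    unfolding alt2_def
    by (auto intro!: linearI simp: add scale linear_add linear_scale algebra_simps)
qed

text \<open>Differentiating b(F y)(DF y v) in direction u gives the derivative of b, evaluated on DF
  u and DF v, and b applied to the second derivative of F (\<open>H\<close> in the proof). The
  second part is symmetric in u and v and drops out of the antisymmetrised expression.\<close>

lemma coord_d_pullback:
  fixes F :: "real ^ 3 \<Rightarrow> real ^ 3"
  assumes "open S" "x \<in> S" "smooth_on S F" "open T" "F ` S \<subseteq> T"
    and lin: "\<And>y. y \<in> T \<Longrightarrow> linear (b y)"
    and smo: "\<And>v. smooth_on T (\<lambda>y. b y v)"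
    and a: "\<And>y v. y \<in> S \<Longrightarrow> a y v = b (F y) (frechet_derivative F (at y) v)"
  shows "coord_d a x u v = coord_d b (F x) (frechet_derivative F (at x) u) (frechet_derivative F (at x) v)"
proof -
  define DF where "DF y = frechet_derivative F (at y)" for y
  have Fx: "F x \<in> T" using assms by blast
  have DF: "(F has_derivative DF y) (at y)" if "y \<in> S" for y
    unfolding DF_def using smooth_on_has_derivative[OF assms(3) that] .
  have comp: "((\<lambda>y. F y $ i) has_derivative (\<lambda>u. DF y u $ i)) (at y)" if "y \<in> S" for y i
    using DF[OF that] by (rule bounded_linear.has_derivative[OF bounded_linear_vec_nth])
  have smc: "smooth_on S (\<lambda>y. F y $ i)" for i
    by (rule smooth_on_bounded_linear[OF assms(1) bounded_linear_vec_nth assms(3)])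
  define H where "H i v = frechet_derivative (\<lambda>y. DF y v $ i) (at x)" for i v
  have "smooth_on S (\<lambda>y. DF y v $ i)" for i v
    unfolding DF_def
    by (rule smooth_on_bounded_linear[OF assms(1) bounded_linear_vec_nth smooth_on_frechet_derivative[OF assms(3)]])
  then have H: "((\<lambda>y. DF y v $ i) has_derivative H i v) (at x)" for i v
    unfolding H_def using smooth_on_has_derivative assms(2) by blast
  have Hsym: "H i v u = H i u v" for i u v
  proof -
    have "frechet_derivative (\<lambda>y. frechet_derivative (\<lambda>y. F y $ i) (at y) v) (at x) = H i v" for v
    proof (rule frechet_derivative_local_eqI[OF assms(1,2) _ H])
      show "frechet_derivative (\<lambda>y. F y $ i) (at y) v = DF y v $ i" if "y \<in> S" for y
        using frechet_derivative_eqI[OF comp[OF that, of i]] by simp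
    qed
    then show ?thesis
      using smooth_on_second_derivative_symmetric[OF assms(1) smc[of i] assms(2), of v u] by simp
  qed
  define E where "E v = frechet_derivative (\<lambda>y. b y v) (at (F x))" for v
  have E: "((\<lambda>y. b y v) has_derivative E v) (at (F x))" for v
    unfolding E_def using smooth_on_has_derivative[OF smo Fx] .
  have bE: "((\<lambda>y. b (F y) w) has_derivative (\<lambda>u. E w (DF x u))) (at x)" for w
    using diff_chain_at[OF DF[OF assms(2)] E[of w]] by (simp add: o_def)
  have Eexp: "E w = (\<lambda>u. w $ 1 * E (ee 1) u + w $ 2 * E (ee 2) u + w $ 3 * E (ee 3) u)" for w
    unfolding E_def[of w]
    by (rule frechet_derivative_local_eqI[OF assms(4) Fx linear_expand3[OF lin]])
       (auto intro!: has_derivative_add has_derivative_mult_right E)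
  have Da: "frechet_derivative (\<lambda>y. a y v) (at x) u =
      E (DF x v) (DF x u) + (H 1 v u * b (F x) (ee 1) + H 2 v u * b (F x) (ee 2) + H 3 v u * b (F x) (ee 3))"
    for u v
  proof -
    have aeq: "a y v = DF y v $ 1 * b (F y) (ee 1) + DF y v $ 2 * b (F y) (ee 2) + DF y v $ 3 * b (F y) (ee 3)"
      if "y \<in> S" for y
      using linear_expand3[OF lin, of "F y" "DF y v"] a[OF that, of v] that assms(5) by (auto simp: DF_def)
    have d: "((\<lambda>y. DF y v $ 1 * b (F y) (ee 1) + DF y v $ 2 * b (F y) (ee 2) + DF y v $ 3 * b (F y) (ee 3))
      has_derivative (\<lambda>u. (DF x v $ 1 * E (ee 1) (DF x u) + H 1 v u * b (F x) (ee 1))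
         + (DF x v $ 2 * E (ee 2) (DF x u) + H 2 v u * b (F x) (ee 2))
         + (DF x v $ 3 * E (ee 3) (DF x u) + H 3 v u * b (F x) (ee 3)))) (at x)"
      by (intro has_derivative_add has_derivative_mult bE H)
    from frechet_derivative_local_eqI[OF assms(1,2) aeq d] show ?thesis
      by (simp add: Eexp[of "DF x v"])
  qed
  show ?thesis
    unfolding coord_d_def Da unfolding DF_def[symmetric] E_def[symmetric]
    by (simp add: Hsym[of _ v u])
qed

lemma coord_d_scale:
  assumes "open S" "x \<in> S" "\<And>y v. y \<in> S \<Longrightarrow> a' y v = f y * a y v"
    "f differentiable (at x)" "\<And>v. (\<lambda>y. a y v) differentiable (at x)"
  shows "coord_d a' x u v = f x * coord_d a x u v +
    (frechet_derivative f (at x) u * a x v - frechet_derivative f (at x) v * a x u)"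
proof -
  have "frechet_derivative (\<lambda>y. a' y v) (at x) = (\<lambda>u. f x * frechet_derivative (\<lambda>y. a y v) (at x) u
      + frechet_derivative f (at x) u * a x v)" for v
    by (rule frechet_derivative_local_eqI[OF assms(1,2) assms(3)[of _ v]])
       (use assms(4,5) in \<open>auto intro!: has_derivative_mult simp only: frechet_derivative_works\<close>)
  then show ?thesis
    by (simp add: coord_d_def algebra_simps)
qed

lemma coord_d_lin_comb:
  assumes "\<And>v. (\<lambda>y. a y v) differentiable (at x)" "\<And>v. (\<lambda>y. b y v) differentiable (at x)"
  shows "coord_d (\<lambda>y v. r * a y v + s * b y v) x u v = r * coord_d a x u v + s * coord_d b x u v"
proof -
  have "frechet_derivative (\<lambda>y. r * a y v + s * b y v) (at x) =
     (\<lambda>u. r * frechet_derivative (\<lambda>y. a y v) (at x) u + s * frechet_derivative (\<lambda>y. b y v) (at x) u)" for v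
    by (rule frechet_derivative_eqI)
       (use assms in \<open>auto intro!: has_derivative_add has_derivative_mult_right simp only: frechet_derivative_works\<close>)
  then show ?thesis
    by (simp add: coord_d_def algebra_simps)
qed

text \<open>Stated for a single triple \<open>p\<close>, \<open>q\<close>, \<open>r\<close>, since a
  three-form on R^3 is determined by its value on one basis; it is applied to the standard
  basis.\<close>

lemma normalised_pair_torsion:
  assumes S: "open S" "x \<in> S"
    and a': "\<And>y v. y \<in> S \<Longrightarrow> a1' y v = f1 y * a1 y v" "\<And>y v. y \<in> S \<Longrightarrow> a2' y v = f2 y * a2 y v"
    and df: "\<And>y. y \<in> S \<Longrightarrow> f1 differentiable (at y)" "\<And>y. y \<in> S \<Longrightarrow> f2 differentiable (at y)"
    and da: "\<And>y v. y \<in> S \<Longrightarrow> (\<lambda>y. a1 y v) differentiable (at y)"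
      "\<And>y v. y \<in> S \<Longrightarrow> (\<lambda>y. a2 y v) differentiable (at y)"
    and nz: "\<And>y. y \<in> S \<Longrightarrow> f1 y \<noteq> 0" "\<And>y. y \<in> S \<Longrightarrow> f2 y \<noteq> 0"
    and V: "\<And>y. y \<in> S \<Longrightarrow> wedge_at (a1 y) (coord_d a1 y) p q r \<noteq> 0"
    and norm: "\<And>y. y \<in> S \<Longrightarrow> \<bar>wedge_at (a1 y) (coord_d a1 y) p q r\<bar> = \<bar>wedge_at (a2 y) (coord_d a2 y) p q r\<bar>"
    and norm': "\<And>y. y \<in> S \<Longrightarrow> \<bar>wedge_at (a1' y) (coord_d a1' y) p q r\<bar> = \<bar>wedge_at (a2' y) (coord_d a2' y) p q r\<bar>"
  shows "(wedge_at (a1' x) (coord_d a2' x) p q r + wedge_at (a2' x) (coord_d a1' x) p q r) / wedge_at (a1' x) (coord_d a1' x) p q r =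
    sgn (f1 x * f2 x) * ((wedge_at (a1 x) (coord_d a2 x) p q r + wedge_at (a2 x) (coord_d a1 x) p q r) / wedge_at (a1 x) (coord_d a1 x) p q r)"
proof -
  have cd1: "coord_d a1' y u v = f1 y * coord_d a1 y u v +
      (frechet_derivative f1 (at y) u * a1 y v - frechet_derivative f1 (at y) v * a1 y u)"
    and cd2: "coord_d a2' y u v = f2 y * coord_d a2 y u v +
      (frechet_derivative f2 (at y) u * a2 y v - frechet_derivative f2 (at y) v * a2 y u)"
    if "y \<in> S" for y u v
    using coord_d_scale[OF S(1) that a'(1) df(1)[OF that] da(1)[OF that]]
      coord_d_scale[OF S(1) that a'(2) df(2)[OF that] da(2)[OF that]] by auto
  have V1: "wedge_at (a1' y) (coord_d a1' y) p q r = (f1 y)\<^sup>2 * wedge_at (a1 y) (coord_d a1 y) p q r"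
    and V2: "wedge_at (a2' y) (coord_d a2' y) p q r = (f2 y)\<^sup>2 * wedge_at (a2 y) (coord_d a2 y) p q r" if "y \<in> S" for y
    unfolding wedge_at_def by (simp_all add: cd1[OF that] cd2[OF that] a'[OF that] algebra_simps power2_eq_square)
  \<comment> \<open>This holds on a neighbourhood of \<open>x\<close>, so it can be differentiated.\<close>
  have sq: "f1 y * f1 y = f2 y * f2 y" if "y \<in> S" for y
    using norm'[OF that] norm[OF that] V[OF that]
    by (auto simp: V1[OF that] V2[OF that] abs_mult power2_eq_square)
  define D1 where "D1 = frechet_derivative f1 (at x)"
  define D2 where "D2 = frechet_derivative f2 (at x)"
  have D: "(f1 has_derivative D1) (at x)" "(f2 has_derivative D2) (at x)"
    using df S(2) unfolding D1_def D2_def by (simp_all only: frechet_derivative_works)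
  have "(\<lambda>u. f1 x * D1 u + D1 u * f1 x) = (\<lambda>u. f2 x * D2 u + D2 u * f2 x)"
    using frechet_derivative_local_eqI[OF S sq has_derivative_mult[OF D(2,2)]]
      frechet_derivative_eqI[OF has_derivative_mult[OF D(1,1)]] by simp
  then have Dsq: "f1 x * D1 u = f2 x * D2 u" for u
    by (drule_tac fun_cong[of _ _ u]) (simp add: mult.commute)
  have "f1 x = f2 x \<or> f1 x = - f2 x"
    using sq[OF S(2)] by (simp add: square_eq_iff)
  then have swap: "f2 x * D1 u = f1 x * D2 u" for u
    using Dsq[of u] nz(2)[OF S(2)] by auto
  \<comment> \<open>The terms with derivatives of the factors add up to (f2 df1 - f1 df2) \<and> a1
    \<and> a2, which is zero by \<open>swap\<close>.\<close>
  have K: "wedge_at (a1' x) (coord_d a2' x) p q r + wedge_at (a2' x) (coord_d a1' x) p q r =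
      f1 x * f2 x * (wedge_at (a1 x) (coord_d a2 x) p q r + wedge_at (a2 x) (coord_d a1 x) p q r)"
    unfolding wedge_at_def
    apply (simp only: cd1[OF S(2)] cd2[OF S(2)] a'[OF S(2)] D1_def[symmetric] D2_def[symmetric])
    using swap[of p] swap[of q] swap[of r] by algebra
  \<comment> \<open>The numerator of the quotient scales by f1 f2, the denominator by f1^2; these
    have the same absolute value.\<close>
  have "f1 x * f2 x / (f1 x)\<^sup>2 = sgn (f1 x * f2 x)"
    using \<open>f1 x = f2 x \<or> f1 x = - f2 x\<close> nz(1)[OF S(2)]
    by (auto simp: power2_eq_square sgn_mult sgn_if)
  then show ?thesis
    unfolding K V1[OF S(2)] using nz(1)[OF S(2)] by (metis times_divide_times_eq)
qed

section \<open>Forms in charts\<close>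

context
  fixes A :: "'a::topological_space atlas" and c :: "'a chart"
  assumes A: "smooth_atlas A" and c: "c \<in> A"
begin

lemma open_chart_dom: "open (chart_dom c)"
  using A c by (auto simp: smooth_atlas_def)

lemma chart_homeomorphism: "homeomorphism (chart_dom c) (coords c ` chart_dom c) (coords c) (chart_inv c)"
  using A c by (auto simp: smooth_atlas_def)

lemma chart_inv_coords: "p \<in> chart_dom c \<Longrightarrow> chart_inv c (coords c p) = p"
  using chart_homeomorphism by (auto simp: homeomorphism_def)

lemma open_coords_image:
  assumes "open W" "W \<subseteq> chart_dom c"
  shows "open (coords c ` W)"
proof -
  have "openin (top_of_set (coords c ` chart_dom c)) (coords c ` W)"
    by (rule homeomorphism_imp_open_map[OF chart_homeomorphism])
       (use assms in \<open>auto simp: openin_open\<close>)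
  moreover have "open (coords c ` chart_dom c)"
    using A c by (auto simp: smooth_atlas_def)
  ultimately show ?thesis
    using openin_open_eq by blast
qed

lemma open_coords_Int: "open U \<Longrightarrow> open (coords c ` (chart_dom c \<inter> U))"
  using open_chart_dom by (intro open_coords_image) auto

end

lemma chart_dom_subset_carrier: "c \<in> A \<Longrightarrow> chart_dom c \<subseteq> carrier A"
  by (auto simp: carrier_def)

lemma open_carrier: "smooth_atlas A \<Longrightarrow> open (carrier A)"
  unfolding carrier_def using open_chart_dom by blast

section \<open>Smooth maps and their tangent maps\<close>

lemma smooth_map_id: "smooth_atlas A \<Longrightarrow> smooth_map A A id"
  unfolding smooth_map_def smooth_atlas_def by auto

lemma open_vimage_chart:
  assumes "smooth_atlas A" "smooth_atlas B" "smooth_map A B \<Phi>" "c \<in> A" "d \<in> B"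
  shows "open (chart_dom c \<inter> \<Phi> -` chart_dom d)"
proof -
  have "open (\<Phi> -` chart_dom d \<inter> carrier A)"
    using assms(3) open_chart_dom[OF assms(2,5)]
    by (simp add: smooth_map_def continuous_on_open_vimage[OF open_carrier[OF assms(1)]])
  then have "open (chart_dom c \<inter> (\<Phi> -` chart_dom d \<inter> carrier A))"
    by (rule open_Int[OF open_chart_dom[OF assms(1,4)]])
  moreover have "chart_dom c \<inter> (\<Phi> -` chart_dom d \<inter> carrier A) = chart_dom c \<inter> \<Phi> -` chart_dom d"
    using chart_dom_subset_carrier[OF assms(4)] by blast
  ultimately show ?thesis by simp
qed

lemma smooth_map_coords:
  assumes "smooth_map A B \<Phi>" "c \<in> A" "d \<in> B"
  shows "smooth_on (coords c ` (chart_dom c \<inter> \<Phi> -` chart_dom d)) (coords d \<circ> \<Phi> \<circ> chart_inv c)"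
  using assms unfolding smooth_map_def by blast

text \<open>Taking the identity for one of the two maps covers chart changes too, so the rule for
  composing Jacobians and the behaviour of a tangent map under a change of chart are
  instances.\<close>

lemma tangent_map_comp:
  assumes at: "smooth_atlas A" "smooth_atlas B" "smooth_atlas E"
    and "smooth_map A B \<Phi>" "smooth_map B E \<Psi>"
    and "c \<in> A" "d \<in> B" "e \<in> E" "p \<in> chart_dom c" "\<Phi> p \<in> chart_dom d" "\<Psi> (\<Phi> p) \<in> chart_dom e"
  shows "tangent_map (\<Psi> \<circ> \<Phi>) c e p = tangent_map \<Psi> d e (\<Phi> p) \<circ> tangent_map \<Phi> c d p"
proof -
  let ?W = "chart_dom c \<inter> \<Phi> -` chart_dom d" and ?F = "coords d \<circ> \<Phi> \<circ> chart_inv c"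
    and ?G = "coords e \<circ> \<Psi> \<circ> chart_inv d"
  have x: "coords c p \<in> coords c ` ?W"
    using assms by blast
  have op: "open (coords c ` ?W)"
    using assms by (intro open_coords_image open_vimage_chart) auto
  have F: "(?F has_derivative tangent_map \<Phi> c d p) (at (coords c p))"
    unfolding tangent_map_def
    using smooth_on_has_derivative[OF smooth_map_coords x] assms by blast
  have Fx: "?F (coords c p) = coords d (\<Phi> p)"
    using assms by (simp add: chart_inv_coords)
  have "coords d (\<Phi> p) \<in> coords d ` (chart_dom d \<inter> \<Psi> -` chart_dom e)"
    using assms by blast
  then have G: "(?G has_derivative tangent_map \<Psi> d e (\<Phi> p)) (at (?F (coords c p)))"
    unfolding tangent_map_def Fx
    using smooth_on_has_derivative[OF smooth_map_coords] assms by blast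
  have eq: "(coords e \<circ> (\<Psi> \<circ> \<Phi>) \<circ> chart_inv c) y = (?G \<circ> ?F) y" if "y \<in> coords c ` ?W" for y
    using that assms by (auto simp: chart_inv_coords)
  show ?thesis
    unfolding tangent_map_def[of "\<Psi> \<circ> \<Phi>"]
    by (rule frechet_derivative_local_eqI[OF op x eq diff_chain_at[OF F G]])
qed

text \<open>The map is required to be the identity on the chart domain only: the composite of a
  diffeomorphism with its \<open>inv_into\<close> is known to be the identity just on the
  carrier.\<close>

lemma tangent_map_eq_id:
  assumes A: "smooth_atlas A" "c \<in> A" "p \<in> chart_dom c" and "\<And>q. q \<in> chart_dom c \<Longrightarrow> \<Phi> q = q"
  shows "tangent_map \<Phi> c c p = id"
  unfolding tangent_map_def
proof (rule frechet_derivative_local_eqI)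
  show "open (coords c ` chart_dom c)"
    using assms by (intro open_coords_image) (auto intro: open_chart_dom)
  show "coords c p \<in> coords c ` chart_dom c"
    using assms by blast
  show "(coords c \<circ> \<Phi> \<circ> chart_inv c) y = id y" if "y \<in> coords c ` chart_dom c" for y
    using that assms by (auto simp: chart_inv_coords)
qed (rule has_derivative_id)

lemma linear_tangent_map:
  assumes "smooth_map A B \<Phi>" "c \<in> A" "d \<in> B" "p \<in> chart_dom c" "\<Phi> p \<in> chart_dom d"
  shows "linear (tangent_map \<Phi> c d p)"
  unfolding tangent_map_def
  using smooth_on_has_derivative[OF smooth_map_coords[OF assms(1-3)]] assms(4,5)
  by (intro has_derivative_linear[of "coords d \<circ> \<Phi> \<circ> chart_inv c"]) blast

section \<open>Two-forms, three-forms and their quotients\<close>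

definition two_form :: "'a atlas \<Rightarrow> 'a set \<Rightarrow> 'a form2 \<Rightarrow> bool"
  where "two_form A U \<tau> \<longleftrightarrow>
    (\<forall>c\<in>A. (\<forall>p\<in>chart_dom c \<inter> U. alt2 (\<tau> c p)) \<and>
      (\<forall>u v. smooth_on (coords c ` (chart_dom c \<inter> U)) (\<lambda>x. \<tau> c (chart_inv c x) u v)) \<and>
      (\<forall>d\<in>A. \<forall>p\<in>chart_dom c \<inter> chart_dom d \<inter> U. \<forall>u v.
         \<tau> c p u v = \<tau> d p (tangent_map id c d p u) (tangent_map id c d p v)))"

text \<open>Multilinearity and alternation are encoded together as being a multiple of
  \<open>det3\<close>, the shape in which one coefficient can be divided by another.\<close>

definition three_form :: "'a atlas \<Rightarrow> 'a set \<Rightarrow> 'a form3 \<Rightarrow> bool"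
  where "three_form A U \<sigma> \<longleftrightarrow>
    (\<forall>c\<in>A. (\<forall>p\<in>chart_dom c \<inter> U. \<forall>u v w. \<sigma> c p u v w = \<sigma> c p (ee 1) (ee 2) (ee 3) * det3 u v w) \<and>
      (\<forall>u v w. smooth_on (coords c ` (chart_dom c \<inter> U)) (\<lambda>x. \<sigma> c (chart_inv c x) u v w)) \<and>
      (\<forall>d\<in>A. \<forall>p\<in>chart_dom c \<inter> chart_dom d \<inter> U. \<forall>u v w.
         \<sigma> c p u v w =
           \<sigma> d p (tangent_map id c d p u) (tangent_map id c d p v) (tangent_map id c d p w)))"

text \<open>The chart is an arbitrary choice: another chart multiplies both coefficients by the same
  Jacobian determinant.\<close>

definition form_ratio :: "'a atlas \<Rightarrow> 'a form3 \<Rightarrow> 'a form3 \<Rightarrow> 'a \<Rightarrow> real"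
  where "form_ratio A \<sigma> \<tau> p = (let c = (SOME c. c \<in> A \<and> p \<in> chart_dom c) in
    \<sigma> c p (ee 1) (ee 2) (ee 3) / \<tau> c p (ee 1) (ee 2) (ee 3))"

lemma one_form_linear: "one_form A U \<omega> \<Longrightarrow> c \<in> A \<Longrightarrow> p \<in> chart_dom c \<Longrightarrow> p \<in> U \<Longrightarrow> linear (\<omega> c p)"
  unfolding one_form_def by blast

lemma one_form_smooth:
  "one_form A U \<omega> \<Longrightarrow> c \<in> A \<Longrightarrow>
    smooth_on (coords c ` (chart_dom c \<inter> U)) (\<lambda>x. \<omega> c (chart_inv c x) v)"
  unfolding one_form_def by blast

lemma one_form_tangent_map:
  "one_form A U \<omega> \<Longrightarrow> c \<in> A \<Longrightarrow> d \<in> A \<Longrightarrow> p \<in> chart_dom c \<Longrightarrow> p \<in> chart_dom d \<Longrightarrow> p \<in> U \<Longrightarrow>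
    \<omega> c p v = \<omega> d p (tangent_map id c d p v)"
  unfolding one_form_def by blast

lemma three_form_det3:
  "three_form A U \<sigma> \<Longrightarrow> c \<in> A \<Longrightarrow> p \<in> chart_dom c \<Longrightarrow> p \<in> U \<Longrightarrow>
    \<sigma> c p u v w = \<sigma> c p (ee 1) (ee 2) (ee 3) * det3 u v w"
  unfolding three_form_def by blast

lemma three_form_smooth:
  "three_form A U \<sigma> \<Longrightarrow> c \<in> A \<Longrightarrow>
    smooth_on (coords c ` (chart_dom c \<inter> U)) (\<lambda>x. \<sigma> c (chart_inv c x) u v w)"
  unfolding three_form_def by blast

lemma three_form_tangent_map:
  "three_form A U \<sigma> \<Longrightarrow> c \<in> A \<Longrightarrow> d \<in> A \<Longrightarrow> p \<in> chart_dom c \<Longrightarrow> p \<in> chart_dom d \<Longrightarrow> p \<in> U \<Longrightarrow>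
    \<sigma> c p u v w = \<sigma> d p (tangent_map id c d p u) (tangent_map id c d p v) (tangent_map id c d p w)"
  unfolding three_form_def by blast

lemma one_form_subset:
  assumes "one_form A U \<omega>" "W \<subseteq> U"
  shows "one_form A W \<omega>"
proof -
  have "smooth_on (coords c ` (chart_dom c \<inter> W)) (\<lambda>x. \<omega> c (chart_inv c x) v)" if "c \<in> A" for c v
    using one_form_smooth[OF assms(1) that] assms(2) by (rule_tac smooth_on_subset) auto
  then show ?thesis
    using assms unfolding one_form_def by blast
qed

lemma wedge12_wedge_at: "wedge12 \<sigma> \<tau> c p = wedge_at (\<sigma> c p) (\<tau> c p)"
  by (simp add: wedge12_def wedge_at_def fun_eq_iff)

lemma smooth_function_const: "smooth_function A U (\<lambda>_. r)"
  by (simp add: smooth_function_def o_def smooth_on_const)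

lemma ext_d_coord_d: "ext_d \<omega> c p = coord_d (\<lambda>x. \<omega> c (chart_inv c x)) (coords c p)"
  by (simp add: ext_d_def coord_d_def fun_eq_iff)

text \<open>The relation between the two forms is the hypothesis \<open>pb\<close> instead of an
  equation with \<open>pullback\<close>, so that one statement serves for the identity between two
  charts, which makes \<open>ext_d\<close> independent of the chart, and for pullbacks by maps
  between manifolds.\<close>

lemma ext_d_pullback:
  assumes at: "smooth_atlas A" "smooth_atlas B" and Phi: "smooth_map A B \<Phi>"
    and U: "open U" and V: "open V" "\<Phi> ` U \<subseteq> V" and theta: "one_form B V \<theta>"
    and charts: "c \<in> A" "d \<in> B"
    and pb: "\<And>q v. q \<in> chart_dom c \<Longrightarrow> q \<in> U \<Longrightarrow> \<Phi> q \<in> chart_dom d \<Longrightarrow>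
      \<omega> c q v = \<theta> d (\<Phi> q) (tangent_map \<Phi> c d q v)"
    and p: "p \<in> chart_dom c" "p \<in> U" "\<Phi> p \<in> chart_dom d"
  shows "ext_d \<omega> c p u v = ext_d \<theta> d (\<Phi> p) (tangent_map \<Phi> c d p u) (tangent_map \<Phi> c d p v)"
proof -
  let ?W = "chart_dom c \<inter> \<Phi> -` chart_dom d \<inter> U" and ?F = "coords d \<circ> \<Phi> \<circ> chart_inv c"
  let ?T = "coords d ` (chart_dom d \<inter> V)"
  have op: "open (coords c ` ?W)" "open ?T"
    using open_vimage_chart[OF at Phi charts] U V at charts
    by (auto intro!: open_coords_image[OF at(1) charts(1)] open_coords_Int)
  have sm: "smooth_on (coords c ` ?W) ?F"
    by (rule smooth_on_subset[OF smooth_map_coords[OF Phi charts]]) auto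
  have x: "coords c p \<in> coords c ` ?W"
    using p by blast
  have FT: "?F ` (coords c ` ?W) \<subseteq> ?T"
    using V(2) at charts by (auto simp: chart_inv_coords)
  have Fx: "?F (coords c p) = coords d (\<Phi> p)"
    using at charts p by (simp add: chart_inv_coords)
  show ?thesis
    unfolding ext_d_coord_d tangent_map_def Fx[symmetric]
  proof (rule coord_d_pullback[OF op(1) x sm op(2) FT])
    show "linear (\<theta> d (chart_inv d y))" if "y \<in> ?T" for y
      using that one_form_linear[OF theta charts(2)] at charts by (auto simp: chart_inv_coords)
    show "smooth_on ?T (\<lambda>y. \<theta> d (chart_inv d y) v)" for v
      by (rule one_form_smooth[OF theta charts(2)])
    show "\<omega> c (chart_inv c y) v = \<theta> d (chart_inv d (?F y)) (frechet_derivative ?F (at y) v)"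
      if "y \<in> coords c ` ?W" for y v
      using that at charts pb by (auto simp: chart_inv_coords tangent_map_def)
  qed
qed

context
  fixes A :: "'a::topological_space atlas" and U :: "'a set"
  assumes A: "smooth_atlas A" and U: "open U"
begin

lemma two_form_ext_d:
  assumes "one_form A U \<omega>"
  shows "two_form A U (ext_d \<omega>)"
  unfolding two_form_def
proof (intro ballI conjI allI)
  fix c assume c: "c \<in> A"
  let ?S = "coords c ` (chart_dom c \<inter> U)"
  have op: "open ?S" using open_coords_Int[OF A c U] .
  {
    fix p assume "p \<in> chart_dom c \<inter> U"
    then show "alt2 (ext_d \<omega> c p)"
      unfolding ext_d_coord_d
      using one_form_linear[OF assms c] smooth_on_differentiable[OF one_form_smooth[OF assms c]]
      by (intro alt2_coord_d[OF op]) (auto simp: chart_inv_coords[OF A c])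
  }
  show "smooth_on ?S (\<lambda>x. ext_d \<omega> c (chart_inv c x) u v)" for u v
  proof (rule smooth_on_cong[OF op])
    show "smooth_on ?S (\<lambda>x. coord_d (\<lambda>x. \<omega> c (chart_inv c x)) x u v)"
      unfolding coord_d_def
      by (intro smooth_on_diff[OF op] smooth_on_frechet_derivative one_form_smooth[OF assms c])
    show "coord_d (\<lambda>x. \<omega> c (chart_inv c x)) x u v = ext_d \<omega> c (chart_inv c x) u v" if "x \<in> ?S" for x
      using that by (auto simp: ext_d_coord_d chart_inv_coords[OF A c])
  qed
  fix d p u v assume d: "d \<in> A" and p: "p \<in> chart_dom c \<inter> chart_dom d \<inter> U"
  show "ext_d \<omega> c p u v = ext_d \<omega> d p (tangent_map id c d p u) (tangent_map id c d p v)"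
    using ext_d_pullback[OF A A smooth_map_id[OF A] U U _ assms c d, of \<omega> p u v]
      one_form_tangent_map[OF assms c d] p by auto
qed

lemma two_form_wedge11:
  assumes "one_form A U \<sigma>" "one_form A U \<tau>"
  shows "two_form A U (wedge11 \<sigma> \<tau>)"
  unfolding two_form_def wedge11_def
proof (intro ballI conjI allI)
  fix c assume c: "c \<in> A"
  show "alt2 (\<lambda>u v. \<sigma> c p u * \<tau> c p v - \<sigma> c p v * \<tau> c p u)" if "p \<in> chart_dom c \<inter> U" for p
    using that assms c by (intro alt2_wedge) (auto intro: one_form_linear)
  show "smooth_on (coords c ` (chart_dom c \<inter> U))
     (\<lambda>x. \<sigma> c (chart_inv c x) u * \<tau> c (chart_inv c x) v - \<sigma> c (chart_inv c x) v * \<tau> c (chart_inv c x) u)" for u v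
    by (intro smooth_on_diff smooth_on_mult open_coords_Int[OF A c U] one_form_smooth[OF assms(1) c] one_form_smooth[OF assms(2) c])
  show "\<sigma> c p u * \<tau> c p v - \<sigma> c p v * \<tau> c p u =
       \<sigma> d p (tangent_map id c d p u) * \<tau> d p (tangent_map id c d p v) -
       \<sigma> d p (tangent_map id c d p v) * \<tau> d p (tangent_map id c d p u)"
    if "d \<in> A" "p \<in> chart_dom c \<inter> chart_dom d \<inter> U" for d p u v
    using one_form_tangent_map[OF assms(1) c that(1)] one_form_tangent_map[OF assms(2) c that(1)] that(2)
    by simp
qed

lemma three_form_wedge12:
  assumes "one_form A U \<sigma>" "two_form A U \<tau>"
  shows "three_form A U (wedge12 \<sigma> \<tau>)"
  unfolding three_form_def
proof (intro ballI conjI allI)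
  fix c assume c: "c \<in> A"
  show "wedge12 \<sigma> \<tau> c p u v w = wedge12 \<sigma> \<tau> c p (ee 1) (ee 2) (ee 3) * det3 u v w"
    if "p \<in> chart_dom c \<inter> U" for p u v w
    using that assms c unfolding wedge12_wedge_at
    by (intro wedge_at_det3) (auto simp: two_form_def intro: one_form_linear)
  have t: "smooth_on (coords c ` (chart_dom c \<inter> U)) (\<lambda>x. \<tau> c (chart_inv c x) u v)" for u v
    using assms c by (auto simp: two_form_def)
  show "smooth_on (coords c ` (chart_dom c \<inter> U)) (\<lambda>x. wedge12 \<sigma> \<tau> c (chart_inv c x) u v w)" for u v w
    unfolding wedge12_def
    by (intro smooth_on_add smooth_on_mult open_coords_Int[OF A c U] one_form_smooth[OF assms(1) c] t)
  show "wedge12 \<sigma> \<tau> c p u v w = wedge12 \<sigma> \<tau> d p (tangent_map id c d p u) (tangent_map id c d p v)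
      (tangent_map id c d p w)"
    if "d \<in> A" "p \<in> chart_dom c \<inter> chart_dom d \<inter> U" for d p u v w
  proof -
    have "\<tau> c p u v = \<tau> d p (tangent_map id c d p u) (tangent_map id c d p v)" for u v
      using assms(2) c that unfolding two_form_def by blast
    then show ?thesis
      using one_form_tangent_map[OF assms(1) c that(1)] that(2) by (simp add: wedge12_def)
  qed
qed

lemma three_form_add:
  assumes "three_form A U \<sigma>" "three_form A U \<tau>"
  shows "three_form A U (\<lambda>c p u v w. \<sigma> c p u v w + \<tau> c p u v w)"
  unfolding three_form_def
proof (intro ballI conjI allI)
  fix c assume c: "c \<in> A"
  show "\<sigma> c p u v w + \<tau> c p u v w =
     (\<sigma> c p (ee 1) (ee 2) (ee 3) + \<tau> c p (ee 1) (ee 2) (ee 3)) * det3 u v w"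
    if "p \<in> chart_dom c \<inter> U" for p u v w
    using three_form_det3[OF assms(1) c, of p u v w] three_form_det3[OF assms(2) c, of p u v w] that
    by (simp only: Int_iff distrib_right)
  show "smooth_on (coords c ` (chart_dom c \<inter> U))
      (\<lambda>x. \<sigma> c (chart_inv c x) u v w + \<tau> c (chart_inv c x) u v w)" for u v w
    by (intro smooth_on_add open_coords_Int[OF A c U] three_form_smooth[OF assms(1) c]
        three_form_smooth[OF assms(2) c])
  show "\<sigma> c p u v w + \<tau> c p u v w =
       \<sigma> d p (tangent_map id c d p u) (tangent_map id c d p v) (tangent_map id c d p w) +
       \<tau> d p (tangent_map id c d p u) (tangent_map id c d p v) (tangent_map id c d p w)"
    if "d \<in> A" "p \<in> chart_dom c \<inter> chart_dom d \<inter> U" for d p u v w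
    using three_form_tangent_map[OF assms(1) c that(1), of p u v w]
      three_form_tangent_map[OF assms(2) c that(1), of p u v w] that(2)
    by (simp only: Int_iff)
qed

lemma one_form_scale:
  assumes "one_form A U \<omega>" "smooth_function A U f"
  shows "one_form A U (\<lambda>c p v. f p * \<omega> c p v)"
  unfolding one_form_def
proof (intro ballI conjI allI)
  fix c assume c: "c \<in> A"
  show "linear (\<lambda>v. f p * \<omega> c p v)" if "p \<in> chart_dom c \<inter> U" for p
    using linear_compose_scale_right[OF one_form_linear[OF assms(1) c]] that by auto
  have "smooth_on (coords c ` (chart_dom c \<inter> U)) (\<lambda>x. f (chart_inv c x))"
    using assms(2) c by (simp add: smooth_function_def o_def)
  then show "smooth_on (coords c ` (chart_dom c \<inter> U)) (\<lambda>x. f (chart_inv c x) * \<omega> c (chart_inv c x) v)" for v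
    by (intro smooth_on_mult open_coords_Int[OF A c U] one_form_smooth[OF assms(1) c])
  show "f p * \<omega> c p v = f p * \<omega> d p (tangent_map id c d p v)"
    if "d \<in> A" "p \<in> chart_dom c \<inter> chart_dom d \<inter> U" for d p v
    using one_form_tangent_map[OF assms(1) c that(1)] that(2) by simp
qed

lemma one_form_add:
  assumes "one_form A U \<sigma>" "one_form A U \<tau>"
  shows "one_form A U (\<lambda>c p v. \<sigma> c p v + \<tau> c p v)"
  unfolding one_form_def
proof (intro ballI conjI allI)
  fix c assume c: "c \<in> A"
  show "linear (\<lambda>v. \<sigma> c p v + \<tau> c p v)" if "p \<in> chart_dom c \<inter> U" for p
    using linear_compose_add[OF one_form_linear[OF assms(1) c] one_form_linear[OF assms(2) c]] that by auto
  show "smooth_on (coords c ` (chart_dom c \<inter> U)) (\<lambda>x. \<sigma> c (chart_inv c x) v + \<tau> c (chart_inv c x) v)" for v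
    by (intro smooth_on_add open_coords_Int[OF A c U] one_form_smooth[OF assms(1) c] one_form_smooth[OF assms(2) c])
  show "\<sigma> c p v + \<tau> c p v = \<sigma> d p (tangent_map id c d p v) + \<tau> d p (tangent_map id c d p v)"
    if "d \<in> A" "p \<in> chart_dom c \<inter> chart_dom d \<inter> U" for d p v
    using one_form_tangent_map[OF assms(1) c that(1)] one_form_tangent_map[OF assms(2) c that(1)] that(2)
    by simp
qed

lemma one_form_lin_comb:
  assumes "one_form A U \<sigma>" "one_form A U \<tau>"
  shows "one_form A U (lin_comb r s \<sigma> \<tau>)"
  unfolding lin_comb_def
  by (intro one_form_add one_form_scale assms smooth_function_const)

lemma smooth_function_cong:
  assumes "smooth_function A U f" "\<And>p. p \<in> U \<Longrightarrow> p \<in> carrier A \<Longrightarrow> f p = g p"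
  shows "smooth_function A U g"
  unfolding smooth_function_def
proof
  fix c assume c: "c \<in> A"
  show "smooth_on (coords c ` (chart_dom c \<inter> U)) (g \<circ> chart_inv c)"
  proof (rule smooth_on_cong[OF open_coords_Int[OF A c U]])
    show "smooth_on (coords c ` (chart_dom c \<inter> U)) (f \<circ> chart_inv c)"
      using assms(1) c by (simp add: smooth_function_def)
    show "(f \<circ> chart_inv c) x = (g \<circ> chart_inv c) x" if "x \<in> coords c ` (chart_dom c \<inter> U)" for x
      using that assms(2) chart_dom_subset_carrier[OF c] by (auto simp: chart_inv_coords[OF A c])
  qed
qed

lemma three_form_nonzero_basis:
  assumes "three_form A U \<tau>" "nowhere_zero3 A U \<tau>" "c \<in> A" "p \<in> chart_dom c" "p \<in> U"
  shows "\<tau> c p (ee 1) (ee 2) (ee 3) \<noteq> 0"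
proof -
  obtain u v w where "\<tau> c p u v w \<noteq> 0"
    using assms unfolding nowhere_zero3_def by blast
  then show ?thesis
    using three_form_det3[OF assms(1,3-5), of u v w] by auto
qed

lemma form_ratio:
  assumes "three_form A U \<sigma>" "three_form A U \<tau>" "nowhere_zero3 A U \<tau>" "c \<in> A" "p \<in> chart_dom c" "p \<in> U"
  shows "\<sigma> c p u v w = form_ratio A \<sigma> \<tau> p * \<tau> c p u v w"
proof -
  define d where "d = (SOME c. c \<in> A \<and> p \<in> chart_dom c)"
  have d: "d \<in> A" "p \<in> chart_dom d"
    using someI[of "\<lambda>c. c \<in> A \<and> p \<in> chart_dom c" c] assms(4,5) by (auto simp: d_def)
  \<comment> \<open>Passing from \<open>c\<close> to the chosen chart \<open>d\<close> produces the
    same \<open>det3\<close> of the transported vectors for every three-form, so it is a common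
    factor of both sides.\<close>
  have expand: "\<rho> c p u v w = \<rho> d p (ee 1) (ee 2) (ee 3) *
      det3 (tangent_map id c d p u) (tangent_map id c d p v) (tangent_map id c d p w)"
    if "three_form A U \<rho>" for \<rho>
    by (subst three_form_tangent_map[OF that assms(4) d(1) assms(5) d(2) assms(6)])
       (rule three_form_det3[OF that d assms(6)])
  have "form_ratio A \<sigma> \<tau> p = \<sigma> d p (ee 1) (ee 2) (ee 3) / \<tau> d p (ee 1) (ee 2) (ee 3)"
    by (simp add: form_ratio_def d_def Let_def)
  then show ?thesis
    using expand[OF assms(1)] expand[OF assms(2)] three_form_nonzero_basis[OF assms(2,3) d assms(6)]
    by simp
qed

text \<open>The chart chosen inside \<open>form_ratio\<close> may jump from one point to the next;
  by the lemma \<open>form_ratio\<close> the value can be computed in the fixed chart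
  \<open>c\<close>, where it is a quotient of smooth functions.\<close>

lemma smooth_form_ratio:
  assumes "three_form A U \<sigma>" "three_form A U \<tau>" "nowhere_zero3 A U \<tau>"
  shows "smooth_function A U (form_ratio A \<sigma> \<tau>)"
  unfolding smooth_function_def
proof
  fix c assume c: "c \<in> A"
  let ?S = "coords c ` (chart_dom c \<inter> U)"
  have nz: "\<tau> c (chart_inv c x) (ee 1) (ee 2) (ee 3) \<noteq> 0" if "x \<in> ?S" for x
    using that three_form_nonzero_basis[OF assms(2,3) c] by (auto simp: chart_inv_coords[OF A c])
  show "smooth_on ?S (form_ratio A \<sigma> \<tau> \<circ> chart_inv c)"
  proof (rule smooth_on_cong[OF open_coords_Int[OF A c U]])
    show "smooth_on ?S (\<lambda>x. \<sigma> c (chart_inv c x) (ee 1) (ee 2) (ee 3) / \<tau> c (chart_inv c x) (ee 1) (ee 2) (ee 3))"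
      by (intro smooth_on_divide open_coords_Int[OF A c U] three_form_smooth[OF assms(1) c]
          three_form_smooth[OF assms(2) c] nz)
    show "\<sigma> c (chart_inv c x) (ee 1) (ee 2) (ee 3) / \<tau> c (chart_inv c x) (ee 1) (ee 2) (ee 3) =
        (form_ratio A \<sigma> \<tau> \<circ> chart_inv c) x" if "x \<in> ?S" for x
      using that nz[OF that] form_ratio[OF assms c, of "chart_inv c x" "ee 1" "ee 2" "ee 3"]
      by (auto simp: chart_inv_coords[OF A c])
  qed
qed

end

section \<open>Normalised pairs of contact forms\<close>

text \<open>The polar form of the quadratic map sending \<omega> to \<omega> \<and> d\<omega>: the
  coefficient of r s in the contact volume of r \<omega>1 + s \<omega>2.\<close>

definition cross_volume :: "'a form1 \<Rightarrow> 'a form1 \<Rightarrow> 'a form3"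
  where "cross_volume \<omega>1 \<omega>2 =
    (\<lambda>c p u v w. wedge12 \<omega>1 (ext_d \<omega>2) c p u v w + wedge12 \<omega>2 (ext_d \<omega>1) c p u v w)"

text \<open>The function \<open>C\<close> with \<open>\<omega>1 \<and> d\<omega>2 + \<omega>2 \<and> d\<omega>1 = 2C \<omega>1 \<and> d\<omega>1\<close>.\<close>
definition torsion_quotient :: "'a atlas \<Rightarrow> 'a form1 \<Rightarrow> 'a form1 \<Rightarrow> 'a \<Rightarrow> real"
  where "torsion_quotient A \<omega>1 \<omega>2 p = form_ratio A (cross_volume \<omega>1 \<omega>2) (contact_volume \<omega>1) p / 2"

text \<open>The sign of \<open>\<epsilon>\<close> is left open, so that one notion covers the whole manifold.\<close>
definition normalised :: "'a atlas \<Rightarrow> 'a set \<Rightarrow> 'a form1 \<Rightarrow> 'a form1 \<Rightarrow> bool"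
  where "normalised A U \<omega>1 \<omega>2 \<longleftrightarrow> one_form A U \<omega>1 \<and> one_form A U \<omega>2 \<and>
    nowhere_zero3 A U (contact_volume \<omega>1) \<and>
    (\<forall>c\<in>A. \<forall>p\<in>chart_dom c \<inter> U. \<forall>u v w.
       \<bar>contact_volume \<omega>1 c p u v w\<bar> = \<bar>contact_volume \<omega>2 c p u v w\<bar>)"

text \<open>Where a form vanishes, its kernel is the whole tangent space, and a factor relating
  another form to it is not determined.\<close>

definition nonvanishing :: "'a atlas \<Rightarrow> 'a set \<Rightarrow> 'a form1 \<Rightarrow> bool"
  where "nonvanishing A U \<omega> \<longleftrightarrow> (\<forall>c\<in>A. \<forall>p\<in>chart_dom c \<inter> U. \<exists>v. \<omega> c p v \<noteq> 0)"

lemma nonvanishing_wedge12: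
  assumes "nowhere_zero3 A U (wedge12 \<omega> \<tau>)"
  shows "nonvanishing A U \<omega>"
  unfolding nonvanishing_def
proof (intro ballI)
  fix c p assume "c \<in> A" "p \<in> chart_dom c \<inter> U"
  then obtain u v w where "wedge12 \<omega> \<tau> c p u v w \<noteq> 0"
    using assms unfolding nowhere_zero3_def by blast
  then show "\<exists>v. \<omega> c p v \<noteq> 0"
    by (rule contrapos_np) (simp add: wedge12_def)
qed

lemma nowhere_zero3_subset: "nowhere_zero3 A U \<sigma> \<Longrightarrow> W \<subseteq> U \<Longrightarrow> nowhere_zero3 A W \<sigma>"
  unfolding nowhere_zero3_def by blast

lemma normalised_subset:
  assumes "normalised A U \<omega>1 \<omega>2" "W \<subseteq> U"
  shows "normalised A W \<omega>1 \<omega>2"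
  unfolding normalised_def
proof (intro conjI ballI allI)
  show "\<bar>contact_volume \<omega>1 c p u v w\<bar> = \<bar>contact_volume \<omega>2 c p u v w\<bar>"
    if "c \<in> A" "p \<in> chart_dom c \<inter> W" for c p u v w
    using that assms unfolding normalised_def by blast
qed (use assms in \<open>auto simp: normalised_def intro: one_form_subset nowhere_zero3_subset\<close>)

lemma normalised_nonvanishing:
  assumes "normalised A U \<omega>1 \<omega>2"
  shows "nonvanishing A U \<omega>1" "nonvanishing A U \<omega>2"
proof -
  show "nonvanishing A U \<omega>1"
    using assms nonvanishing_wedge12 unfolding normalised_def contact_volume_def by blast
  have "nowhere_zero3 A U (contact_volume \<omega>2)"
    unfolding nowhere_zero3_def
  proof (intro ballI)
    fix c p assume c: "c \<in> A" and p: "p \<in> chart_dom c \<inter> U"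
    obtain u v w where "contact_volume \<omega>1 c p u v w \<noteq> 0"
      using assms c p unfolding normalised_def nowhere_zero3_def by blast
    moreover have "\<bar>contact_volume \<omega>1 c p u v w\<bar> = \<bar>contact_volume \<omega>2 c p u v w\<bar>"
      using assms c p unfolding normalised_def by blast
    ultimately show "\<exists>u v w. contact_volume \<omega>2 c p u v w \<noteq> 0"
      by (intro exI[of _ u] exI[of _ v] exI[of _ w]) auto
  qed
  then show "nonvanishing A U \<omega>2"
    using nonvanishing_wedge12 unfolding contact_volume_def by blast
qed

section \<open>Pairs of forms up to nowhere vanishing factors\<close>

lemma relative_signE:
  assumes "relative_sign A U \<eta>1 \<eta>2 \<omega>1 \<omega>2 \<delta>"
  obtains f1 f2 where "\<forall>p\<in>U. f1 p \<noteq> 0 \<and> f2 p \<noteq> 0 \<and> \<delta> p = sgn (f1 p * f2 p)"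
    "eq1 A U \<omega>1 (\<lambda>c p v. f1 p * \<eta>1 c p v)" "eq1 A U \<omega>2 (\<lambda>c p v. f2 p * \<eta>2 c p v)"
  using assms unfolding relative_sign_def by (elim exE conjE) (rule that)

lemma relative_sign_trans:
  assumes "relative_sign A U \<eta>1 \<eta>2 \<omega>1 \<omega>2 \<delta>" "relative_sign A U \<omega>1 \<omega>2 \<theta>1 \<theta>2 \<delta>'"
  shows "relative_sign A U \<eta>1 \<eta>2 \<theta>1 \<theta>2 (\<lambda>p. \<delta> p * \<delta>' p)"
proof -
  obtain f1 f2 where f: "\<forall>p\<in>U. f1 p \<noteq> 0 \<and> f2 p \<noteq> 0 \<and> \<delta> p = sgn (f1 p * f2 p)"
    "eq1 A U \<omega>1 (\<lambda>c p v. f1 p * \<eta>1 c p v)" "eq1 A U \<omega>2 (\<lambda>c p v. f2 p * \<eta>2 c p v)"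
    by (rule relative_signE[OF assms(1)])
  obtain g1 g2 where g: "\<forall>p\<in>U. g1 p \<noteq> 0 \<and> g2 p \<noteq> 0 \<and> \<delta>' p = sgn (g1 p * g2 p)"
    "eq1 A U \<theta>1 (\<lambda>c p v. g1 p * \<omega>1 c p v)" "eq1 A U \<theta>2 (\<lambda>c p v. g2 p * \<omega>2 c p v)"
    by (rule relative_signE[OF assms(2)])
  show ?thesis
    unfolding relative_sign_def
  proof (intro exI conjI)
    show "\<forall>p\<in>U. f1 p * g1 p \<noteq> 0 \<and> f2 p * g2 p \<noteq> 0 \<and> \<delta> p * \<delta>' p = sgn (f1 p * g1 p * (f2 p * g2 p))"
      using f(1) g(1) by (simp add: sgn_mult)
    show "eq1 A U \<theta>1 (\<lambda>c p v. f1 p * g1 p * \<eta>1 c p v)" "eq1 A U \<theta>2 (\<lambda>c p v. f2 p * g2 p * \<eta>2 c p v)"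
      using f(2,3) g(2,3) by (simp_all add: eq1_def mult_ac)
  qed
qed

lemma relative_sign_sym:
  assumes "relative_sign A U \<eta>1 \<eta>2 \<omega>1 \<omega>2 \<delta>"
  shows "relative_sign A U \<omega>1 \<omega>2 \<eta>1 \<eta>2 \<delta>"
proof -
  obtain f1 f2 where f: "\<forall>p\<in>U. f1 p \<noteq> 0 \<and> f2 p \<noteq> 0 \<and> \<delta> p = sgn (f1 p * f2 p)"
    "eq1 A U \<omega>1 (\<lambda>c p v. f1 p * \<eta>1 c p v)" "eq1 A U \<omega>2 (\<lambda>c p v. f2 p * \<eta>2 c p v)"
    by (rule relative_signE[OF assms(1)])
  have s: "sgn (inverse a * inverse b) = sgn (a * b)" for a b :: real
    by (simp add: sgn_if zero_less_mult_iff)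
  show ?thesis
    unfolding relative_sign_def
    by (rule exI[of _ "\<lambda>p. inverse (f1 p)"], rule exI[of _ "\<lambda>p. inverse (f2 p)"])
       (use f s in \<open>auto simp: eq1_def fun_eq_iff\<close>)
qed

lemma relative_sign_scale:
  assumes "\<And>p. p \<in> U \<Longrightarrow> h p > 0"
  shows "relative_sign A U \<eta>1 \<eta>2 (\<lambda>c p v. h p * \<eta>1 c p v) \<eta>2 (\<lambda>_. 1)"
  unfolding relative_sign_def
  by (rule exI[of _ h], rule exI[of _ "\<lambda>_. 1"]) (use assms in \<open>auto simp: eq1_def less_imp_neq[symmetric]\<close>)

lemma relative_sign_subset:
  assumes "relative_sign A U \<eta>1 \<eta>2 \<omega>1 \<omega>2 \<delta>" "W \<subseteq> U"
  shows "relative_sign A W \<eta>1 \<eta>2 \<omega>1 \<omega>2 \<delta>"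
  using assms(1)
proof (rule relative_signE)
  fix f1 f2 assume "\<forall>p\<in>U. f1 p \<noteq> 0 \<and> f2 p \<noteq> 0 \<and> \<delta> p = sgn (f1 p * f2 p)"
    "eq1 A U \<omega>1 (\<lambda>c p v. f1 p * \<eta>1 c p v)" "eq1 A U \<omega>2 (\<lambda>c p v. f2 p * \<eta>2 c p v)"
  then show ?thesis
    unfolding relative_sign_def eq1_def using assms(2) by (intro exI[of _ f1] exI[of _ f2]) auto
qed

text \<open>On a vector where the reference form is nonzero the factor can be read off. This pins
  down the sign whose mere existence \<open>torsion_function\<close> asserts.\<close>

lemma relative_sign_unique:
  assumes "relative_sign A U \<eta>1 \<eta>2 \<omega>1 \<omega>2 \<delta>" "relative_sign A U \<eta>1 \<eta>2 \<omega>1 \<omega>2 \<delta>'"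
    "nonvanishing A U \<eta>1" "nonvanishing A U \<eta>2" "p \<in> U" "p \<in> carrier A"
  shows "\<delta> p = \<delta>' p"
proof -
  obtain c where c: "c \<in> A" "p \<in> chart_dom c"
    using assms(6) by (auto simp: carrier_def)
  obtain f1 f2 where f: "\<forall>p\<in>U. f1 p \<noteq> 0 \<and> f2 p \<noteq> 0 \<and> \<delta> p = sgn (f1 p * f2 p)"
    "eq1 A U \<omega>1 (\<lambda>c p v. f1 p * \<eta>1 c p v)" "eq1 A U \<omega>2 (\<lambda>c p v. f2 p * \<eta>2 c p v)"
    by (rule relative_signE[OF assms(1)])
  obtain g1 g2 where g: "\<forall>p\<in>U. g1 p \<noteq> 0 \<and> g2 p \<noteq> 0 \<and> \<delta>' p = sgn (g1 p * g2 p)"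
    "eq1 A U \<omega>1 (\<lambda>c p v. g1 p * \<eta>1 c p v)" "eq1 A U \<omega>2 (\<lambda>c p v. g2 p * \<eta>2 c p v)"
    by (rule relative_signE[OF assms(2)])
  obtain v1 v2 where v: "\<eta>1 c p v1 \<noteq> 0" "\<eta>2 c p v2 \<noteq> 0"
    using assms(3-5) c unfolding nonvanishing_def by blast
  have at_p: "\<sigma> c p v = \<tau> c p v" if "eq1 A U \<sigma> \<tau>" for \<sigma> \<tau> v
    using that c assms(5) by (simp add: eq1_def)
  have "f1 p * \<eta>1 c p v1 = g1 p * \<eta>1 c p v1"
    using at_p[OF f(2), of v1] at_p[OF g(2), of v1] by auto
  moreover have "f2 p * \<eta>2 c p v2 = g2 p * \<eta>2 c p v2"
    using at_p[OF f(3), of v2] at_p[OF g(3), of v2] by auto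
  ultimately show ?thesis
    using v f(1) g(1) assms(5) by simp
qed

text \<open>A functional is determined by its kernel up to a factor. Both forms transform by the
  same Jacobian, so the factor found in one chart at \<open>p\<close> works in all of them and
  depends on \<open>p\<close> only. It comes from a pointwise choice and carries no regularity
  yet.\<close>

lemma same_distribution_proportional:
  assumes "one_form A U \<sigma>" "one_form A U \<tau>" "nonvanishing A U \<tau>" "same_distribution A U \<sigma> \<tau>" "U \<subseteq> carrier A"
  shows "\<exists>f. (\<forall>p\<in>U. f p \<noteq> 0) \<and> eq1 A U \<sigma> (\<lambda>c p v. f p * \<tau> c p v)"
proof -
  have "\<exists>r. r \<noteq> 0 \<and> (\<forall>c\<in>A. p \<in> chart_dom c \<longrightarrow> (\<forall>v. \<sigma> c p v = r * \<tau> c p v))" if p: "p \<in> U" for p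
  proof -
    obtain c where c: "c \<in> A" "p \<in> chart_dom c"
      using p assms(5) by (auto simp: carrier_def)
    obtain w where w: "\<tau> c p w \<noteq> 0"
      using assms(3) p c unfolding nonvanishing_def by blast
    have ker: "{v. \<sigma> c p v = 0} = {v. \<tau> c p v = 0}"
      using assms(4) p c unfolding same_distribution_def kern_def by blast
    note pr = proportional_if_kernel_eq[OF one_form_linear[OF assms(1) c p] one_form_linear[OF assms(2) c p] ker w]
    have "\<sigma> d p v = \<sigma> c p w / \<tau> c p w * \<tau> d p v" if "d \<in> A" "p \<in> chart_dom d" for d v
      using pr(1)[of "tangent_map id d c p v"]
        one_form_tangent_map[OF assms(1) that(1) c(1) that(2) c(2) p]
        one_form_tangent_map[OF assms(2) that(1) c(1) that(2) c(2) p] by simp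
    then show ?thesis
      using pr(2) w by (intro exI[of _ "\<sigma> c p w / \<tau> c p w"]) auto
  qed
  then obtain f where "\<And>p. p \<in> U \<Longrightarrow> f p \<noteq> 0 \<and> (\<forall>c\<in>A. p \<in> chart_dom c \<longrightarrow> (\<forall>v. \<sigma> c p v = f p * \<tau> c p v))"
    by metis
  then show ?thesis
    by (intro exI[of _ f]) (auto simp: eq1_def fun_eq_iff)
qed

lemma same_distribution_relative_sign:
  assumes "one_form A U \<omega>1" "one_form A U \<omega>2" "one_form A U \<eta>1" "one_form A U \<eta>2"
    "nonvanishing A U \<eta>1" "nonvanishing A U \<eta>2"
    "same_distribution A U \<omega>1 \<eta>1" "same_distribution A U \<omega>2 \<eta>2" "U \<subseteq> carrier A"
  shows "\<exists>\<delta>. relative_sign A U \<eta>1 \<eta>2 \<omega>1 \<omega>2 \<delta>"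
proof -
  obtain f1 where "\<forall>p\<in>U. f1 p \<noteq> 0" "eq1 A U \<omega>1 (\<lambda>c p v. f1 p * \<eta>1 c p v)"
    using same_distribution_proportional[OF assms(1,3,5,7,9)] by blast
  moreover obtain f2 where "\<forall>p\<in>U. f2 p \<noteq> 0" "eq1 A U \<omega>2 (\<lambda>c p v. f2 p * \<eta>2 c p v)"
    using same_distribution_proportional[OF assms(2,4,6,8,9)] by blast
  ultimately show ?thesis
    unfolding relative_sign_def
    by (intro exI[of _ "\<lambda>p. sgn (f1 p * f2 p)"] exI[of _ f1] exI[of _ f2]) simp
qed

section \<open>Torsion quotients of normalised pairs\<close>

context
  fixes A :: "'a::topological_space atlas" and U :: "'a set"
  assumes A: "smooth_atlas A" and U: "open U"
begin

lemma three_form_contact_volume: "one_form A U \<omega> \<Longrightarrow> three_form A U (contact_volume \<omega>)"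
  unfolding contact_volume_def by (intro three_form_wedge12 two_form_ext_d A U)

lemma three_form_cross_volume: "one_form A U \<omega>1 \<Longrightarrow> one_form A U \<omega>2 \<Longrightarrow> three_form A U (cross_volume \<omega>1 \<omega>2)"
  unfolding cross_volume_def by (intro three_form_add three_form_wedge12 two_form_ext_d A U)

lemma cross_volume_eq:
  assumes "normalised A U \<omega>1 \<omega>2" "c \<in> A" "p \<in> chart_dom c" "p \<in> U"
  shows "cross_volume \<omega>1 \<omega>2 c p u v w = 2 * torsion_quotient A \<omega>1 \<omega>2 p * contact_volume \<omega>1 c p u v w"
  using form_ratio[OF A U three_form_cross_volume three_form_contact_volume, of \<omega>1 \<omega>2 \<omega>1 c p u v w] assms
  by (simp add: normalised_def torsion_quotient_def)

text \<open>Near a point, \<open>f\<close> is the quotient of the two forms on one fixed vector that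
  \<open>\<tau>\<close> does not annihilate there; the vector changes from place to place, hence the
  local argument.\<close>

lemma proportional_smooth:
  assumes "one_form A U \<sigma>" "one_form A U \<tau>" "nonvanishing A U \<tau>" "eq1 A U \<sigma> (\<lambda>c p v. f p * \<tau> c p v)"
  shows "smooth_function A U f"
  unfolding smooth_function_def
proof (intro ballI smooth_on_local)
  fix c x assume c: "c \<in> A" and x: "x \<in> coords c ` (chart_dom c \<inter> U)"
  let ?S = "coords c ` (chart_dom c \<inter> U)"
  have opS: "open ?S" by (rule open_coords_Int[OF A c U])
  obtain v where v: "\<tau> c (chart_inv c x) v \<noteq> 0"
    using assms(3) c x unfolding nonvanishing_def by (fastforce simp: chart_inv_coords[OF A c])
  define T where "T = ?S \<inter> (\<lambda>y. \<tau> c (chart_inv c y) v) -` (- {0})"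
  have cont: "continuous_on ?S (\<lambda>y. \<tau> c (chart_inv c y) v)"
    by (rule smooth_on_continuous_on[OF one_form_smooth[OF assms(2) c]])
  have op: "open T"
    unfolding T_def by (rule continuous_open_preimage[OF cont opS]) auto
  have TS: "T \<subseteq> ?S" by (auto simp: T_def)
  have "smooth_on T (f \<circ> chart_inv c)"
  proof (rule smooth_on_cong[OF op])
    show "smooth_on T (\<lambda>y. \<sigma> c (chart_inv c y) v / \<tau> c (chart_inv c y) v)"
      by (intro smooth_on_divide op smooth_on_subset[OF one_form_smooth[OF assms(1) c] TS]
          smooth_on_subset[OF one_form_smooth[OF assms(2) c] TS]) (simp add: T_def)
    show "\<sigma> c (chart_inv c y) v / \<tau> c (chart_inv c y) v = (f \<circ> chart_inv c) y" if "y \<in> T" for y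
    proof -
      have "chart_inv c y \<in> chart_dom c \<inter> U"
        using that TS by (auto simp: chart_inv_coords[OF A c])
      then have "\<sigma> c (chart_inv c y) v = f (chart_inv c y) * \<tau> c (chart_inv c y) v"
        using assms(4) c unfolding eq1_def by (metis (no_types))
      then show ?thesis
        using that by (simp add: T_def)
    qed
  qed
  then show "\<exists>T. open T \<and> x \<in> T \<and> smooth_on T (f \<circ> chart_inv c)"
    using op x v by (intro exI[of _ T]) (auto simp: T_def)
qed

text \<open>The intrinsic form of \<open>normalised_pair_torsion\<close>. Independence of the
  coframe, invariance under bi-contactomorphisms and the criterion for tautness are all derived from
  it.\<close>

lemma torsion_quotient_relative_sign:
  assumes n: "normalised A U \<omega>1 \<omega>2" and n': "normalised A U \<omega>1' \<omega>2'"
    and rs: "relative_sign A U \<omega>1 \<omega>2 \<omega>1' \<omega>2' \<delta>" and p: "p \<in> U" "p \<in> carrier A"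
  shows "torsion_quotient A \<omega>1' \<omega>2' p = \<delta> p * torsion_quotient A \<omega>1 \<omega>2 p"
proof -
  obtain c where c: "c \<in> A" "p \<in> chart_dom c"
    using p by (auto simp: carrier_def)
  obtain f1 f2 where f: "\<forall>p\<in>U. f1 p \<noteq> 0 \<and> f2 p \<noteq> 0 \<and> \<delta> p = sgn (f1 p * f2 p)"
    "eq1 A U \<omega>1' (\<lambda>c p v. f1 p * \<omega>1 c p v)" "eq1 A U \<omega>2' (\<lambda>c p v. f2 p * \<omega>2 c p v)"
    by (rule relative_signE[OF rs])
  have one: "one_form A U \<omega>1" "one_form A U \<omega>2" "one_form A U \<omega>1'" "one_form A U \<omega>2'"
    using n n' by (auto simp: normalised_def)
  \<comment> \<open>\<open>relative_sign\<close> provides factors without regularity, but the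
    computation differentiates them.\<close>
  have sf: "smooth_function A U f1" "smooth_function A U f2"
    using proportional_smooth[OF one(3,1) normalised_nonvanishing(1)[OF n] f(2)]
      proportional_smooth[OF one(4,2) normalised_nonvanishing(2)[OF n] f(3)] .
  let ?S = "coords c ` (chart_dom c \<inter> U)"
  define rep where "rep = (\<lambda>\<omega> :: 'a form1. \<lambda>x. \<omega> c (chart_inv c x))"
  have S: "open ?S" "coords c p \<in> ?S"
    using open_coords_Int[OF A c(1) U] c p by auto
  have inS: "chart_inv c y \<in> chart_dom c" "chart_inv c y \<in> U" "coords c (chart_inv c y) = y" if "y \<in> ?S" for y
    using that by (auto simp: chart_inv_coords[OF A c(1)])
  have wd: "wedge12 \<sigma> (ext_d \<tau>) c (chart_inv c y) = wedge_at (rep \<sigma> y) (coord_d (rep \<tau>) y)" if "y \<in> ?S" for \<sigma> \<tau> y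
    by (simp only: wedge12_wedge_at ext_d_coord_d rep_def inS(3)[OF that])
  have diff: "(\<lambda>y. rep \<omega> y v) differentiable (at y)" if "one_form A U \<omega>" "y \<in> ?S" for \<omega> v y
    unfolding rep_def using smooth_on_differentiable[OF one_form_smooth[OF that(1) c(1)] that(2)] .
  have fdiff: "(f \<circ> chart_inv c) differentiable (at y)" if "smooth_function A U f" "y \<in> ?S" for f y
    using that c(1) unfolding smooth_function_def by (blast intro: smooth_on_differentiable)
  have nz: "contact_volume \<omega> c q (ee 1) (ee 2) (ee 3) \<noteq> 0"
    if "one_form A U \<omega>" "nowhere_zero3 A U (contact_volume \<omega>)" "q \<in> chart_dom c" "q \<in> U" for \<omega> q
    using three_form_nonzero_basis[OF A U three_form_contact_volume[OF that(1)] that(2) c(1) that(3,4)] .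
  have key: "(wedge_at (rep \<omega>1' (coords c p)) (coord_d (rep \<omega>2') (coords c p)) (ee 1) (ee 2) (ee 3) +
      wedge_at (rep \<omega>2' (coords c p)) (coord_d (rep \<omega>1') (coords c p)) (ee 1) (ee 2) (ee 3)) /
      wedge_at (rep \<omega>1' (coords c p)) (coord_d (rep \<omega>1') (coords c p)) (ee 1) (ee 2) (ee 3) =
    sgn ((f1 \<circ> chart_inv c) (coords c p) * (f2 \<circ> chart_inv c) (coords c p)) *
    ((wedge_at (rep \<omega>1 (coords c p)) (coord_d (rep \<omega>2) (coords c p)) (ee 1) (ee 2) (ee 3) +
      wedge_at (rep \<omega>2 (coords c p)) (coord_d (rep \<omega>1) (coords c p)) (ee 1) (ee 2) (ee 3)) /
      wedge_at (rep \<omega>1 (coords c p)) (coord_d (rep \<omega>1) (coords c p)) (ee 1) (ee 2) (ee 3))"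
  proof (rule normalised_pair_torsion[OF S])
    fix y assume y: "y \<in> ?S"
    show "rep \<omega>1' y v = (f1 \<circ> chart_inv c) y * rep \<omega>1 y v" for v
      using f(2) c(1) inS[OF y] by (simp add: eq1_def rep_def)
    show "rep \<omega>2' y v = (f2 \<circ> chart_inv c) y * rep \<omega>2 y v" for v
      using f(3) c(1) inS[OF y] by (simp add: eq1_def rep_def)
    show "(f1 \<circ> chart_inv c) differentiable (at y)" "(f2 \<circ> chart_inv c) differentiable (at y)"
      using fdiff[OF sf(1) y] fdiff[OF sf(2) y] .
    show "(\<lambda>y. rep \<omega>1 y v) differentiable (at y)" "(\<lambda>y. rep \<omega>2 y v) differentiable (at y)" for v
      using diff[OF one(1) y] diff[OF one(2) y] .
    show "(f1 \<circ> chart_inv c) y \<noteq> 0" "(f2 \<circ> chart_inv c) y \<noteq> 0"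
      using f(1) inS(2)[OF y] by auto
    show "wedge_at (rep \<omega>1 y) (coord_d (rep \<omega>1) y) (ee 1) (ee 2) (ee 3) \<noteq> 0"
      using nz[OF one(1) _ inS(1,2)[OF y]] n
      unfolding normalised_def contact_volume_def wd[OF y] by blast
    show "\<bar>wedge_at (rep \<omega>1 y) (coord_d (rep \<omega>1) y) (ee 1) (ee 2) (ee 3)\<bar> =
        \<bar>wedge_at (rep \<omega>2 y) (coord_d (rep \<omega>2) y) (ee 1) (ee 2) (ee 3)\<bar>"
      using n c(1) inS(1,2)[OF y] unfolding normalised_def contact_volume_def wd[OF y, symmetric] by blast
    show "\<bar>wedge_at (rep \<omega>1' y) (coord_d (rep \<omega>1') y) (ee 1) (ee 2) (ee 3)\<bar> =
        \<bar>wedge_at (rep \<omega>2' y) (coord_d (rep \<omega>2') y) (ee 1) (ee 2) (ee 3)\<bar>"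
      using n' c(1) inS(1,2)[OF y] unfolding normalised_def contact_volume_def wd[OF y, symmetric] by blast
  qed
  have quot: "(wedge_at (rep \<sigma> (coords c p)) (coord_d (rep \<tau>) (coords c p)) (ee 1) (ee 2) (ee 3) +
      wedge_at (rep \<tau> (coords c p)) (coord_d (rep \<sigma>) (coords c p)) (ee 1) (ee 2) (ee 3)) /
      wedge_at (rep \<sigma> (coords c p)) (coord_d (rep \<sigma>) (coords c p)) (ee 1) (ee 2) (ee 3) = 2 * torsion_quotient A \<sigma> \<tau> p"
    if "normalised A U \<sigma> \<tau>" for \<sigma> \<tau>
  proof -
    have "contact_volume \<sigma> c p (ee 1) (ee 2) (ee 3) \<noteq> 0"
      using that c p by (intro nz) (auto simp: normalised_def)
    then have "cross_volume \<sigma> \<tau> c p (ee 1) (ee 2) (ee 3) / contact_volume \<sigma> c p (ee 1) (ee 2) (ee 3)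
        = 2 * torsion_quotient A \<sigma> \<tau> p"
      using cross_volume_eq[OF that c p(1), of "ee 1" "ee 2" "ee 3"] by simp
    moreover have "wedge_at (rep \<alpha> (coords c p)) (coord_d (rep \<beta>) (coords c p)) = wedge12 \<alpha> (ext_d \<beta>) c p" for \<alpha> \<beta>
      using wd[OF S(2), of \<alpha> \<beta>] by (simp add: chart_inv_coords[OF A c])
    ultimately show ?thesis
      by (simp add: cross_volume_def contact_volume_def)
  qed
  show ?thesis
    using key bspec[OF f(1) p(1)] unfolding quot[OF n] quot[OF n'] by (simp add: chart_inv_coords[OF A c])
qed

lemma smooth_torsion_quotient:
  assumes "normalised A U \<omega>1 \<omega>2"
  shows "smooth_function A U (torsion_quotient A \<omega>1 \<omega>2)"
proof -
  have sm: "smooth_function A U (form_ratio A (cross_volume \<omega>1 \<omega>2) (contact_volume \<omega>1))"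
    using assms by (intro smooth_form_ratio A U three_form_cross_volume three_form_contact_volume)
      (auto simp: normalised_def)
  have "smooth_on (coords c ` (chart_dom c \<inter> U)) (torsion_quotient A \<omega>1 \<omega>2 \<circ> chart_inv c)" if "c \<in> A" for c
    using smooth_on_mult[OF open_coords_Int[OF A that U] smooth_on_const[of _ "1/2"], of
        "form_ratio A (cross_volume \<omega>1 \<omega>2) (contact_volume \<omega>1) \<circ> chart_inv c"] sm that
    by (simp add: smooth_function_def o_def torsion_quotient_def)
  then show ?thesis by (simp add: smooth_function_def)
qed

text \<open>The derivative of the factor contributes \<omega> \<and> df \<and> \<omega> = 0, so only
  the square of the factor remains.\<close>

lemma contact_volume_scale:
  assumes "one_form A U \<omega>" "smooth_function A U f" "c \<in> A" "p \<in> chart_dom c" "p \<in> U"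
  shows "contact_volume (\<lambda>c p v. f p * \<omega> c p v) c p u v w = (f p)\<^sup>2 * contact_volume \<omega> c p u v w"
proof -
  let ?S = "coords c ` (chart_dom c \<inter> U)" and ?D = "frechet_derivative (f \<circ> chart_inv c) (at (coords c p))"
  have S: "open ?S" "coords c p \<in> ?S"
    using open_coords_Int[OF A assms(3) U] assms by auto
  have fd: "(f \<circ> chart_inv c) differentiable (at (coords c p))"
    using assms(2,3) S(2) unfolding smooth_function_def by (blast intro: smooth_on_differentiable)
  have od: "(\<lambda>y. \<omega> c (chart_inv c y) v) differentiable (at (coords c p))" for v
    by (rule smooth_on_differentiable[OF one_form_smooth[OF assms(1,3)] S(2)])
  have "ext_d (\<lambda>c p v. f p * \<omega> c p v) c p u v = f p * ext_d \<omega> c p u v + (?D u * \<omega> c p v - ?D v * \<omega> c p u)" for u v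
    using coord_d_scale[OF S, of "\<lambda>y v. f (chart_inv c y) * \<omega> c (chart_inv c y) v" "f \<circ> chart_inv c"
        "\<lambda>y. \<omega> c (chart_inv c y)" u v, OF _ fd od]
    by (simp add: ext_d_coord_d chart_inv_coords[OF A assms(3,4)])
  note d = this
  show ?thesis
    unfolding contact_volume_def wedge12_def d by algebra
qed

lemma normalised_scale:
  assumes "contact_form A U \<eta>1" "contact_form A U \<eta>2"
  shows "\<exists>h. (\<forall>p\<in>U \<inter> carrier A. h p > 0) \<and> normalised A U (\<lambda>c p v. h p * \<eta>1 c p v) \<eta>2"
proof -
  define r where "r = form_ratio A (contact_volume \<eta>2) (contact_volume \<eta>1)"
  \<comment> \<open>\<open>r\<close> has no zeros because \<open>\<eta>2\<close> is a contact form,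
    so the root of its absolute value is smooth. With the positive root the rescaled pair has
    relative sign 1 to the given one.\<close>
  define h where "h p = sqrt \<bar>r p\<bar>" for p
  have one: "one_form A U \<eta>1" "one_form A U \<eta>2"
    and nz: "nowhere_zero3 A U (contact_volume \<eta>1)" "nowhere_zero3 A U (contact_volume \<eta>2)"
    using assms by (auto simp: contact_form_def contact_volume_def)
  have req: "contact_volume \<eta>2 c p u v w = r p * contact_volume \<eta>1 c p u v w"
    if "c \<in> A" "p \<in> chart_dom c" "p \<in> U" for c p u v w
    unfolding r_def using form_ratio[OF A U three_form_contact_volume[OF one(2)] three_form_contact_volume[OF one(1)] nz(1) that] .
  have r0: "r p \<noteq> 0" if "p \<in> U" "c \<in> A" "p \<in> chart_dom c" for c p
    using nz(2) req[OF that(2,3,1)] that unfolding nowhere_zero3_def by force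
  have pos: "h p > 0" if "p \<in> U" "c \<in> A" "p \<in> chart_dom c" for c p
    using r0[OF that] by (simp add: h_def)
  have sr: "smooth_function A U r"
    unfolding r_def by (intro smooth_form_ratio[OF A U] three_form_contact_volume one nz)
  have sh: "smooth_function A U h"
    unfolding smooth_function_def
  proof
    fix c assume c: "c \<in> A"
    have "r (chart_inv c x) \<noteq> 0" if "x \<in> coords c ` (chart_dom c \<inter> U)" for x
      using that r0[OF _ c] by (auto simp: chart_inv_coords[OF A c])
    moreover have "smooth_on (coords c ` (chart_dom c \<inter> U)) (\<lambda>x. r (chart_inv c x))"
      using sr c by (simp add: smooth_function_def o_def)
    ultimately show "smooth_on (coords c ` (chart_dom c \<inter> U)) (h \<circ> chart_inv c)"
      unfolding h_def o_def by (intro smooth_on_sqrt smooth_on_abs open_coords_Int[OF A c U]) auto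
  qed
  have cv: "contact_volume (\<lambda>c p v. h p * \<eta>1 c p v) c p u v w = \<bar>r p\<bar> * contact_volume \<eta>1 c p u v w"
    if "c \<in> A" "p \<in> chart_dom c" "p \<in> U" for c p u v w
    using contact_volume_scale[OF one(1) sh that] by (simp add: h_def)
  have "normalised A U (\<lambda>c p v. h p * \<eta>1 c p v) \<eta>2"
    unfolding normalised_def
  proof (intro conjI ballI allI one one_form_scale[OF A U one(1) sh])
    show "nowhere_zero3 A U (contact_volume (\<lambda>c p v. h p * \<eta>1 c p v))"
      using nz(1) r0 cv unfolding nowhere_zero3_def by force
    show "\<bar>contact_volume (\<lambda>c p v. h p * \<eta>1 c p v) c p u v w\<bar> = \<bar>contact_volume \<eta>2 c p u v w\<bar>"
      if "c \<in> A" "p \<in> chart_dom c \<inter> U" for c p u v w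
      using that cv[of c p u v w] req[of c p u v w] by (simp add: abs_mult)
  qed
  moreover have "\<forall>p\<in>U \<inter> carrier A. h p > 0"
    using pos by (auto simp: carrier_def)
  ultimately show ?thesis by blast
qed

end

section \<open>Adapted coframes\<close>

context
  fixes A :: "'a::topological_space atlas" and U :: "'a set"
  assumes A: "smooth_atlas A" and U: "open U"
begin

lemma adapted_coframe_normalised:
  assumes "adapted_coframe A \<eta>1 \<eta>2 U \<epsilon> \<omega>1 \<omega>2 \<omega>3"
  shows "normalised A U \<omega>1 \<omega>2"
  unfolding normalised_def
proof (intro conjI ballI allI)
  have e: "\<bar>\<epsilon>\<bar> = 1" using assms by (auto simp: adapted_coframe_def)
  have 1: "contact_volume \<omega>1 c p = wedge12 \<omega>1 (wedge11 \<omega>2 \<omega>3) c p" if "c \<in> A" "p \<in> chart_dom c \<inter> U" for c p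
    using assms that unfolding adapted_coframe_def eq3_def contact_volume_def by blast
  have 2: "- \<epsilon> * contact_volume \<omega>2 c p u v w = wedge12 \<omega>1 (wedge11 \<omega>2 \<omega>3) c p u v w"
    if "c \<in> A" "p \<in> chart_dom c \<inter> U" for c p u v w
    using assms that unfolding adapted_coframe_def eq3_def contact_volume_def by (simp add: fun_eq_iff)
  show "one_form A U \<omega>1" "one_form A U \<omega>2"
    using assms by (auto simp: adapted_coframe_def)
  show "nowhere_zero3 A U (contact_volume \<omega>1)"
    using assms 1 by (simp add: adapted_coframe_def nowhere_zero3_def)
  show "\<bar>contact_volume \<omega>1 c p u v w\<bar> = \<bar>contact_volume \<omega>2 c p u v w\<bar>"
    if "c \<in> A" "p \<in> chart_dom c \<inter> U" for c p u v w
    unfolding 1[OF that] 2[OF that, symmetric] using e by (simp add: abs_mult)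
qed

text \<open>In \<omega>1 \<and> d\<omega>2 + \<omega>2 \<and> d\<omega>1 the two terms with
  \<open>\<alpha>\<close> cancel, those with coefficients 1 and \<open>\<epsilon>\<close> contain a
  repeated factor, and the two terms with \<open>C\<close> agree. So the structure equations
  determine \<open>C\<close> whatever \<open>\<alpha>\<close> is.\<close>

lemma coframe_torsion_eq_quotient:
  assumes ad: "adapted_coframe A \<eta>1 \<eta>2 U \<epsilon> \<omega>1 \<omega>2 \<omega>3"
    and ct: "coframe_torsion A U \<epsilon> \<omega>1 \<omega>2 \<omega>3 C" and p: "p \<in> U" "p \<in> carrier A"
  shows "C p = torsion_quotient A \<omega>1 \<omega>2 p"
proof -
  obtain c where c: "c \<in> A" "p \<in> chart_dom c"
    using p by (auto simp: carrier_def)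
  obtain \<alpha> \<beta>1 \<beta>2 where se: "structure_equations A U \<epsilon> \<omega>1 \<omega>2 \<omega>3 \<alpha> \<beta>1 \<beta>2 C"
    using ct unfolding coframe_torsion_def by (elim conjE exE)
  note n = adapted_coframe_normalised[OF ad]
  have d1: "ext_d \<omega>1 c p u v =
      - wedge11 \<alpha> \<omega>1 c p u v - C p * wedge11 \<omega>1 \<omega>3 c p u v + wedge11 \<omega>2 \<omega>3 c p u v"
    and d2: "ext_d \<omega>2 c p u v =
      - wedge11 \<alpha> \<omega>2 c p u v + \<epsilon> * wedge11 \<omega>1 \<omega>3 c p u v + C p * wedge11 \<omega>2 \<omega>3 c p u v" for u v
    using se c p(1) unfolding structure_equations_def eq2_def by simp_all
  have vol: "contact_volume \<omega>1 c p = wedge12 \<omega>1 (wedge11 \<omega>2 \<omega>3) c p"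
    using ad c p unfolding adapted_coframe_def eq3_def contact_volume_def by blast
  have "cross_volume \<omega>1 \<omega>2 c p u v w = 2 * C p * wedge12 \<omega>1 (wedge11 \<omega>2 \<omega>3) c p u v w" for u v w
    unfolding cross_volume_def wedge12_def by (simp only: d1 d2 wedge11_def) algebra
  then have "2 * C p * contact_volume \<omega>1 c p u v w = 2 * torsion_quotient A \<omega>1 \<omega>2 p * contact_volume \<omega>1 c p u v w" for u v w
    using cross_volume_eq[OF A U n c p(1), of u v w] by (simp add: vol)
  moreover obtain u v w where "contact_volume \<omega>1 c p u v w \<noteq> 0"
    using n c p(1) unfolding normalised_def nowhere_zero3_def by blast
  ultimately show ?thesis
    by (metis mult_cancel_left mult_cancel_right zero_neq_numeral)
qed

text \<open>In terms of \<omega>1 \<and> \<omega>2, \<omega>1 \<and> \<omega>3 and \<omega>2 \<and>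
  \<omega>3 the forms d\<omega>1 and d\<omega>2 have six coefficients. Two are fixed by the
  normalisation. The components of \<open>\<alpha>\<close> along \<omega>1 and \<omega>2 absorb the
  two coefficients of \<omega>1 \<and> \<omega>2. To the remaining two the component of
  \<open>\<alpha>\<close> along \<omega>3 contributes equally and \<open>C\<close> with opposite
  signs; so \<open>C\<close> is half the sum of \<open>r \<omega>1 \<omega>2\<close> and
  \<open>r \<omega>2 \<omega>1\<close>, and the component is half their difference. The equation for
  d\<omega>3 can always be solved, as each of the three products contains \<omega>1 or
  \<omega>2.\<close>

lemma adapted_coframe_torsion:
  assumes ad: "adapted_coframe A \<eta>1 \<eta>2 U \<epsilon> \<omega>1 \<omega>2 \<omega>3"
  shows "coframe_torsion A U \<epsilon> \<omega>1 \<omega>2 \<omega>3 (torsion_quotient A \<omega>1 \<omega>2)"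
proof -
  note n = adapted_coframe_normalised[OF ad]
  have e: "\<epsilon> * \<epsilon> = 1" using ad by (auto simp: adapted_coframe_def)
  have one: "one_form A U \<omega>1" "one_form A U \<omega>2" "one_form A U \<omega>3"
    using ad by (simp_all add: adapted_coframe_def)
  define vol where "vol = wedge12 \<omega>1 (wedge11 \<omega>2 \<omega>3)"
  have tvol: "three_form A U vol"
    unfolding vol_def by (intro three_form_wedge12 two_form_wedge11 A U one)
  have nz: "nowhere_zero3 A U vol"
    using ad by (simp add: adapted_coframe_def vol_def)
  define r where "r \<sigma> \<tau> = form_ratio A (wedge12 \<sigma> (ext_d \<tau>)) vol" for \<sigma> \<tau>
  have r: "wedge12 \<sigma> (ext_d \<tau>) c p u v w = r \<sigma> \<tau> p * vol c p u v w"
    if "one_form A U \<sigma>" "one_form A U \<tau>" "c \<in> A" "p \<in> chart_dom c" "p \<in> U" for \<sigma> \<tau> c p u v w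
    unfolding r_def
    by (rule form_ratio[OF A U three_form_wedge12[OF A U that(1) two_form_ext_d[OF A U that(2)]] tvol nz that(3-5)])
  have sr: "smooth_function A U (r \<sigma> \<tau>)" if "one_form A U \<sigma>" "one_form A U \<tau>" for \<sigma> \<tau>
    unfolding r_def
    by (rule smooth_form_ratio[OF A U three_form_wedge12[OF A U that(1) two_form_ext_d[OF A U that(2)]] tvol nz])
  have expand: "ext_d \<tau> c p u v = r \<omega>3 \<tau> p * wedge11 \<omega>1 \<omega>2 c p u v - r \<omega>2 \<tau> p * wedge11 \<omega>1 \<omega>3 c p u v
      + r \<omega>1 \<tau> p * wedge11 \<omega>2 \<omega>3 c p u v"
    if "one_form A U \<tau>" "c \<in> A" "p \<in> chart_dom c" "p \<in> U" for \<tau> c p u v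
  proof -
    have N: "vol c p (ee 1) (ee 2) (ee 3) \<noteq> 0"
      by (rule three_form_nonzero_basis[OF A U tvol nz that(2-4)])
    have alt: "alt2 (ext_d \<tau> c p)"
      using two_form_ext_d[OF A U that(1)] that(2-4) unfolding two_form_def by blast
    have "vol c p (ee 1) (ee 2) (ee 3) * ext_d \<tau> c p u v =
        wedge12 \<omega>3 (ext_d \<tau>) c p (ee 1) (ee 2) (ee 3) * wedge11 \<omega>1 \<omega>2 c p u v
      - wedge12 \<omega>2 (ext_d \<tau>) c p (ee 1) (ee 2) (ee 3) * wedge11 \<omega>1 \<omega>3 c p u v
      + wedge12 \<omega>1 (ext_d \<tau>) c p (ee 1) (ee 2) (ee 3) * wedge11 \<omega>2 \<omega>3 c p u v"
      unfolding vol_def wedge12_wedge_at wedge11_def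
      by (rule coframe_expansion[OF one_form_linear[OF one(1) that(2-4)]
            one_form_linear[OF one(2) that(2-4)] one_form_linear[OF one(3) that(2-4)] alt])
    also have "\<dots> = vol c p (ee 1) (ee 2) (ee 3) * (r \<omega>3 \<tau> p * wedge11 \<omega>1 \<omega>2 c p u v
        - r \<omega>2 \<tau> p * wedge11 \<omega>1 \<omega>3 c p u v + r \<omega>1 \<tau> p * wedge11 \<omega>2 \<omega>3 c p u v)"
      by (simp only: r[OF one(1) that] r[OF one(2) that] r[OF one(3) that]) algebra
    finally show ?thesis
      using N by simp
  qed
  have coeffs: "r \<omega>1 \<omega>1 p = 1 \<and> r \<omega>2 \<omega>2 p = - \<epsilon> \<and> r \<omega>1 \<omega>2 p + r \<omega>2 \<omega>1 p = 2 * torsion_quotient A \<omega>1 \<omega>2 p"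
    if "c \<in> A" "p \<in> chart_dom c" "p \<in> U" for c p
  proof -
    have N: "vol c p (ee 1) (ee 2) (ee 3) \<noteq> 0"
      by (rule three_form_nonzero_basis[OF A U tvol nz that])
    have cv: "contact_volume \<omega>1 c p = vol c p"
      using ad that unfolding adapted_coframe_def eq3_def contact_volume_def vol_def by blast
    have cv2: "- \<epsilon> * contact_volume \<omega>2 c p u v w = vol c p u v w" for u v w
      using ad that unfolding adapted_coframe_def eq3_def contact_volume_def vol_def by (simp add: fun_eq_iff)
    have "r \<omega>1 \<omega>1 p = 1"
      using r[OF one(1,1) that, of "ee 1" "ee 2" "ee 3"] cv N by (simp add: contact_volume_def)
    moreover have "r \<omega>2 \<omega>2 p = - \<epsilon>"
    proof -
      have "- \<epsilon> * (r \<omega>2 \<omega>2 p * vol c p (ee 1) (ee 2) (ee 3)) = vol c p (ee 1) (ee 2) (ee 3)"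
        using r[OF one(2,2) that, of "ee 1" "ee 2" "ee 3"] cv2[of "ee 1" "ee 2" "ee 3"]
        by (simp add: contact_volume_def)
      then have "- \<epsilon> * r \<omega>2 \<omega>2 p = 1"
        using N by (metis mult.assoc mult_cancel_right mult_1)
      then show ?thesis
        using e by algebra
    qed
    moreover have "(r \<omega>1 \<omega>2 p + r \<omega>2 \<omega>1 p) * vol c p (ee 1) (ee 2) (ee 3) =
        2 * torsion_quotient A \<omega>1 \<omega>2 p * vol c p (ee 1) (ee 2) (ee 3)"
      using cross_volume_eq[OF A U n that, of "ee 1" "ee 2" "ee 3"]
        r[OF one(1,2) that, of "ee 1" "ee 2" "ee 3"] r[OF one(2,1) that, of "ee 1" "ee 2" "ee 3"]
      by (simp add: cross_volume_def cv distrib_right)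
    ultimately show ?thesis using N by simp
  qed
  \<comment> \<open>Solves the structure equations for \<open>\<alpha>\<close>, \<open>\<beta>1\<close>, \<open>\<beta>2\<close>, where \<open>r \<sigma> \<tau>\<close> is the ratio of
    \<open>\<sigma> \<and> d\<tau>\<close> to \<open>\<omega>1 \<and> \<omega>2 \<and> \<omega>3\<close>.\<close>
  define \<alpha> where "\<alpha> = lin_comb 1 1
    (lin_comb (-1) 1 (\<lambda>c p v. r \<omega>3 \<omega>2 p * \<omega>1 c p v) (\<lambda>c p v. r \<omega>3 \<omega>1 p * \<omega>2 c p v))
    (lin_comb (1/2) (-1/2) (\<lambda>c p v. r \<omega>1 \<omega>2 p * \<omega>3 c p v) (\<lambda>c p v. r \<omega>2 \<omega>1 p * \<omega>3 c p v))"
  define \<beta>1 where "\<beta>1 = lin_comb 1 (-1) (\<lambda>c p v. r \<omega>3 \<omega>3 p * \<omega>2 c p v) (\<lambda>c p v. r \<omega>2 \<omega>3 p * \<omega>3 c p v)"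
  define \<beta>2 where "\<beta>2 = (\<lambda>c p v. r \<omega>1 \<omega>3 p * \<omega>3 c p v)"
  have "one_form A U \<alpha>" "one_form A U \<beta>1" "one_form A U \<beta>2"
    unfolding \<alpha>_def \<beta>1_def \<beta>2_def
    by (intro one_form_lin_comb one_form_scale A U one sr)+
  moreover have "structure_equations A U \<epsilon> \<omega>1 \<omega>2 \<omega>3 \<alpha> \<beta>1 \<beta>2 (torsion_quotient A \<omega>1 \<omega>2)"
    unfolding structure_equations_def eq2_def
  proof (intro conjI ballI ext)
    fix c p u v assume c: "c \<in> A" and "p \<in> chart_dom c \<inter> U"
    then have p: "p \<in> chart_dom c" "p \<in> U" by auto
    note co = coeffs[OF c p]
    show "ext_d \<omega>1 c p u v = - wedge11 \<alpha> \<omega>1 c p u v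
        - torsion_quotient A \<omega>1 \<omega>2 p * wedge11 \<omega>1 \<omega>3 c p u v + wedge11 \<omega>2 \<omega>3 c p u v"
      unfolding expand[OF one(1) c p] wedge11_def \<alpha>_def lin_comb_def using co by (simp add: field_simps) algebra
    show "ext_d \<omega>2 c p u v = - wedge11 \<alpha> \<omega>2 c p u v
        + \<epsilon> * wedge11 \<omega>1 \<omega>3 c p u v + torsion_quotient A \<omega>1 \<omega>2 p * wedge11 \<omega>2 \<omega>3 c p u v"
      unfolding expand[OF one(2) c p] wedge11_def \<alpha>_def lin_comb_def using co by (simp add: field_simps) algebra
    show "ext_d \<omega>3 c p u v = - wedge11 \<beta>1 \<omega>1 c p u v - wedge11 \<beta>2 \<omega>2 c p u v"
      unfolding expand[OF one(3) c p] wedge11_def \<beta>1_def \<beta>2_def lin_comb_def by algebra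
  qed
  ultimately show ?thesis
    unfolding coframe_torsion_def using smooth_torsion_quotient[OF A U n] by blast
qed

end

section \<open>Local existence of adapted coframes\<close>

lemma smooth_function_continuous_on:
  assumes "smooth_atlas A" "c \<in> A" "smooth_function A (chart_dom c) f"
  shows "continuous_on (chart_dom c) f"
proof -
  have "smooth_on (coords c ` chart_dom c) (f \<circ> chart_inv c)"
    using assms by (simp add: smooth_function_def) (metis Int_absorb)
  then have "continuous_on (coords c ` chart_dom c) (f \<circ> chart_inv c)"
    by (rule smooth_on_continuous_on)
  moreover have "continuous_on (chart_dom c) (coords c)"
    using chart_homeomorphism[OF assms(1,2)] by (simp add: homeomorphism_def)
  ultimately have "continuous_on (chart_dom c) ((f \<circ> chart_inv c) \<circ> coords c)"
    by (rule continuous_on_compose[rotated])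
  then show ?thesis
    by (rule continuous_on_eq) (simp add: chart_inv_coords[OF assms(1,2)])
qed

text \<open>This is the differential of the i-th coordinate of \<open>c0\<close>, expressed in every
  other chart by a Jacobian; its transformation rule is the chain rule for chart changes.\<close>

lemma one_form_coordinate:
  assumes A: "smooth_atlas A" and c0: "c0 \<in> A"
  shows "one_form A (chart_dom c0) (\<lambda>c p v. tangent_map id c c0 p v $ i)"
  unfolding one_form_def
proof (intro ballI conjI allI)
  fix c assume c: "c \<in> A"
  show "linear (\<lambda>v. tangent_map id c c0 p v $ i)" if "p \<in> chart_dom c \<inter> chart_dom c0" for p
    using linear_compose[OF linear_tangent_map[OF smooth_map_id[OF A] c c0]
        bounded_linear.linear[OF bounded_linear_vec_nth]] that by (simp add: o_def)
  let ?S = "coords c ` (chart_dom c \<inter> chart_dom c0)"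
  have op: "open ?S"
    by (rule open_coords_Int[OF A c open_chart_dom[OF A c0]])
  show "smooth_on ?S (\<lambda>x. tangent_map id c c0 (chart_inv c x) v $ i)" for v
  proof (rule smooth_on_cong[OF op])
    have "smooth_on ?S (coords c0 \<circ> id \<circ> chart_inv c)"
      using smooth_map_coords[OF smooth_map_id[OF A] c c0] by simp
    then show "smooth_on ?S (\<lambda>x. frechet_derivative (coords c0 \<circ> id \<circ> chart_inv c) (at x) v $ i)"
      by (intro smooth_on_bounded_linear[OF op bounded_linear_vec_nth] smooth_on_frechet_derivative)
    show "frechet_derivative (coords c0 \<circ> id \<circ> chart_inv c) (at x) v $ i =
        tangent_map id c c0 (chart_inv c x) v $ i" if "x \<in> ?S" for x
      using that by (auto simp: tangent_map_def chart_inv_coords[OF A c])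
  qed
  show "tangent_map id c c0 p v $ i = tangent_map id d c0 p (tangent_map id c d p v) $ i"
    if "d \<in> A" "p \<in> chart_dom c \<inter> chart_dom d \<inter> chart_dom c0" for d p v
    using tangent_map_comp[OF A A A smooth_map_id[OF A] smooth_map_id[OF A] c that(1) c0, of p] that(2)
    by simp
qed

text \<open>Near \<open>p\<close> some coordinate differential completes the pair to a coframe, and
  rescaling it adjusts the volume form. The ratio of the two contact volumes is 1 or -1 and
  continuous, hence locally constant, which yields one \<open>\<epsilon>\<close> for a whole
  neighbourhood.\<close>

lemma exists_adapted_coframe:
  assumes A: "smooth_atlas A" and n: "normalised A (carrier A) \<omega>1 \<omega>2"
    and ker: "\<And>c p. c \<in> A \<Longrightarrow> p \<in> chart_dom c \<Longrightarrow> kern \<omega>1 c p \<noteq> kern \<omega>2 c p"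
    and same: "same_distribution A (carrier A) \<omega>1 \<eta>1" "same_distribution A (carrier A) \<omega>2 \<eta>2"
    and p: "p \<in> carrier A"
  shows "\<exists>U \<epsilon> \<omega>3. open_in_manifold A U \<and> p \<in> U \<and> adapted_coframe A \<eta>1 \<eta>2 U \<epsilon> \<omega>1 \<omega>2 \<omega>3"
proof -
  obtain c0 where c0: "c0 \<in> A" "p \<in> chart_dom c0"
    using p by (auto simp: carrier_def)
  let ?W = "chart_dom c0"
  have W: "open ?W" "?W \<subseteq> carrier A"
    using open_chart_dom[OF A c0(1)] chart_dom_subset_carrier[OF c0(1)] .
  have nW: "normalised A ?W \<omega>1 \<omega>2"
    by (rule normalised_subset[OF n W(2)])
  have one: "one_form A ?W \<omega>1" "one_form A ?W \<omega>2"
    using nW by (auto simp: normalised_def)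
  have nz: "nowhere_zero3 A ?W (contact_volume \<omega>1)"
    using nW by (simp add: normalised_def)
  have id: "tangent_map id c0 c0 p = id"
    using tangent_map_eq_id[OF A c0] by simp
  have "\<omega>1 c0 p \<noteq> (\<lambda>_. 0)" "\<omega>2 c0 p \<noteq> (\<lambda>_. 0)"
    using normalised_nonvanishing[OF nW] c0 unfolding nonvanishing_def by (metis IntI)+
  moreover have "{v. \<omega>1 c0 p v = 0} \<noteq> {v. \<omega>2 c0 p v = 0}"
    using ker[OF c0] by (simp add: kern_def)
  ultimately obtain i where i: "wedge_at (\<omega>1 c0 p) (\<lambda>u v. \<omega>2 c0 p u * v $ i - \<omega>2 c0 p v * u $ i) (ee 1) (ee 2) (ee 3) \<noteq> 0"
    using exists_transverse_coordinate[OF one_form_linear[OF one(1) c0 c0(2)] one_form_linear[OF one(2) c0 c0(2)]] by blast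
  define dx where "dx = (\<lambda>c p v. tangent_map id c c0 p v $ i)"
  have dx: "one_form A ?W dx"
    unfolding dx_def by (rule one_form_coordinate[OF A c0(1)])
  define vol where "vol = wedge12 \<omega>1 (wedge11 \<omega>2 dx)"
  have tvol: "three_form A ?W vol"
    unfolding vol_def by (intro three_form_wedge12 two_form_wedge11 A W one dx)
  have volp: "vol c0 p (ee 1) (ee 2) (ee 3) \<noteq> 0"
    using i by (simp add: vol_def wedge12_wedge_at wedge11_def dx_def id)
  define f where "f = form_ratio A vol (contact_volume \<omega>1)"
  define \<rho> where "\<rho> = form_ratio A (contact_volume \<omega>2) (contact_volume \<omega>1)"
  have cv: "three_form A ?W (contact_volume \<omega>1)" "three_form A ?W (contact_volume \<omega>2)"
    by (intro three_form_contact_volume A W one)+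
  have feq: "vol c q u v w = f q * contact_volume \<omega>1 c q u v w"
    if "c \<in> A" "q \<in> chart_dom c" "q \<in> ?W" for c q u v w
    unfolding f_def by (rule form_ratio[OF A W(1) tvol cv(1) nz that])
  have req: "contact_volume \<omega>2 c q u v w = \<rho> q * contact_volume \<omega>1 c q u v w"
    if "c \<in> A" "q \<in> chart_dom c" "q \<in> ?W" for c q u v w
    unfolding \<rho>_def by (rule form_ratio[OF A W(1) cv(2,1) nz that])
  have basis: "contact_volume \<omega>1 c0 q (ee 1) (ee 2) (ee 3) \<noteq> 0" if "q \<in> ?W" for q
    by (rule three_form_nonzero_basis[OF A W(1) cv(1) nz c0(1) that that])
  have \<rho>1: "\<rho> q = 1 \<or> \<rho> q = -1" if "q \<in> ?W" for q
  proof -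
    have "\<bar>contact_volume \<omega>1 c0 q (ee 1) (ee 2) (ee 3)\<bar> = \<bar>contact_volume \<omega>2 c0 q (ee 1) (ee 2) (ee 3)\<bar>"
      using nW that c0(1) unfolding normalised_def by blast
    then have "\<bar>\<rho> q\<bar> = 1"
      using basis[OF that] by (simp add: req[OF c0(1) that that] abs_mult)
    then show ?thesis by arith
  qed
  have cont: "continuous_on ?W f" "continuous_on ?W \<rho>"
    unfolding f_def \<rho>_def
    by (intro smooth_function_continuous_on[OF A c0(1)] smooth_form_ratio[OF A W(1)] tvol cv nz)+
  \<comment> \<open>Where \<open>f\<close> is nonzero the three forms are independent. The values of
    \<open>\<rho>\<close> are 1 or -1, two apart, so radius 1 forces \<open>\<rho>\<close> to keep
    its value at \<open>p\<close>.\<close>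
  define U where "U = (?W \<inter> f -` (- {0})) \<inter> (?W \<inter> \<rho> -` ball (\<rho> p) 1)"
  have opU: "open U"
    unfolding U_def
    by (intro open_Int continuous_open_preimage[OF cont(1) W(1)] continuous_open_preimage[OF cont(2) W(1)]) auto
  have UW: "U \<subseteq> ?W"
    by (auto simp: U_def)
  have "f p \<noteq> 0"
    using volp feq[OF c0 c0(2), of "ee 1" "ee 2" "ee 3"] by auto
  then have pU: "p \<in> U"
    using c0 by (simp add: U_def)
  have \<rho>U: "\<rho> q = \<rho> p" if "q \<in> U" for q
    using that \<rho>1[of q] \<rho>1[OF c0(2)] by (auto simp: U_def dist_real_def)
  have nzU: "nowhere_zero3 A U vol"
    unfolding nowhere_zero3_def
  proof (intro ballI)
    fix c q assume c: "c \<in> A" and q: "q \<in> chart_dom c \<inter> U"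
    then obtain u v w where "contact_volume \<omega>1 c q u v w \<noteq> 0"
      using nz UW unfolding nowhere_zero3_def by blast
    then have "vol c q u v w \<noteq> 0"
      using feq[OF c, of q u v w] q UW by (auto simp: U_def)
    then show "\<exists>u v w. vol c q u v w \<noteq> 0" by blast
  qed
  have oneU: "one_form A U \<omega>1" "one_form A U \<omega>2" "one_form A U dx"
    using one dx one_form_subset[OF _ UW] by auto
  \<comment> \<open>On \<open>U\<close> this is the reciprocal of \<open>f\<close>: multiplying
    \<open>dx\<close> by it turns \<omega>1 \<and> \<omega>2 \<and> dx into the contact volume of
    \<omega>1.\<close>
  define g where "g = form_ratio A (contact_volume \<omega>1) vol"
  have tU: "three_form A U vol" "three_form A U (contact_volume \<omega>1)"
    unfolding vol_def by (intro three_form_wedge12 two_form_wedge11 three_form_contact_volume A opU oneU)+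
  have geq: "contact_volume \<omega>1 c q u v w = g q * vol c q u v w"
    if "c \<in> A" "q \<in> chart_dom c" "q \<in> U" for c q u v w
    unfolding g_def by (rule form_ratio[OF A opU tU(2,1) nzU that])
  have sg: "smooth_function A U g"
    unfolding g_def by (rule smooth_form_ratio[OF A opU tU(2,1) nzU])
  define \<omega>3 where "\<omega>3 = (\<lambda>c q v. g q * dx c q v)"
  have vol3: "wedge12 \<omega>1 (wedge11 \<omega>2 \<omega>3) c q u v w = contact_volume \<omega>1 c q u v w"
    if "c \<in> A" "q \<in> chart_dom c" "q \<in> U" for c q u v w
    unfolding geq[OF that] vol_def \<omega>3_def wedge12_def wedge11_def by algebra
  \<comment> \<open>Since \<omega>2 \<and> d\<omega>2 = \<rho> \<omega>1 \<and> d\<omega>1 and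
    \<rho>^2 = 1, the condition on \<omega>2 holds for \<epsilon> = -\<rho>.\<close>
  have "adapted_coframe A \<eta>1 \<eta>2 U (- \<rho> p) \<omega>1 \<omega>2 \<omega>3"
    unfolding adapted_coframe_def
  proof (intro conjI)
    show "- \<rho> p = 1 \<or> - \<rho> p = - 1"
      using \<rho>1[OF c0(2)] by auto
    show "one_form A U \<omega>1" "one_form A U \<omega>2" "one_form A U \<omega>3"
      unfolding \<omega>3_def by (intro oneU one_form_scale A opU sg)+
    show "nowhere_zero3 A U (wedge12 \<omega>1 (wedge11 \<omega>2 \<omega>3))"
      using nowhere_zero3_subset[OF nz UW] by (simp add: nowhere_zero3_def vol3)
    show "same_distribution A U \<omega>1 \<eta>1" "same_distribution A U \<omega>2 \<eta>2"
      using same UW W(2) unfolding same_distribution_def by blast+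
    show "eq3 A U (wedge12 \<omega>1 (ext_d \<omega>1)) (wedge12 \<omega>1 (wedge11 \<omega>2 \<omega>3))"
      unfolding eq3_def by (auto simp: vol3 fun_eq_iff contact_volume_def)
    show "eq3 A U (\<lambda>c q u v w. - (- \<rho> p) * wedge12 \<omega>2 (ext_d \<omega>2) c q u v w)
        (wedge12 \<omega>1 (wedge11 \<omega>2 \<omega>3))"
      unfolding eq3_def
    proof (intro ballI ext)
      fix c q u v w assume c: "c \<in> A" and "q \<in> chart_dom c \<inter> U"
      then have q: "q \<in> chart_dom c" "q \<in> U" "q \<in> ?W"
        using UW by auto
      have "\<rho> q * \<rho> q = 1"
        using \<rho>1[OF q(3)] by auto
      then show "- (- \<rho> p) * wedge12 \<omega>2 (ext_d \<omega>2) c q u v w = wedge12 \<omega>1 (wedge11 \<omega>2 \<omega>3) c q u v w"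
        using req[OF c q(1,3), of u v w] vol3[OF c q(1,2), of u v w] \<rho>U[OF q(2)]
        by (simp add: contact_volume_def mult.assoc[symmetric])
    qed
  qed
  then show ?thesis
    using opU pU UW W(2) unfolding open_in_manifold_def by blast
qed

section \<open>Pullback by diffeomorphisms\<close>

text \<open>The chain rule for both composites with the inverse map. Surjectivity keeps pulled back
  volumes nonzero, injectivity lets kernels be compared.\<close>

lemma tangent_map_bij:
  assumes at: "smooth_atlas A" "smooth_atlas B" and Phi: "diffeomorphism A B \<Phi>"
    and charts: "c \<in> A" "d \<in> B" "p \<in> chart_dom c" "\<Phi> p \<in> chart_dom d"
  shows "bij (tangent_map \<Phi> c d p)"
proof (rule o_bij)
  let ?\<Psi> = "inv_into (carrier A) \<Phi>"
  have sm: "smooth_map A B \<Phi>" "smooth_map B A ?\<Psi>" and bij: "bij_betw \<Phi> (carrier A) (carrier B)"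
    using Phi by (auto simp: diffeomorphism_def)
  have left: "?\<Psi> (\<Phi> q) = q" if "q \<in> carrier A" for q
    using bij that by (simp add: bij_betw_def)
  have right: "\<Phi> (?\<Psi> q) = q" if "q \<in> carrier B" for q
    using bij that by (simp add: bij_betw_inv_into_right)
  have sub: "chart_dom c \<subseteq> carrier A" "chart_dom d \<subseteq> carrier B"
    using chart_dom_subset_carrier charts by auto
  have p: "?\<Psi> (\<Phi> p) = p"
    using left sub charts by blast
  have "tangent_map (?\<Psi> \<circ> \<Phi>) c c p = id"
    using left sub by (intro tangent_map_eq_id[OF at(1) charts(1,3)]) auto
  then show "tangent_map ?\<Psi> d c (\<Phi> p) \<circ> tangent_map \<Phi> c d p = id"
    using tangent_map_comp[OF at(1,2,1) sm charts(1,2,1,3,4)] p charts by simp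
  have "tangent_map (\<Phi> \<circ> ?\<Psi>) d d (\<Phi> p) = id"
    using right sub by (intro tangent_map_eq_id[OF at(2) charts(2,4)]) auto
  then show "tangent_map \<Phi> c d p \<circ> tangent_map ?\<Psi> d c (\<Phi> p) = id"
    using tangent_map_comp[OF at(2,1,2) sm(2,1) charts(2,1,2,4)] p charts by simp
qed

context
  fixes A :: "'a::topological_space atlas" and B :: "'b::topological_space atlas" and \<Phi> :: "'a \<Rightarrow> 'b"
  assumes at: "smooth_atlas A" "smooth_atlas B" and Phi: "smooth_map A B \<Phi>"
begin

text \<open>Replacing the chosen chart by \<open>d\<close> composes the tangent map with the
  Jacobian of a chart change, which the transformation rule of \<open>\<theta>\<close>
  absorbs.\<close>

lemma pullback_eq:
  assumes "one_form B (carrier B) \<theta>" "c \<in> A" "d \<in> B" "p \<in> chart_dom c" "\<Phi> p \<in> chart_dom d"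
  shows "pullback B \<Phi> \<theta> c p v = \<theta> d (\<Phi> p) (tangent_map \<Phi> c d p v)"
proof -
  define e where "e = (SOME e. e \<in> B \<and> \<Phi> p \<in> chart_dom e)"
  have e: "e \<in> B" "\<Phi> p \<in> chart_dom e"
    using someI[of "\<lambda>e. e \<in> B \<and> \<Phi> p \<in> chart_dom e" d] assms(3,5) by (auto simp: e_def)
  have "\<Phi> p \<in> carrier B"
    using assms(3,5) by (auto simp: carrier_def)
  have "tangent_map \<Phi> c d p = tangent_map id e d (\<Phi> p) \<circ> tangent_map \<Phi> c e p"
    using tangent_map_comp[OF at(1,2,2) Phi smooth_map_id[OF at(2)] assms(2) e(1) assms(3,4) e(2)] assms(5)
    by simp
  then show ?thesis
    using one_form_tangent_map[OF assms(1) e(1) assms(3) e(2) assms(5) \<open>\<Phi> p \<in> carrier B\<close>]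
    by (simp add: pullback_def e_def Let_def)
qed

lemma chart_at_image:
  assumes "p \<in> carrier A"
  obtains d where "d \<in> B" "\<Phi> p \<in> chart_dom d"
  using assms Phi unfolding smooth_map_def carrier_def by blast

lemma one_form_pullback:
  assumes "one_form B (carrier B) \<theta>"
  shows "one_form A (carrier A) (pullback B \<Phi> \<theta>)"
  unfolding one_form_def
proof (intro ballI conjI allI)
  fix c assume c: "c \<in> A"
  show "linear (pullback B \<Phi> \<theta> c p)" if p: "p \<in> chart_dom c \<inter> carrier A" for p
  proof -
    obtain d where d: "d \<in> B" "\<Phi> p \<in> chart_dom d"
      using p by (auto elim: chart_at_image)
    then have "\<Phi> p \<in> carrier B" by (auto simp: carrier_def)
    have "pullback B \<Phi> \<theta> c p = \<theta> d (\<Phi> p) \<circ> tangent_map \<Phi> c d p"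
      using pullback_eq[OF assms c d(1) _ d(2)] p by auto
    then show ?thesis
      using linear_compose[OF linear_tangent_map[OF Phi c d(1) _ d(2)]
          one_form_linear[OF assms d \<open>\<Phi> p \<in> carrier B\<close>]] p by simp
  qed
  show "smooth_on (coords c ` (chart_dom c \<inter> carrier A)) (\<lambda>x. pullback B \<Phi> \<theta> c (chart_inv c x) v)" for v
  \<comment> \<open>The image of a chart domain need not lie in a single chart of \<open>B\<close>,
    so smoothness is checked around each point with its own \<open>d\<close>.\<close>
  proof (rule smooth_on_local)
    fix x assume "x \<in> coords c ` (chart_dom c \<inter> carrier A)"
    then obtain p where p: "x = coords c p" "p \<in> chart_dom c" "p \<in> carrier A" by blast
    obtain d where d: "d \<in> B" "\<Phi> p \<in> chart_dom d"
      using chart_at_image[OF p(3)] .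
    let ?F = "coords d \<circ> \<Phi> \<circ> chart_inv c"
    let ?S = "coords c ` (chart_dom c \<inter> \<Phi> -` chart_dom d)" and ?T = "coords d ` (chart_dom d \<inter> carrier B)"
    define b where "b y = \<theta> d (chart_inv d y)" for y
    have opS: "open ?S" "open ?T"
      by (rule open_coords_image[OF at(1) c open_vimage_chart[OF at Phi c d(1)]], blast)
         (rule open_coords_Int[OF at(2) d(1) open_carrier[OF at(2)]])
    have sub: "chart_dom d \<subseteq> carrier B"
      using d chart_dom_subset_carrier by blast
    have F: "smooth_on ?S ?F"
      by (rule smooth_map_coords[OF Phi c d(1)])
    have FT: "?F ` ?S \<subseteq> ?T"
      using sub by (auto simp: chart_inv_coords[OF at(1) c])
    have bF: "smooth_on ?S (\<lambda>y. b (?F y) w)" for w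
      unfolding b_def using one_form_smooth[OF assms d(1), of w]
      by (rule smooth_on_compose[OF opS FT F])
    have DF: "smooth_on ?S (\<lambda>y. frechet_derivative ?F (at y) v $ i)" for i
      by (rule smooth_on_bounded_linear[OF opS(1) bounded_linear_vec_nth smooth_on_frechet_derivative[OF F]])
    have "smooth_on ?S (\<lambda>x. pullback B \<Phi> \<theta> c (chart_inv c x) v)"
    proof (rule smooth_on_cong[OF opS(1)])
      \<comment> \<open>Smoothness of \<open>\<theta>\<close> is given on fixed vectors only, while
        the image of \<open>v\<close> moves with the point; it is therefore expanded in the standard
        basis.\<close>
      show "smooth_on ?S (\<lambda>y. frechet_derivative ?F (at y) v $ 1 * b (?F y) (ee 1)
          + frechet_derivative ?F (at y) v $ 2 * b (?F y) (ee 2)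
          + frechet_derivative ?F (at y) v $ 3 * b (?F y) (ee 3))"
        by (intro smooth_on_add smooth_on_mult opS(1) bF DF)
      fix y assume "y \<in> ?S"
      then obtain q where q: "y = coords c q" "q \<in> chart_dom c" "\<Phi> q \<in> chart_dom d" by blast
      have lin: "linear (\<theta> d (\<Phi> q))"
        using one_form_linear[OF assms d(1) q(3)] sub q(3) by blast
      have "b (?F y) = \<theta> d (\<Phi> q)"
        using q by (simp add: b_def chart_inv_coords[OF at(1) c] chart_inv_coords[OF at(2) d(1)])
      moreover have "pullback B \<Phi> \<theta> c (chart_inv c y) v = \<theta> d (\<Phi> q) (frechet_derivative ?F (at y) v)"
        using pullback_eq[OF assms c d(1) q(2,3), of v] q(1)
        by (simp add: tangent_map_def chart_inv_coords[OF at(1) c q(2)])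
      ultimately show "frechet_derivative ?F (at y) v $ 1 * b (?F y) (ee 1)
          + frechet_derivative ?F (at y) v $ 2 * b (?F y) (ee 2)
          + frechet_derivative ?F (at y) v $ 3 * b (?F y) (ee 3) = pullback B \<Phi> \<theta> c (chart_inv c y) v"
        using linear_expand3[OF lin, of "frechet_derivative ?F (at y) v"] by simp
    qed
    then show "\<exists>T. open T \<and> x \<in> T \<and> smooth_on T (\<lambda>x. pullback B \<Phi> \<theta> c (chart_inv c x) v)"
      using opS(1) p d by (intro exI[of _ ?S]) auto
  qed
  show "pullback B \<Phi> \<theta> c p v = pullback B \<Phi> \<theta> e p (tangent_map id c e p v)"
    if e: "e \<in> A" and p: "p \<in> chart_dom c \<inter> chart_dom e \<inter> carrier A" for e p v
  proof -
    obtain d where d: "d \<in> B" "\<Phi> p \<in> chart_dom d"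
      using p by (auto elim: chart_at_image)
    have "tangent_map \<Phi> c d p = tangent_map \<Phi> e d p \<circ> tangent_map id c e p"
      using tangent_map_comp[OF at(1,1,2) smooth_map_id[OF at(1)] Phi c e d(1), of p] p d by simp
    then show ?thesis
      using pullback_eq[OF assms c d(1) _ d(2)] pullback_eq[OF assms e d(1) _ d(2)] p by simp
  qed
qed

lemma wedge12_ext_d_pullback:
  assumes "one_form B (carrier B) \<sigma>" "one_form B (carrier B) \<tau>"
    "c \<in> A" "d \<in> B" "p \<in> chart_dom c" "\<Phi> p \<in> chart_dom d"
  shows "wedge12 (pullback B \<Phi> \<sigma>) (ext_d (pullback B \<Phi> \<tau>)) c p u v w =
    wedge12 \<sigma> (ext_d \<tau>) d (\<Phi> p) (tangent_map \<Phi> c d p u) (tangent_map \<Phi> c d p v) (tangent_map \<Phi> c d p w)"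
proof -
  have im: "\<Phi> ` carrier A \<subseteq> carrier B"
    using Phi by (simp add: smooth_map_def)
  have p: "p \<in> carrier A"
    using assms(3,5) by (auto simp: carrier_def)
  have "ext_d (pullback B \<Phi> \<tau>) c p u v =
      ext_d \<tau> d (\<Phi> p) (tangent_map \<Phi> c d p u) (tangent_map \<Phi> c d p v)" for u v
    by (rule ext_d_pullback[OF at Phi open_carrier[OF at(1)] open_carrier[OF at(2)] im assms(2,3,4) _
          assms(5) p assms(6)]) (rule pullback_eq[OF assms(2,3,4)])
  then show ?thesis
    by (simp add: wedge12_def pullback_eq[OF assms(1,3-6)])
qed

lemma relative_sign_pullback:
  assumes "relative_sign B (carrier B) \<theta>1 \<theta>2 \<sigma>1 \<sigma>2 \<delta>"
  shows "relative_sign A (carrier A) (pullback B \<Phi> \<theta>1) (pullback B \<Phi> \<theta>2)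
    (pullback B \<Phi> \<sigma>1) (pullback B \<Phi> \<sigma>2) (\<delta> \<circ> \<Phi>)"
proof -
  obtain f1 f2 where f: "\<forall>p\<in>carrier B. f1 p \<noteq> 0 \<and> f2 p \<noteq> 0 \<and> \<delta> p = sgn (f1 p * f2 p)"
    "eq1 B (carrier B) \<sigma>1 (\<lambda>c p v. f1 p * \<theta>1 c p v)" "eq1 B (carrier B) \<sigma>2 (\<lambda>c p v. f2 p * \<theta>2 c p v)"
    by (rule relative_signE[OF assms])
  have im: "\<Phi> p \<in> carrier B" if "p \<in> carrier A" for p
    using Phi that by (auto simp: smooth_map_def)
  have pb: "eq1 A (carrier A) (pullback B \<Phi> \<sigma>) (\<lambda>c p v. (f \<circ> \<Phi>) p * pullback B \<Phi> \<theta> c p v)"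
    if "eq1 B (carrier B) \<sigma> (\<lambda>c p v. f p * \<theta> c p v)" for \<sigma> \<theta> f
    unfolding eq1_def
  proof (intro ballI ext)
    fix c p v assume "c \<in> A" "p \<in> chart_dom c \<inter> carrier A"
    then obtain d where "d \<in> B" "\<Phi> p \<in> chart_dom d"
      by (auto elim: chart_at_image)
    \<comment> \<open>Both pullbacks evaluate in the same chosen chart, so the factor can be
      compared there directly.\<close>
    then have e: "(SOME d. d \<in> B \<and> \<Phi> p \<in> chart_dom d) \<in> B \<and> \<Phi> p \<in> chart_dom (SOME d. d \<in> B \<and> \<Phi> p \<in> chart_dom d)"
      by (intro someI[of "\<lambda>d. d \<in> B \<and> \<Phi> p \<in> chart_dom d"]) auto
    then have "\<sigma> (SOME d. d \<in> B \<and> \<Phi> p \<in> chart_dom d) (\<Phi> p) =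
        (\<lambda>v. f (\<Phi> p) * \<theta> (SOME d. d \<in> B \<and> \<Phi> p \<in> chart_dom d) (\<Phi> p) v)"
      using that im \<open>p \<in> chart_dom c \<inter> carrier A\<close> unfolding eq1_def by blast
    then show "pullback B \<Phi> \<sigma> c p v = (f \<circ> \<Phi>) p * pullback B \<Phi> \<theta> c p v"
      by (simp add: pullback_def Let_def)
  qed
  show ?thesis
    unfolding relative_sign_def
    by (rule exI[of _ "f1 \<circ> \<Phi>"], rule exI[of _ "f2 \<circ> \<Phi>"], intro conjI pb f(2,3)) (use f(1) im in simp)
qed

end

context
  fixes A :: "'a::topological_space atlas" and B :: "'b::topological_space atlas" and \<Phi> :: "'a \<Rightarrow> 'b"
  assumes at: "smooth_atlas A" "smooth_atlas B" and diffeo: "diffeomorphism A B \<Phi>"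
begin

lemma smooth_map_diffeo: "smooth_map A B \<Phi>"
  using diffeo by (simp add: diffeomorphism_def)

lemma normalised_pullback:
  assumes n: "normalised B (carrier B) \<sigma>1 \<sigma>2"
  shows "normalised A (carrier A) (pullback B \<Phi> \<sigma>1) (pullback B \<Phi> \<sigma>2)"
  unfolding normalised_def
proof (intro conjI ballI allI)
  note sm = smooth_map_diffeo
  have one: "one_form B (carrier B) \<sigma>1" "one_form B (carrier B) \<sigma>2"
    using n by (auto simp: normalised_def)
  show "one_form A (carrier A) (pullback B \<Phi> \<sigma>1)" "one_form A (carrier A) (pullback B \<Phi> \<sigma>2)"
    using one_form_pullback[OF at sm] one by auto
  show "nowhere_zero3 A (carrier A) (contact_volume (pullback B \<Phi> \<sigma>1))"
    unfolding nowhere_zero3_def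
  proof (intro ballI)
    fix c p assume c: "c \<in> A" and p: "p \<in> chart_dom c \<inter> carrier A"
    then obtain d where d: "d \<in> B" "\<Phi> p \<in> chart_dom d"
      by (auto elim: chart_at_image[OF at sm])
    then have "\<Phi> p \<in> chart_dom d \<inter> carrier B" by (auto simp: carrier_def)
    then obtain u v w where nz: "contact_volume \<sigma>1 d (\<Phi> p) u v w \<noteq> 0"
      using n d(1) unfolding normalised_def nowhere_zero3_def by blast
    \<comment> \<open>The vectors on which the volume on \<open>B\<close> is nonzero have to be
      images of tangent vectors at \<open>p\<close>.\<close>
    have "surj (tangent_map \<Phi> c d p)"
      using tangent_map_bij[OF at diffeo c d(1) _ d(2)] p by (auto simp: bij_def)
    then obtain u' v' w' where "u = tangent_map \<Phi> c d p u'" "v = tangent_map \<Phi> c d p v'" "w = tangent_map \<Phi> c d p w'"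
      by (metis surjD)
    then have "contact_volume (pullback B \<Phi> \<sigma>1) c p u' v' w' \<noteq> 0"
      using nz wedge12_ext_d_pullback[OF at sm one(1,1) c d(1) _ d(2), of u' v' w'] p
      by (simp add: contact_volume_def)
    then show "\<exists>u v w. contact_volume (pullback B \<Phi> \<sigma>1) c p u v w \<noteq> 0" by blast
  qed
  fix c p u v w assume c: "c \<in> A" and p: "p \<in> chart_dom c \<inter> carrier A"
  obtain d where d: "d \<in> B" "\<Phi> p \<in> chart_dom d"
    using p by (auto elim: chart_at_image[OF at sm])
  then have "\<Phi> p \<in> chart_dom d \<inter> carrier B" by (auto simp: carrier_def)
  then show "\<bar>contact_volume (pullback B \<Phi> \<sigma>1) c p u v w\<bar> = \<bar>contact_volume (pullback B \<Phi> \<sigma>2) c p u v w\<bar>"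
    using n d(1) wedge12_ext_d_pullback[OF at sm one(1,1) c d(1) _ d(2), of u v w]
      wedge12_ext_d_pullback[OF at sm one(2,2) c d(1) _ d(2), of u v w] p
    by (simp add: contact_volume_def normalised_def)
qed

text \<open>Both three-forms of the quotient are pulled back along the same tangent vectors, so
  their ratio at \<open>p\<close> is the ratio at the image point.\<close>

lemma torsion_quotient_pullback:
  assumes n: "normalised B (carrier B) \<sigma>1 \<sigma>2" and p: "p \<in> carrier A"
  shows "torsion_quotient A (pullback B \<Phi> \<sigma>1) (pullback B \<Phi> \<sigma>2) p = torsion_quotient B \<sigma>1 \<sigma>2 (\<Phi> p)"
proof -
  note sm = smooth_map_diffeo
  have one: "one_form B (carrier B) \<sigma>1" "one_form B (carrier B) \<sigma>2"
    using n by (auto simp: normalised_def)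
  note n' = normalised_pullback[OF n]
  obtain c where c: "c \<in> A" "p \<in> chart_dom c"
    using p by (auto simp: carrier_def)
  obtain d where d: "d \<in> B" "\<Phi> p \<in> chart_dom d"
    using chart_at_image[OF at sm p] .
  then have Phip: "\<Phi> p \<in> carrier B" by (auto simp: carrier_def)
  obtain u v w where nz: "contact_volume (pullback B \<Phi> \<sigma>1) c p u v w \<noteq> 0"
    using n' c p unfolding normalised_def nowhere_zero3_def by blast
  note pb = wedge12_ext_d_pullback[OF at sm _ _ c(1) d(1) c(2) d(2), of _ _ u v w]
  have "cross_volume (pullback B \<Phi> \<sigma>1) (pullback B \<Phi> \<sigma>2) c p u v w =
      2 * torsion_quotient B \<sigma>1 \<sigma>2 (\<Phi> p) * contact_volume (pullback B \<Phi> \<sigma>1) c p u v w"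
    using cross_volume_eq[OF at(2) open_carrier[OF at(2)] n d Phip, of "tangent_map \<Phi> c d p u"
        "tangent_map \<Phi> c d p v" "tangent_map \<Phi> c d p w"]
    by (simp add: cross_volume_def contact_volume_def pb[OF one(1,2)] pb[OF one(2,1)] pb[OF one(1,1)])
  then show ?thesis
    using cross_volume_eq[OF at(1) open_carrier[OF at(1)] n' c p, of u v w] nz by simp
qed

lemma contactomorphism_same_distribution:
  assumes "contactomorphism A B \<eta> \<theta> \<Phi>" "one_form B (carrier B) \<theta>"
  shows "same_distribution A (carrier A) (pullback B \<Phi> \<theta>) \<eta>"
  unfolding same_distribution_def
proof (intro ballI)
  note sm = smooth_map_diffeo
  fix c p assume c: "c \<in> A" and p: "p \<in> chart_dom c \<inter> carrier A"
  then obtain d where d: "d \<in> B" "\<Phi> p \<in> chart_dom d"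
    by (auto elim: chart_at_image[OF at sm])
  have "inj (tangent_map \<Phi> c d p)"
    using tangent_map_bij[OF at diffeo c d(1) _ d(2)] p by (auto simp: bij_def)
  moreover have "tangent_map \<Phi> c d p ` kern \<eta> c p = kern \<theta> d (\<Phi> p)"
    using assms(1) c d p by (simp add: contactomorphism_def)
  ultimately have "tangent_map \<Phi> c d p v \<in> kern \<theta> d (\<Phi> p) \<longleftrightarrow> v \<in> kern \<eta> c p" for v
    by (metis inj_image_mem_iff)
  then show "kern (pullback B \<Phi> \<theta>) c p = kern \<eta> c p"
    using pullback_eq[OF at sm assms(2) c d(1) _ d(2)] p by (auto simp: kern_def)
qed

end

section \<open>The torsion function as a quotient\<close>

lemma structure_equations_cong:
  assumes "structure_equations A U \<epsilon> \<omega>1 \<omega>2 \<omega>3 \<alpha> \<beta>1 \<beta>2 C" "\<And>p. p \<in> U \<Longrightarrow> C p = C' p"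
  shows "structure_equations A U \<epsilon> \<omega>1 \<omega>2 \<omega>3 \<alpha> \<beta>1 \<beta>2 C'"
  using assms unfolding structure_equations_def eq2_def by simp

lemma coframe_torsion_cong:
  assumes "smooth_atlas A" "open U" "coframe_torsion A U \<epsilon> \<omega>1 \<omega>2 \<omega>3 C" "\<And>p. p \<in> U \<Longrightarrow> C p = C' p"
  shows "coframe_torsion A U \<epsilon> \<omega>1 \<omega>2 \<omega>3 C'"
proof -
  obtain \<alpha> \<beta>1 \<beta>2 where forms: "one_form A U \<alpha>" "one_form A U \<beta>1" "one_form A U \<beta>2"
    and se: "structure_equations A U \<epsilon> \<omega>1 \<omega>2 \<omega>3 \<alpha> \<beta>1 \<beta>2 C"
    using assms(3) unfolding coframe_torsion_def by (elim conjE exE)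
  have "structure_equations A U \<epsilon> \<omega>1 \<omega>2 \<omega>3 \<alpha> \<beta>1 \<beta>2 C'"
    by (rule structure_equations_cong[OF se]) (rule assms(4))
  moreover have "smooth_function A U C'"
    by (rule smooth_function_cong[OF assms(1,2) conjunct1[OF assms(3)[unfolded coframe_torsion_def]]])
       (rule assms(4))
  ultimately show ?thesis
    unfolding coframe_torsion_def using forms by (intro conjI exI)
qed

text \<open>Phrased as an elimination rule, since it is applied to both manifolds; it makes
  existence, uniqueness, smoothness and invariance of the torsion statements about one quotient.
  From left to right an adapted coframe containing the normalised pair is needed; from right to left
  every adapted coframe is compared with that pair by its relative sign.\<close>

lemma torsion_function_iff:
  assumes A: "smooth_atlas A" and bc: "bi_contact A \<eta>1 \<eta>2"
  obtains \<omega>1 where "normalised A (carrier A) \<omega>1 \<eta>2" "relative_sign A (carrier A) \<eta>1 \<eta>2 \<omega>1 \<eta>2 (\<lambda>_. 1)"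
    "same_distribution A (carrier A) \<omega>1 \<eta>1" "\<And>c p. c \<in> A \<Longrightarrow> p \<in> chart_dom c \<Longrightarrow> kern \<omega>1 c p \<noteq> kern \<eta>2 c p"
    "\<And>C. torsion_function A \<eta>1 \<eta>2 C \<longleftrightarrow> (\<forall>p\<in>carrier A. C p = torsion_quotient A \<omega>1 \<eta>2 p)"
proof -
  let ?M = "carrier A"
  have M: "open ?M" by (rule open_carrier[OF A])
  have cf: "contact_form A ?M \<eta>1" "contact_form A ?M \<eta>2"
    and ker: "\<And>c p. c \<in> A \<Longrightarrow> p \<in> chart_dom c \<Longrightarrow> kern \<eta>1 c p \<noteq> kern \<eta>2 c p"
    using bc unfolding bi_contact_def by blast+
  have one: "one_form A ?M \<eta>1" "one_form A ?M \<eta>2" and nv: "nonvanishing A ?M \<eta>1" "nonvanishing A ?M \<eta>2"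
    using cf nonvanishing_wedge12 unfolding contact_form_def by blast+
  obtain h where h: "\<forall>p\<in>?M \<inter> ?M. h p > 0" "normalised A ?M (\<lambda>c p v. h p * \<eta>1 c p v) \<eta>2"
    using normalised_scale[OF A M cf] by blast
  define \<omega>1 where "\<omega>1 = (\<lambda>c p v. h p * \<eta>1 c p v)"
  have n: "normalised A ?M \<omega>1 \<eta>2"
    using h(2) by (simp add: \<omega>1_def)
  have rs: "relative_sign A ?M \<eta>1 \<eta>2 \<omega>1 \<eta>2 (\<lambda>_. 1)"
    unfolding \<omega>1_def using h(1) by (intro relative_sign_scale) auto
  have kern_eq: "kern \<omega>1 c p = kern \<eta>1 c p" if "c \<in> A" "p \<in> chart_dom c" for c p
  proof -
    have "h p > 0" using h(1) that by (auto simp: carrier_def)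
    then show ?thesis by (simp add: kern_def \<omega>1_def)
  qed
  have same: "same_distribution A ?M \<omega>1 \<eta>1"
    using kern_eq by (simp add: same_distribution_def)
  have ker1: "kern \<omega>1 c p \<noteq> kern \<eta>2 c p" if "c \<in> A" "p \<in> chart_dom c" for c p
    using kern_eq[OF that] ker[OF that] by simp
  have "torsion_function A \<eta>1 \<eta>2 C \<longleftrightarrow> (\<forall>p\<in>?M. C p = torsion_quotient A \<omega>1 \<eta>2 p)" for C
  proof
    assume tf: "torsion_function A \<eta>1 \<eta>2 C"
    show "\<forall>p\<in>?M. C p = torsion_quotient A \<omega>1 \<eta>2 p"
    proof
      fix p assume p: "p \<in> ?M"
      have "same_distribution A ?M \<eta>2 \<eta>2" by (simp add: same_distribution_def)
      then obtain U \<epsilon> \<omega>3 where U: "open_in_manifold A U" "p \<in> U" "adapted_coframe A \<eta>1 \<eta>2 U \<epsilon> \<omega>1 \<eta>2 \<omega>3"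
        using exists_adapted_coframe[OF A n ker1 same _ p] by blast
      then obtain \<delta> where d: "relative_sign A U \<eta>1 \<eta>2 \<omega>1 \<eta>2 \<delta>"
        "coframe_torsion A U \<epsilon> \<omega>1 \<eta>2 \<omega>3 (\<lambda>p. \<delta> p * C p)"
        using tf unfolding torsion_function_def by blast
      have UM: "U \<subseteq> ?M" "open U"
        using U(1) by (auto simp: open_in_manifold_def)
      have nvU: "nonvanishing A U \<eta>1" "nonvanishing A U \<eta>2"
        using nv UM(1) unfolding nonvanishing_def by blast+
      \<comment> \<open>The definition provides some sign for this coframe. As \<omega>1 is a
        positive multiple of \<eta>1 and the second form is unchanged, the sign has to be 1.\<close>
      have "\<delta> p = 1"
        by (rule relative_sign_unique[OF d(1) relative_sign_subset[OF rs UM(1)] nvU U(2) p])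
      then show "C p = torsion_quotient A \<omega>1 \<eta>2 p"
        using coframe_torsion_eq_quotient[OF A UM(2) U(3) d(2) U(2) p] by simp
    qed
  next
    assume C: "\<forall>p\<in>?M. C p = torsion_quotient A \<omega>1 \<eta>2 p"
    show "torsion_function A \<eta>1 \<eta>2 C"
      unfolding torsion_function_def
    proof (intro allI impI, elim conjE)
      fix U \<epsilon> \<sigma>1 \<sigma>2 \<sigma>3
      assume oU: "open_in_manifold A U" and ad: "adapted_coframe A \<eta>1 \<eta>2 U \<epsilon> \<sigma>1 \<sigma>2 \<sigma>3"
      have UM: "U \<subseteq> ?M" "open U"
        using oU by (auto simp: open_in_manifold_def)
      have nvU: "nonvanishing A U \<eta>1" "nonvanishing A U \<eta>2"
        using nv UM(1) unfolding nonvanishing_def by blast+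
      note n' = adapted_coframe_normalised[OF A UM(2) ad]
      have oneU: "one_form A U \<sigma>1" "one_form A U \<sigma>2" and sd: "same_distribution A U \<sigma>1 \<eta>1" "same_distribution A U \<sigma>2 \<eta>2"
        using ad unfolding adapted_coframe_def by blast+
      obtain \<delta> where d: "relative_sign A U \<eta>1 \<eta>2 \<sigma>1 \<sigma>2 \<delta>"
        using same_distribution_relative_sign[OF oneU one_form_subset[OF one(1) UM(1)]
            one_form_subset[OF one(2) UM(1)] nvU sd UM(1)] by blast
      \<comment> \<open>The sign against the given forms is also the sign against the normalised
        pair, the latter being a positive rescaling.\<close>
      have "relative_sign A U \<omega>1 \<eta>2 \<sigma>1 \<sigma>2 (\<lambda>p. 1 * \<delta> p)"
        by (rule relative_sign_trans[OF relative_sign_sym[OF relative_sign_subset[OF rs UM(1)]] d])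
      then have "torsion_quotient A \<sigma>1 \<sigma>2 p = \<delta> p * C p" if "p \<in> U" for p
        using torsion_quotient_relative_sign[OF A UM(2) normalised_subset[OF n UM(1)] n', of "\<lambda>p. 1 * \<delta> p" p]
          that UM(1) C by auto
      then have "coframe_torsion A U \<epsilon> \<sigma>1 \<sigma>2 \<sigma>3 (\<lambda>p. \<delta> p * C p)"
        by (rule coframe_torsion_cong[OF A UM(2) adapted_coframe_torsion[OF A UM(2) ad]])
      with d show "\<exists>\<delta>. relative_sign A U \<eta>1 \<eta>2 \<sigma>1 \<sigma>2 \<delta> \<and> coframe_torsion A U \<epsilon> \<sigma>1 \<sigma>2 \<sigma>3 (\<lambda>p. \<delta> p * C p)"
        by blast
    qed
  qed
  with n rs same ker1 show ?thesis by (rule that)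
qed

section \<open>Taut contact circles and hyperbolas\<close>

lemma relative_sign_nonzero:
  assumes "relative_sign A U \<eta>1 \<eta>2 \<omega>1 \<omega>2 \<delta>" "p \<in> U"
  shows "\<delta> p \<noteq> 0"
  using assms(1) by (rule relative_signE) (use assms(2) in \<open>auto simp: sgn_if\<close>)

text \<open>The coefficients are constants, so no derivative of them enters, and the contact volume
  is a quadratic form in \<open>r\<close> and \<open>s\<close>.\<close>

lemma contact_volume_lin_comb:
  assumes A: "smooth_atlas A" and U: "open U" and one: "one_form A U \<omega>1" "one_form A U \<omega>2"
    and c: "c \<in> A" "p \<in> chart_dom c" "p \<in> U"
  shows "contact_volume (lin_comb r s \<omega>1 \<omega>2) c p u v w =
    r\<^sup>2 * contact_volume \<omega>1 c p u v w + r * s * cross_volume \<omega>1 \<omega>2 c p u v w + s\<^sup>2 * contact_volume \<omega>2 c p u v w"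
proof -
  have x: "coords c p \<in> coords c ` (chart_dom c \<inter> U)"
    using c by blast
  have d: "(\<lambda>y. \<omega> c (chart_inv c y) v) differentiable (at (coords c p))" if "one_form A U \<omega>" for \<omega> v
    by (rule smooth_on_differentiable[OF one_form_smooth[OF that c(1)] x])
  have e: "ext_d (lin_comb r s \<omega>1 \<omega>2) c p u v = r * ext_d \<omega>1 c p u v + s * ext_d \<omega>2 c p u v" for u v
    unfolding ext_d_coord_d lin_comb_def by (rule coord_d_lin_comb[OF d[OF one(1)] d[OF one(2)]])
  have l: "lin_comb r s \<omega>1 \<omega>2 c p u = r * \<omega>1 c p u + s * \<omega>2 c p u" for u
    by (simp add: lin_comb_def)
  show ?thesis
    unfolding contact_volume_def cross_volume_def wedge12_def e l by algebra
qed

lemma taut_contact_circle_normalised: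
  assumes A: "smooth_atlas A" and U: "open U" and taut: "taut_contact_circle A U \<omega>1 \<omega>2"
  shows "normalised A U \<omega>1 \<omega>2" "c \<in> A \<Longrightarrow> p \<in> chart_dom c \<Longrightarrow> p \<in> U \<Longrightarrow> cross_volume \<omega>1 \<omega>2 c p u v w = 0"
proof -
  have cf: "contact_form A U (lin_comb r s \<omega>1 \<omega>2)" if "r\<^sup>2 + s\<^sup>2 = 1" for r s
    using taut that by (simp add: taut_contact_circle_def)
  have cv: "contact_volume (lin_comb r s \<omega>1 \<omega>2) c p = contact_volume \<omega>1 c p"
    if "r\<^sup>2 + s\<^sup>2 = 1" "c \<in> A" "p \<in> chart_dom c" "p \<in> U" for r s c p
  proof -
    have "eq3 A U (contact_volume (lin_comb r s \<omega>1 \<omega>2)) (contact_volume (lin_comb 1 0 \<omega>1 \<omega>2))"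
      using taut that(1) by (simp add: taut_contact_circle_def)
    then show ?thesis
      using that by (simp add: eq3_def lin_comb_def)
  qed
  have f1: "contact_form A U \<omega>1" and f2: "contact_form A U \<omega>2"
    using cf[of 1 0] cf[of 0 1] by (simp_all add: lin_comb_def)
  have cv2: "contact_volume \<omega>2 c p = contact_volume \<omega>1 c p" if "c \<in> A" "p \<in> chart_dom c" "p \<in> U" for c p
    using cv[of 0 1, OF _ that] by (simp add: lin_comb_def)
  show "normalised A U \<omega>1 \<omega>2"
    using f1 f2 cv2 by (simp add: normalised_def contact_form_def contact_volume_def)
  show "cross_volume \<omega>1 \<omega>2 c p u v w = 0" if p: "c \<in> A" "p \<in> chart_dom c" "p \<in> U"
  proof -
    have h: "(1 / sqrt 2)\<^sup>2 = (1 / 2 :: real)" by (simp add: power_divide)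
    \<comment> \<open>Both axes give the same volume V. At the point of the circle with equal
      coordinates the quadratic form is V + K/2, K being the mixed term, and tautness makes this
      V.\<close>
    have "contact_volume \<omega>1 c p u v w = contact_volume (lin_comb (1 / sqrt 2) (1 / sqrt 2) \<omega>1 \<omega>2) c p u v w"
      using cv[of "1 / sqrt 2" "1 / sqrt 2", OF _ p] h by simp
    also have "\<dots> = (1/2) * contact_volume \<omega>1 c p u v w + (1/2) * cross_volume \<omega>1 \<omega>2 c p u v w
        + (1/2) * contact_volume \<omega>1 c p u v w"
      using contact_volume_lin_comb[OF A U _ _ p, of \<omega>1 \<omega>2 "1 / sqrt 2" "1 / sqrt 2" u v w] f1 f2 h
        cv2[OF p] by (simp add: contact_form_def power2_eq_square)
    finally show ?thesis by simp
  qed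
qed

lemma taut_contact_equilateral_hyperbola_normalised:
  assumes A: "smooth_atlas A" and U: "open U" and taut: "taut_contact_equilateral_hyperbola A U \<omega>1 \<omega>2"
  shows "normalised A U \<omega>1 \<omega>2" "c \<in> A \<Longrightarrow> p \<in> chart_dom c \<Longrightarrow> p \<in> U \<Longrightarrow> cross_volume \<omega>1 \<omega>2 c p u v w = 0"
proof -
  have t: "contact_form A U (lin_comb r s \<omega>1 \<omega>2) \<and>
      eq3 A U (contact_volume (lin_comb r s \<omega>1 \<omega>2)) (\<lambda>c p u v w. k * contact_volume \<omega>1 c p u v w) \<and>
      eq3 A U (contact_volume (lin_comb r s \<omega>1 \<omega>2)) (\<lambda>c p u v w. - k * contact_volume \<omega>2 c p u v w)"
    if "k = 1 \<or> k = -1" "r\<^sup>2 - s\<^sup>2 = k" for k r s :: real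
    using taut that unfolding taut_contact_equilateral_hyperbola_def by blast
  have f1: "contact_form A U \<omega>1" and f2: "contact_form A U \<omega>2"
    using t[of 1 1 0] t[of "-1" 0 1] by (simp_all add: lin_comb_def)
  have cv2: "contact_volume \<omega>1 c p u v w = - contact_volume \<omega>2 c p u v w"
    if "c \<in> A" "p \<in> chart_dom c" "p \<in> U" for c p u v w
    using t[of 1 1 0] that by (simp add: lin_comb_def eq3_def)
  show "normalised A U \<omega>1 \<omega>2"
    using f1 f2 cv2 by (simp add: normalised_def contact_form_def contact_volume_def)
  show "cross_volume \<omega>1 \<omega>2 c p u v w = 0" if p: "c \<in> A" "p \<in> chart_dom c" "p \<in> U"
  proof -
    \<comment> \<open>The axes do not see the mixed term K; the point (sqrt 2, 1) lies on r^2 - s^2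
      = 1 off the axes and gives 2V + sqrt 2 K - V = V.\<close>
    have "contact_volume \<omega>1 c p u v w = contact_volume (lin_comb (sqrt 2) 1 \<omega>1 \<omega>2) c p u v w"
      using t[of 1 "sqrt 2" 1] p by (simp add: eq3_def)
    also have "\<dots> = 2 * contact_volume \<omega>1 c p u v w + sqrt 2 * cross_volume \<omega>1 \<omega>2 c p u v w
        - contact_volume \<omega>1 c p u v w"
      using contact_volume_lin_comb[OF A U _ _ p, of \<omega>1 \<omega>2 "sqrt 2" 1 u v w] f1 f2
        cv2[OF p, of u v w] by (simp add: contact_form_def)
    finally show ?thesis by simp
  qed
qed

lemma torsion_quotient_eq_0:
  assumes A: "smooth_atlas A" and U: "open U" and n: "normalised A U \<omega>1 \<omega>2"
    and z: "\<And>c u v w. c \<in> A \<Longrightarrow> p \<in> chart_dom c \<Longrightarrow> cross_volume \<omega>1 \<omega>2 c p u v w = 0"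
    and p: "p \<in> U" "p \<in> carrier A"
  shows "torsion_quotient A \<omega>1 \<omega>2 p = 0"
proof -
  obtain c where c: "c \<in> A" "p \<in> chart_dom c"
    using p by (auto simp: carrier_def)
  obtain u v w where "contact_volume \<omega>1 c p u v w \<noteq> 0"
    using n c p unfolding normalised_def nowhere_zero3_def by blast
  then show ?thesis
    using cross_volume_eq[OF A U n c p(1), of u v w] z[OF c, of u v w] by simp
qed

lemma contact_form_lin_combI:
  assumes A: "smooth_atlas A" and U: "open U" and one: "one_form A U \<omega>1" "one_form A U \<omega>2"
    and nz: "nowhere_zero3 A U (contact_volume \<omega>1)"
    and cv: "\<And>c p u v w. c \<in> A \<Longrightarrow> p \<in> chart_dom c \<Longrightarrow> p \<in> U \<Longrightarrow>
      contact_volume (lin_comb r s \<omega>1 \<omega>2) c p u v w = k * contact_volume \<omega>1 c p u v w" and "k \<noteq> 0"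
  shows "contact_form A U (lin_comb r s \<omega>1 \<omega>2)"
  unfolding contact_form_def
proof
  show "one_form A U (lin_comb r s \<omega>1 \<omega>2)"
    by (rule one_form_lin_comb[OF A U one])
  show "nowhere_zero3 A U (wedge12 (lin_comb r s \<omega>1 \<omega>2) (ext_d (lin_comb r s \<omega>1 \<omega>2)))"
    using nz cv \<open>k \<noteq> 0\<close> unfolding contact_volume_def[symmetric] nowhere_zero3_def by simp
qed

text \<open>Without mixed term the contact volume of r \<omega>1 + s \<omega>2 is r^2 - \<epsilon>
  s^2 times that of \<omega>1. Its level curves are circles or equilateral hyperbolas according to
  the sign \<open>\<epsilon>\<close>.\<close>

lemma taut_if_cross_volume_eq_0:
  assumes A: "smooth_atlas A" and U: "open U" and one: "one_form A U \<omega>1" "one_form A U \<omega>2"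
    and nz: "nowhere_zero3 A U (contact_volume \<omega>1)"
    and cross: "\<And>c p u v w. c \<in> A \<Longrightarrow> p \<in> chart_dom c \<Longrightarrow> p \<in> U \<Longrightarrow> cross_volume \<omega>1 \<omega>2 c p u v w = 0"
    and vol: "\<And>c p u v w. c \<in> A \<Longrightarrow> p \<in> chart_dom c \<Longrightarrow> p \<in> U \<Longrightarrow>
      contact_volume \<omega>2 c p u v w = - \<epsilon> * contact_volume \<omega>1 c p u v w"
  shows "\<epsilon> = -1 \<Longrightarrow> taut_contact_circle A U \<omega>1 \<omega>2"
    and "\<epsilon> = 1 \<Longrightarrow> taut_contact_equilateral_hyperbola A U \<omega>1 \<omega>2"
proof -
  have cv: "contact_volume (lin_comb r s \<omega>1 \<omega>2) c p u v w = (r\<^sup>2 - \<epsilon> * s\<^sup>2) * contact_volume \<omega>1 c p u v w"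
    if "c \<in> A" "p \<in> chart_dom c" "p \<in> U" for r s c p u v w
    using contact_volume_lin_comb[OF A U one that, of r s u v w] cross[OF that] vol[OF that]
    by (simp add: algebra_simps)
  show "taut_contact_circle A U \<omega>1 \<omega>2" if "\<epsilon> = -1"
    unfolding taut_contact_circle_def
  proof (intro conjI allI impI)
    show "contact_form A U (lin_comb r s \<omega>1 \<omega>2)" if "r\<^sup>2 + s\<^sup>2 = 1" for r s
      using that \<open>\<epsilon> = -1\<close> by (intro contact_form_lin_combI[OF A U one nz cv]) auto
    show "eq3 A U (contact_volume (lin_comb r s \<omega>1 \<omega>2)) (contact_volume (lin_comb r' s' \<omega>1 \<omega>2))"
      if "r\<^sup>2 + s\<^sup>2 = 1 \<and> r'\<^sup>2 + s'\<^sup>2 = 1" for r s r' s'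
      using that \<open>\<epsilon> = -1\<close> cv unfolding eq3_def by (simp add: fun_eq_iff)
  qed
  show "taut_contact_equilateral_hyperbola A U \<omega>1 \<omega>2" if "\<epsilon> = 1"
    unfolding taut_contact_equilateral_hyperbola_def
  proof (intro ballI conjI allI impI)
    fix k r s :: real assume k: "k \<in> {1, -1}" and rs: "r\<^sup>2 - s\<^sup>2 = k"
    show "contact_form A U (lin_comb r s \<omega>1 \<omega>2)"
      using k rs \<open>\<epsilon> = 1\<close> by (intro contact_form_lin_combI[OF A U one nz cv]) auto
    show "eq3 A U (contact_volume (lin_comb r s \<omega>1 \<omega>2)) (\<lambda>c p u v w. k * contact_volume \<omega>1 c p u v w)"
      using rs \<open>\<epsilon> = 1\<close> cv unfolding eq3_def by (simp add: fun_eq_iff)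
    show "eq3 A U (contact_volume (lin_comb r s \<omega>1 \<omega>2)) (\<lambda>c p u v w. - k * contact_volume \<omega>2 c p u v w)"
      using rs \<open>\<epsilon> = 1\<close> cv vol unfolding eq3_def by (simp add: fun_eq_iff)
  qed
qed

theorem proposition1:
  fixes A :: "'a::{second_countable_topology, t2_space} atlas"
    and \<eta>1 \<eta>2 :: "'a form1"
  assumes "smooth_atlas A"
    and "bi_contact A \<eta>1 \<eta>2"
  shows "(\<exists>C. torsion_function A \<eta>1 \<eta>2 C \<and>
            (\<forall>C'. torsion_function A \<eta>1 \<eta>2 C' \<longrightarrow> (\<forall>p\<in>carrier A. C' p = C p))) \<and>
         (\<forall>C. torsion_function A \<eta>1 \<eta>2 C \<longrightarrow>
            smooth_function A (carrier A) C \<and>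
            (\<forall>(B :: 'b::{second_countable_topology, t2_space} atlas) \<theta>1 \<theta>2 C' \<Phi>.
               smooth_atlas B \<and> bi_contact B \<theta>1 \<theta>2 \<and> torsion_function B \<theta>1 \<theta>2 C' \<and>
               bi_contactomorphism A B \<eta>1 \<eta>2 \<theta>1 \<theta>2 \<Phi> \<longrightarrow>
               (\<exists>\<delta>. relative_sign A (carrier A) \<eta>1 \<eta>2
                      (pullback B \<Phi> \<theta>1) (pullback B \<Phi> \<theta>2) \<delta> \<and>
                    (\<forall>p\<in>carrier A. C' (\<Phi> p) = \<delta> p * C p))) \<and>
            (\<forall>p\<in>carrier A.
               (\<exists>U. open_in_manifold A U \<and> p \<in> U \<and> (\<forall>q\<in>U. C q = 0)) \<longleftrightarrow>
               locally_taut A \<eta>1 \<eta>2 p))"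
proof -
  note A = assms(1)
  let ?M = "carrier A"
  have M: "open ?M" by (rule open_carrier[OF A])
  have cf: "contact_form A ?M \<eta>1" "contact_form A ?M \<eta>2"
    using assms(2) unfolding bi_contact_def by blast+
  have one: "one_form A ?M \<eta>1" "one_form A ?M \<eta>2" and nv: "nonvanishing A ?M \<eta>1" "nonvanishing A ?M \<eta>2"
    using cf nonvanishing_wedge12 unfolding contact_form_def by blast+
  obtain \<omega>1 where n: "normalised A ?M \<omega>1 \<eta>2" and rs: "relative_sign A ?M \<eta>1 \<eta>2 \<omega>1 \<eta>2 (\<lambda>_. 1)"
    and same: "same_distribution A ?M \<omega>1 \<eta>1"
    and ker: "\<And>c p. c \<in> A \<Longrightarrow> p \<in> chart_dom c \<Longrightarrow> kern \<omega>1 c p \<noteq> kern \<eta>2 c p"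
    and tf: "\<And>C. torsion_function A \<eta>1 \<eta>2 C \<longleftrightarrow> (\<forall>p\<in>?M. C p = torsion_quotient A \<omega>1 \<eta>2 p)"
    by (rule torsion_function_iff[OF assms]) (rule that; (assumption | blast))
  show ?thesis
  proof (intro conjI allI impI ballI)
    show "\<exists>C. torsion_function A \<eta>1 \<eta>2 C \<and>
        (\<forall>C'. torsion_function A \<eta>1 \<eta>2 C' \<longrightarrow> (\<forall>p\<in>carrier A. C' p = C p))"
      by (rule exI[of _ "torsion_quotient A \<omega>1 \<eta>2"]) (simp add: tf)
  next
    fix C assume "torsion_function A \<eta>1 \<eta>2 C"
    then have C: "C p = torsion_quotient A \<omega>1 \<eta>2 p" if "p \<in> ?M" for p
      using that by (simp add: tf)
    then show "smooth_function A ?M C"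
      by (intro smooth_function_cong[OF A M smooth_torsion_quotient[OF A M n]]) simp
  next
    fix C B \<theta>1 \<theta>2 C' and \<Phi> :: "'a \<Rightarrow> 'b"
    assume "torsion_function A \<eta>1 \<eta>2 C"
    then have C: "C p = torsion_quotient A \<omega>1 \<eta>2 p" if "p \<in> ?M" for p
      using that by (simp add: tf)
    assume h: "smooth_atlas B \<and> bi_contact B \<theta>1 \<theta>2 \<and> torsion_function B \<theta>1 \<theta>2 C' \<and>
      bi_contactomorphism A B \<eta>1 \<eta>2 \<theta>1 \<theta>2 \<Phi>"
    then have B: "smooth_atlas B" and bc: "bi_contact B \<theta>1 \<theta>2" and tf': "torsion_function B \<theta>1 \<theta>2 C'"
      and co: "contactomorphism A B \<eta>1 \<theta>1 \<Phi>" "contactomorphism A B \<eta>2 \<theta>2 \<Phi>"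
      by (auto simp: bi_contactomorphism_def)
    have diffeo: "diffeomorphism A B \<Phi>"
      using co(1) by (simp add: contactomorphism_def)
    note sm = smooth_map_diffeo[OF A B diffeo]
    have oneB: "one_form B (carrier B) \<theta>1" "one_form B (carrier B) \<theta>2"
      using bc by (auto simp: bi_contact_def contact_form_def)
    obtain \<sigma>1 where nB: "normalised B (carrier B) \<sigma>1 \<theta>2"
      and rsB: "relative_sign B (carrier B) \<theta>1 \<theta>2 \<sigma>1 \<theta>2 (\<lambda>_. 1)"
      and tB: "\<And>C. torsion_function B \<theta>1 \<theta>2 C \<longleftrightarrow> (\<forall>p\<in>carrier B. C p = torsion_quotient B \<sigma>1 \<theta>2 p)"
      by (rule torsion_function_iff[OF B bc]) (rule that; (assumption | blast))
    note onep = one_form_pullback[OF A B sm oneB(1)] one_form_pullback[OF A B sm oneB(2)]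
    obtain \<delta> where d: "relative_sign A ?M \<eta>1 \<eta>2 (pullback B \<Phi> \<theta>1) (pullback B \<Phi> \<theta>2) \<delta>"
      using same_distribution_relative_sign[OF onep one nv
          contactomorphism_same_distribution[OF A B diffeo co(1) oneB(1)]
          contactomorphism_same_distribution[OF A B diffeo co(2) oneB(2)]] by blast
    \<comment> \<open>Three comparisons in a row: back from \<omega>1 to \<eta>1 with sign 1, on to
      the pulled back forms with sign \<delta>, and then to the pulled back normalised pair with
      sign 1.\<close>
    have rel: "relative_sign A ?M \<omega>1 \<eta>2 (pullback B \<Phi> \<sigma>1) (pullback B \<Phi> \<theta>2)
        (\<lambda>p. 1 * \<delta> p * ((\<lambda>_. 1) \<circ> \<Phi>) p)"
      by (rule relative_sign_trans[OF relative_sign_trans[OF relative_sign_sym[OF rs] d]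
            relative_sign_pullback[OF A B sm rsB]])
    have "C' (\<Phi> p) = \<delta> p * C p" if p: "p \<in> ?M" for p
    proof -
      have "\<Phi> p \<in> carrier B"
        using sm p by (auto simp: smooth_map_def)
      then have "C' (\<Phi> p) = torsion_quotient B \<sigma>1 \<theta>2 (\<Phi> p)"
        using tf' by (simp add: tB)
      also have "\<dots> = torsion_quotient A (pullback B \<Phi> \<sigma>1) (pullback B \<Phi> \<theta>2) p"
        by (rule torsion_quotient_pullback[OF A B diffeo nB p, symmetric])
      also have "\<dots> = \<delta> p * torsion_quotient A \<omega>1 \<eta>2 p"
        using torsion_quotient_relative_sign[OF A M n normalised_pullback[OF A B diffeo nB] rel p p] by simp
      finally show ?thesis by (simp add: C[OF p])
    qed
    with d show "\<exists>\<delta>. relative_sign A ?M \<eta>1 \<eta>2 (pullback B \<Phi> \<theta>1) (pullback B \<Phi> \<theta>2) \<delta> \<and>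
        (\<forall>p\<in>?M. C' (\<Phi> p) = \<delta> p * C p)"
      by blast
  next
    fix C p assume "torsion_function A \<eta>1 \<eta>2 C" and p: "p \<in> ?M"
    then have C: "C p = torsion_quotient A \<omega>1 \<eta>2 p" if "p \<in> ?M" for p
      using that by (simp add: tf)
    show "(\<exists>U. open_in_manifold A U \<and> p \<in> U \<and> (\<forall>q\<in>U. C q = 0)) \<longleftrightarrow> locally_taut A \<eta>1 \<eta>2 p"
    proof
      assume "\<exists>U. open_in_manifold A U \<and> p \<in> U \<and> (\<forall>q\<in>U. C q = 0)"
      then obtain U where U: "open U" "U \<subseteq> ?M" "p \<in> U" "\<And>q. q \<in> U \<Longrightarrow> C q = 0"
        by (auto simp: open_in_manifold_def)
      have same2: "same_distribution A ?M \<eta>2 \<eta>2" by (simp add: same_distribution_def)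
      \<comment> \<open>\<open>normalised\<close> leaves \<epsilon> open, but \<epsilon> decides
        between circle and hyperbola; an adapted coframe makes it constant near
        \<open>p\<close>.\<close>
      obtain U' \<epsilon> \<omega>3 where U': "open U'" "p \<in> U'" "adapted_coframe A \<eta>1 \<eta>2 U' \<epsilon> \<omega>1 \<eta>2 \<omega>3"
        using exists_adapted_coframe[OF A n ker same same2 p] by (auto simp: open_in_manifold_def)
      have e: "\<epsilon> = 1 \<or> \<epsilon> = -1"
        using U'(3) unfolding adapted_coframe_def by blast
      let ?W = "U \<inter> U'"
      have W: "open ?W" "?W \<subseteq> ?M" using U U' by auto
      have nW: "normalised A ?W \<omega>1 \<eta>2" by (rule normalised_subset[OF n W(2)])
      have oneW: "one_form A ?W \<omega>1" "one_form A ?W \<eta>2" and nzW: "nowhere_zero3 A ?W (contact_volume \<omega>1)"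
        using nW by (auto simp: normalised_def)
      have cross: "cross_volume \<omega>1 \<eta>2 c q u v w = 0" if "c \<in> A" "q \<in> chart_dom c" "q \<in> ?W" for c q u v w
        using cross_volume_eq[OF A M n that(1,2), of u v w] C[of q] U(4)[of q] that(3) U(2) by auto
      have vol: "contact_volume \<eta>2 c q u v w = - \<epsilon> * contact_volume \<omega>1 c q u v w"
        if q: "c \<in> A" "q \<in> chart_dom c" "q \<in> ?W" for c q u v w
      proof -
        have q': "q \<in> chart_dom c \<inter> U'" using q by blast
        have 1: "contact_volume \<omega>1 c q = wedge12 \<omega>1 (wedge11 \<eta>2 \<omega>3) c q"
          using U'(3) q(1) q' unfolding adapted_coframe_def eq3_def contact_volume_def by blast
        have 2: "(\<lambda>u v w. - \<epsilon> * contact_volume \<eta>2 c q u v w) = wedge12 \<omega>1 (wedge11 \<eta>2 \<omega>3) c q"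
          using U'(3) q(1) q' unfolding adapted_coframe_def eq3_def contact_volume_def by blast
        have "contact_volume \<omega>1 c q u v w = - \<epsilon> * contact_volume \<eta>2 c q u v w"
          unfolding 1 2[symmetric] ..
        then show ?thesis using e by auto
      qed
      have "taut_contact_circle A ?W \<omega>1 \<eta>2 \<or> taut_contact_equilateral_hyperbola A ?W \<omega>1 \<eta>2"
        using taut_if_cross_volume_eq_0[OF A W(1) oneW nzW cross vol] e by blast
      moreover have "same_distribution A ?W \<omega>1 \<eta>1" "same_distribution A ?W \<eta>2 \<eta>2"
        using same same2 W(2) unfolding same_distribution_def by blast+
      ultimately show "locally_taut A \<eta>1 \<eta>2 p"
        unfolding locally_taut_def open_in_manifold_def using W U(3) U'(2) by blast
    next
      assume "locally_taut A \<eta>1 \<eta>2 p"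
      then obtain U \<sigma>1 \<sigma>2 where oU: "open_in_manifold A U" and pU: "p \<in> U"
        and sd: "same_distribution A U \<sigma>1 \<eta>1" "same_distribution A U \<sigma>2 \<eta>2"
        and taut: "taut_contact_circle A U \<sigma>1 \<sigma>2 \<or> taut_contact_equilateral_hyperbola A U \<sigma>1 \<sigma>2"
        unfolding locally_taut_def by blast
      have U: "open U" "U \<subseteq> ?M"
        using oU by (auto simp: open_in_manifold_def)
      \<comment> \<open>The contact volumes of a taut pair are equal or opposite, so it can be
        compared with the pair \<omega>1, \<eta>2 although it comes with no third form.\<close>
      have nU: "normalised A U \<sigma>1 \<sigma>2"
        using taut taut_contact_circle_normalised(1)[OF A U(1)]
          taut_contact_equilateral_hyperbola_normalised(1)[OF A U(1)] by blast
      have cross: "cross_volume \<sigma>1 \<sigma>2 c q u v w = 0" if "q \<in> U" "c \<in> A" "q \<in> chart_dom c" for c q u v w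
        using taut taut_contact_circle_normalised(2)[OF A U(1) _ that(2,3,1)]
          taut_contact_equilateral_hyperbola_normalised(2)[OF A U(1) _ that(2,3,1)] by blast
      have oneU: "one_form A U \<sigma>1" "one_form A U \<sigma>2"
        using nU by (auto simp: normalised_def)
      have nvU: "nonvanishing A U \<eta>1" "nonvanishing A U \<eta>2"
        using nv U(2) unfolding nonvanishing_def by blast+
      obtain \<delta> where d: "relative_sign A U \<eta>1 \<eta>2 \<sigma>1 \<sigma>2 \<delta>"
        using same_distribution_relative_sign[OF oneU one_form_subset[OF one(1) U(2)]
            one_form_subset[OF one(2) U(2)] nvU sd U(2)] by blast
      have rel: "relative_sign A U \<omega>1 \<eta>2 \<sigma>1 \<sigma>2 (\<lambda>p. 1 * \<delta> p)"
        by (rule relative_sign_trans[OF relative_sign_sym[OF relative_sign_subset[OF rs U(2)]] d])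
      \<comment> \<open>The mixed term of the taut pair vanishes, hence so does its quotient; the
        quotient of the reference pair differs from it by a nonzero sign only.\<close>
      have "C q = 0" if q: "q \<in> U" for q
      proof -
        have qM: "q \<in> ?M" using q U(2) by blast
        have "0 = torsion_quotient A \<sigma>1 \<sigma>2 q"
          using torsion_quotient_eq_0[OF A U(1) nU cross[OF q] q qM] by simp
        also have "\<dots> = \<delta> q * C q"
          using torsion_quotient_relative_sign[OF A U(1) normalised_subset[OF n U(2)] nU rel q qM]
          by (simp add: C[OF qM])
        finally show ?thesis
          using relative_sign_nonzero[OF d q] by simp
      qed
      with oU pU show "\<exists>U. open_in_manifold A U \<and> p \<in> U \<and> (\<forall>q\<in>U. C q = 0)"
        by blast
    qed
  qed
qed

end
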